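(* Assume there is no wind forcing, i.e. consider, for $t>0$ and $(x,z)\in D=[0,1]^2$ with periodic boundary conditions (period $1$ in $x$ and in $z$) and zero mean for $\psi$ and $\rho$, the system $$\Delta\psi_t + J(\Delta\psi,\psi) = \rho_x + \nu\Delta^2\psi,\qquad \rho_t + J(\rho,\psi) = -N^2\psi_x + \frac{\nu}{Pr}\Delta\rho .$$ Let $\omega=\Delta\psi$ and let the initial data satisfy $(\omega_0,\rho_0)\in V\times V$ (i.e. $\psi_0\in H^3_{per0}$ and $\rho_0\in H^1_{per0}$). Let $(\psi,\rho)$ be the solution with $\psi(0)=\psi_0$, $\rho(0)=\rho_0$. Then $\|\psi(t)\|_{H^3_{per0}}$ and $\|\rho(t)\|_{H^1_{per0}}$ tend to zero exponentially fast as $t\to\infty$; that is, there are constants $C,\kappa>0$ (which may depend on the initial data and the parameters) such that $$\|\psi(t)\|_{H^3_{per0}}+\|\rho(t)\|_{H^1_{per0}}\le C e^{-\kappa t}\qquad\text{for all } t\ge 0.$$ Moreover, there exists a time $T>0$, depending on $Pr$, $N^2$, $\nu$, $\lambda_1$ and the initial values, such that the mean-square norms $\|\nabla\rho(t)\|$ and $\|\nabla\omega(t)\|$ are uniformly bounded for $0\le t\le T$ and decay exponentially for $t>T$.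
   Context: $D=\{(x,z):0\le x,z\le 1\}$ is the periodic domain. $J(a,b)=a_xb_z-a_zb_x$ is the Jacobian and $\Delta=\partial_{xx}+\partial_{zz}$. The unknowns are the stream function $\psi(x,z,t)$ and the density fluctuation $\rho(x,z,t)$; $\omega=\Delta\psi$ is the vorticity. The constants $\nu>0$ (viscosity), $N^2>0$ (mean buoyancy frequency) and $Pr>0$ (Prandtl number) are given. $H=L^2_{per0}$ is the space of functions in $L^2(D)$ that are periodic in $x$ and $z$ and have zero mean, with norm $\|\cdot\|$ (the $L^2$ norm). $V=H^1_{per0}=\{u\in H:\nabla u\in H\}$, $H^2_{per0}=\{u\in H:\nabla u\in H,\Delta u\in H\}$, and $H^k_{per0}$ denotes in the same way the periodic zero-mean Sobolev space of order $k$, with its usual Sobolev norm. $\lambda_1$ is the smallest eigenvalue of $-\Delta$ on $D$ with periodic boundary conditions and zero mean. Solutions are taken in the class $\omega,\rho\in L^\infty(0,S;V)\cap L^2(0,S;H^2_{per0})$ for every $S>0$. *)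

theory Defs
  imports "HOL-Analysis.Analysis"
begin

text \<open>
  Functions on the periodic domain are doubly 1-periodic functions on the plane; integrals and
  norms are taken over one period cell.  Elements of the function spaces below are (Borel)
  representatives: all notions depend on them only up to null sets.
\<close>

type_synonym field = "real \<times> real \<Rightarrow> real"

definition period_cell :: "(real \<times> real) set" where
  "period_cell = {0..1} \<times> {0..1}"

definition periodic :: "field \<Rightarrow> bool" where
  "periodic u \<longleftrightarrow> (\<forall>x z. u (x + 1, z) = u (x, z) \<and> u (x, z + 1) = u (x, z))"

definition L2_inner :: "field \<Rightarrow> field \<Rightarrow> real" where
  "L2_inner u v = (LINT p:period_cell|lborel. u p * v p)"

definition L2_norm :: "field \<Rightarrow> real" where
  "L2_norm u = sqrt (LINT p:period_cell|lborel. (u p)\<^sup>2)"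

definition L2_per0 :: "field set" where
  "L2_per0 = {u. u \<in> borel_measurable lborel \<and> periodic u \<and>
     set_integrable lborel period_cell (\<lambda>p. (u p)\<^sup>2) \<and>
     (LINT p:period_cell|lborel. u p) = 0}"


subsection \<open>Periodic test functions and weak derivatives\<close>

definition pdx :: "field \<Rightarrow> field" where
  "pdx \<phi> = (\<lambda>(x, z). deriv (\<lambda>s. \<phi> (s, z)) x)"

definition pdz :: "field \<Rightarrow> field" where
  "pdz \<phi> = (\<lambda>(x, z). deriv (\<lambda>s. \<phi> (x, s)) z)"

text \<open>Coinductively: all iterated classical partial derivatives exist and are (Frechet)
  differentiable, i.e. the function is infinitely differentiable.\<close>

coinductive smooth :: "field \<Rightarrow> bool" where
  "\<lbrakk>\<forall>p. \<phi> differentiable (at p); smooth (pdx \<phi>); smooth (pdz \<phi>)\<rbrakk> \<Longrightarrow> smooth \<phi>"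

definition test_functions :: "field set" where
  "test_functions = {\<phi>. smooth \<phi> \<and> periodic \<phi>}"

definition weak_dx :: "field \<Rightarrow> field \<Rightarrow> bool" where
  "weak_dx u g \<longleftrightarrow> (\<forall>\<phi>\<in>test_functions. L2_inner u (pdx \<phi>) = - L2_inner g \<phi>)"

definition weak_dz :: "field \<Rightarrow> field \<Rightarrow> bool" where
  "weak_dz u g \<longleftrightarrow> (\<forall>\<phi>\<in>test_functions. L2_inner u (pdz \<phi>) = - L2_inner g \<phi>)"

definition weak_lap :: "field \<Rightarrow> field \<Rightarrow> bool" where
  "weak_lap u g \<longleftrightarrow>
     (\<forall>\<phi>\<in>test_functions. L2_inner u (\<lambda>p. pdx (pdx \<phi>) p + pdz (pdz \<phi>) p) = L2_inner g \<phi>)"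

text \<open>Representatives of the weak derivatives (unique up to null sets); they are meaningful
  only where the corresponding weak derivative exists in \<^const>\<open>L2_per0\<close>.\<close>

definition Dx :: "field \<Rightarrow> field" where
  "Dx u = (SOME g. g \<in> L2_per0 \<and> weak_dx u g)"

definition Dz :: "field \<Rightarrow> field" where
  "Dz u = (SOME g. g \<in> L2_per0 \<and> weak_dz u g)"

definition Lap :: "field \<Rightarrow> field" where
  "Lap u = (SOME g. g \<in> L2_per0 \<and> weak_lap u g)"

definition Jac :: "field \<Rightarrow> field \<Rightarrow> field" where
  "Jac a b = (\<lambda>p. Dx a p * Dz b p - Dz a p * Dx b p)"

definition grad_norm :: "field \<Rightarrow> real" where
  "grad_norm u = sqrt ((L2_norm (Dx u))\<^sup>2 + (L2_norm (Dz u))\<^sup>2)"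


subsection \<open>Sobolev spaces\<close>

primrec H_per0 :: "nat \<Rightarrow> field set" where
  "H_per0 0 = L2_per0"
| "H_per0 (Suc k) =
     {u \<in> L2_per0. (\<exists>g\<in>H_per0 k. weak_dx u g) \<and> (\<exists>g\<in>H_per0 k. weak_dz u g)}"

definition H_norm :: "nat \<Rightarrow> field \<Rightarrow> real" where
  "H_norm k u =
     sqrt (\<Sum>(i, j)\<in>{(i, j). i + j \<le> k}. (L2_norm ((Dx ^^ i) ((Dz ^^ j) u)))\<^sup>2)"

text \<open>The second order space is required to control the gradient and the Laplacian only.  By
  elliptic regularity on the torus its elements have all second derivatives in
  \<^const>\<open>L2_per0\<close>, so it is the same space as \<open>H_per0 2\<close> and \<open>H_norm 2\<close> is meaningful on it.\<close>

definition H2_per0 :: "field set" where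
  "H2_per0 = {u \<in> L2_per0. (\<exists>g\<in>L2_per0. weak_dx u g) \<and> (\<exists>g\<in>L2_per0. weak_dz u g) \<and>
     (\<exists>g\<in>L2_per0. weak_lap u g)}"


subsection \<open>Solutions\<close>

text \<open>\<open>Linf_V S u\<close> and \<open>L2_H2 S u\<close>: \<open>u\<close> belongs to $L^\infty(0,S;H^1_{per0})$ and to
  $L^2(0,S;H^2_{per0})$, respectively.\<close>

definition Linf_V :: "real \<Rightarrow> (real \<Rightarrow> field) \<Rightarrow> bool" where
  "Linf_V S u \<longleftrightarrow>
     (\<exists>M. AE t in lborel. 0 < t \<and> t < S \<longrightarrow> u t \<in> H_per0 1 \<and> H_norm 1 (u t) \<le> M)"

definition L2_H2 :: "real \<Rightarrow> (real \<Rightarrow> field) \<Rightarrow> bool" where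
  "L2_H2 S u \<longleftrightarrow>
     (AE t in lborel. 0 < t \<and> t < S \<longrightarrow> u t \<in> H2_per0) \<and>
     set_integrable lborel {0<..<S} (\<lambda>t. (H_norm 2 (u t))\<^sup>2)"

text \<open>\<open>g\<close> is the time derivative of \<open>u\<close> as a function with values in \<^const>\<open>L2_per0\<close>:
  $u(t) = u(0) + \int_0^t g(s)\,ds$ for all $t \ge 0$, tested in space.  This singles out the
  time-continuous representative of \<open>u\<close>, so that \<open>u t\<close> makes sense for every \<open>t\<close> and initial
  values can be prescribed.\<close>

definition has_time_derivative :: "(real \<Rightarrow> field) \<Rightarrow> (real \<Rightarrow> field) \<Rightarrow> bool" where
  "has_time_derivative u g \<longleftrightarrow>
     (\<forall>t\<ge>0. u t \<in> L2_per0) \<and>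
     (AE t in lborel. 0 < t \<longrightarrow> g t \<in> L2_per0) \<and>
     (\<forall>\<phi>\<in>test_functions. \<forall>t\<ge>0.
        set_integrable lborel {0..t} (\<lambda>s. L2_inner (g s) \<phi>) \<and>
        L2_inner (u t) \<phi> = L2_inner (u 0) \<phi> + (LINT s:{0..t}|lborel. L2_inner (g s) \<phi>))"

definition is_solution ::
  "real \<Rightarrow> real \<Rightarrow> real \<Rightarrow> field \<Rightarrow> field \<Rightarrow> (real \<Rightarrow> field) \<Rightarrow> (real \<Rightarrow> field) \<Rightarrow> bool"
where
  "is_solution \<nu> N Pr \<psi>\<^sub>0 \<rho>\<^sub>0 \<psi> \<rho> \<longleftrightarrow>
     (\<forall>t\<ge>0. \<psi> t \<in> H2_per0 \<and> \<rho> t \<in> L2_per0) \<and>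
     (\<forall>S>0. Linf_V S (\<lambda>t. Lap (\<psi> t)) \<and> L2_H2 S (\<lambda>t. Lap (\<psi> t)) \<and>
            Linf_V S \<rho> \<and> L2_H2 S \<rho>) \<and>
     (\<exists>\<omega>\<^sub>t \<rho>\<^sub>t.
        has_time_derivative (\<lambda>t. Lap (\<psi> t)) \<omega>\<^sub>t \<and>
        has_time_derivative \<rho> \<rho>\<^sub>t \<and>
        (AE t in lborel. 0 < t \<longrightarrow> (AE p in lborel.
           \<omega>\<^sub>t t p + Jac (Lap (\<psi> t)) (\<psi> t) p = Dx (\<rho> t) p + \<nu> * Lap (Lap (\<psi> t)) p \<and>
           \<rho>\<^sub>t t p + Jac (\<rho> t) (\<psi> t) p = - N\<^sup>2 * Dx (\<psi> t) p + \<nu> / Pr * Lap (\<rho> t) p))) \<and>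
     (AE p in lborel. \<psi> 0 p = \<psi>\<^sub>0 p) \<and>
     (AE p in lborel. \<rho> 0 p = \<rho>\<^sub>0 p)"

end

theory Submission
  imports Defs
begin

text \<open>
  The argument runs on the Fourier side. The functions \<open>cos (2 \<pi> k \<cdot> p) + sin (2 \<pi> k \<cdot> p)\<close>, with \<open>k\<close>
  ranging over all pairs of integers, form a real orthonormal basis of the mean-square functions on
  the period cell, and differentiation maps the function of index \<open>k\<close> to a multiple of the one of
  index \<open>- k\<close>. Weak derivatives therefore act on coefficients by multiplication (\<open>weak_dx_iff\<close>,
  \<open>weak_lap_iff\<close>), and \<open>H_per0 m\<close> is described by convergence of \<open>\<Sum> \<lambda>\<^sub>k\<^sup>m c\<^sub>k\<^sup>2\<close> with the
  eigenvalues \<open>\<lambda>\<^sub>k\<close> of the negative Laplacian (\<open>H_per0_iff\<close>). This rests on completeness of the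
  basis (\<open>orth_imp_zero\<close>) and on the theorem of Riesz and Fischer.

  Write \<open>A\<close>, \<open>W\<close>, \<open>P\<close> for the squared norms of \<open>\<nabla>\<psi>\<close>, \<open>\<omega>\<close>, \<open>\<nabla>\<omega>\<close>, write \<open>R\<close>, \<open>Q\<close> for those
  of \<open>\<rho>\<close>, \<open>\<nabla>\<rho>\<close>, and let \<open>\<mu> = \<nu> / Pr\<close>. The Jacobian \<open>J(a,b)\<close> is orthogonal to \<open>a\<close> and to \<open>b\<close>,
  and \<open>\<nabla>\<psi>\<close> is bounded pointwise by a multiple of \<open>\<surd>P\<close> (\<open>jacobian\<close>). Testing the equations
  with \<open>\<psi>\<close>, \<open>\<rho>\<close>, \<open>\<omega>\<close>, \<open>\<Delta>\<rho>\<close> and \<open>\<Delta>\<omega>\<close> gives, with the Poincare inequality,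

    \<open>(N\<^sup>2 A + R)' = - 2 (N\<^sup>2 \<nu> W + \<mu> Q)\<close>,
    \<open>W' \<le> - \<nu> P + Q / (\<nu> \<lambda>\<^sub>1)\<close>,
    \<open>Q' \<le> - \<mu> \<lambda>\<^sub>1 Q + K\<^sub>1 P Q + K\<^sub>2 A\<close>,
    \<open>P' \<le> - \<nu> \<lambda>\<^sub>1 P + K\<^sub>3 P P + K\<^sub>4 Q\<close>.

  The first line makes the basic energy decay and bounds the integrals of \<open>W\<close> and \<open>Q\<close> against an
  exponentially growing weight; the second then bounds the integral of \<open>P\<close>. The nonlinear terms in
  the last two lines are linear in \<open>Q\<close> and in \<open>P\<close> with the integrable factor \<open>P\<close>, so Gronwall's
  inequality yields exponential decay of \<open>Q\<close> and \<open>P\<close> (\<open>decay\<close>), hence of \<open>\<rho>\<close> in the first and of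
  \<open>\<psi>\<close> in the third Sobolev norm. All constants depend on the initial values and the parameters only,
  so they serve all solutions at once, and the decay holds from time zero on.

  The equations hold almost everywhere in time only. Every single coefficient is an absolutely
  continuous function of time, and so is its square; summing the squares with weights, by dominated
  convergence, gives the energy identities (\<open>prim_series\<close>). The same step shows that the weighted
  sums stay finite at every time, which is the regularity of \<open>\<psi> t\<close> and \<open>\<rho> t\<close> claimed for all
  \<open>t \<ge> 0\<close>.
\<close>

section \<open>Mean-square functions on the period cell\<close>

text \<open>A probability measure, so mean-square functions are integrable.\<close>
definition torus :: "(real \<times> real) measure" where
  "torus = restrict_space lborel period_cell"

lemma period_cell_cbox: "period_cell = cbox (0, 0) (1, 1)"
  by (auto simp: period_cell_def cbox_Pair_eq)

lemma period_cell_borel [measurable, simp]: "period_cell \<in> sets borel"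
  by (simp add: period_cell_cbox)

lemma space_torus [simp]: "space torus = period_cell"
  by (simp add: torus_def space_restrict_space)

lemma measurable_torus:
  "f \<in> borel_measurable borel \<Longrightarrow> f \<in> borel_measurable torus"
  by (simp add: torus_def measurable_restrict_space1)

lemma emeasure_torus: "emeasure torus (space torus) = 1"
proof -
  have "emeasure torus (space torus) = emeasure lborel (cbox (0::real, 0::real) (1, 1))"
    by (simp add: torus_def emeasure_restrict_space space_restrict_space period_cell_cbox)
  also have "\<dots> = 1"
    by (subst emeasure_lborel_cbox) (auto simp: Basis_prod_def)
  finally show ?thesis .
qed

interpretation torus: finite_measure torus
  by standard (use emeasure_torus in simp)

lemma measure_torus [simp]: "measure torus period_cell = 1"
  using emeasure_torus by (simp add: measure_def)

lemma L2_inner_torus: "L2_inner u v = (\<integral>p. u p * v p \<partial>torus)"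
  by (simp add: L2_inner_def set_lebesgue_integral_def torus_def integral_restrict_space)

lemma L2_norm_sq: "(L2_norm u)\<^sup>2 = L2_inner u u"
proof -
  have "0 \<le> (LINT p:period_cell|lborel. (u p)\<^sup>2)"
    unfolding set_lebesgue_integral_def by (intro integral_nonneg_AE) auto
  then show ?thesis
    by (simp add: L2_norm_def L2_inner_def power2_eq_square)
qed

lemma L2_norm_sq_integral: "(L2_norm u)\<^sup>2 = (\<integral>p. (u p)\<^sup>2 \<partial>torus)"
  unfolding L2_norm_sq by (simp add: L2_inner_torus power2_eq_square)

lemma L2_norm_nonneg [simp]: "0 \<le> L2_norm u"
  unfolding L2_norm_def set_lebesgue_integral_def by (auto intro!: integral_nonneg_AE)

lemma L2_inner_self_nonneg [simp]: "0 \<le> L2_inner u u"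
  by (simp flip: L2_norm_sq)

lemma L2_norm_eq_sqrt: "L2_norm u = sqrt (L2_inner u u)"
  by (simp flip: L2_norm_sq)

lemma set_integrable_torus:
  fixes f :: field
  shows "set_integrable lborel period_cell f \<longleftrightarrow> integrable torus f"
  unfolding set_integrable_def torus_def by (subst integrable_restrict_space) simp_all

lemma AE_torus: "AE p in lborel. P p \<Longrightarrow> AE p in torus. P p"
  unfolding torus_def by (subst AE_restrict_space_iff) auto

text \<open>Only square integrability over the cell is asked for: products with basis functions and
  the nonlinear terms are taken in this space.\<close>
definition L2 :: "field set" where
  "L2 = {u. u \<in> borel_measurable borel \<and> integrable torus (\<lambda>p. (u p)\<^sup>2)}"

lemma L2_measurable: "u \<in> L2 \<Longrightarrow> u \<in> borel_measurable borel"
  by (simp add: L2_def)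

lemma L2_per0_iff:
  "u \<in> L2_per0 \<longleftrightarrow> u \<in> L2 \<and> periodic u \<and> (\<integral>p. u p \<partial>torus) = 0"
  by (auto simp: L2_per0_def L2_def set_integrable_torus set_lebesgue_integral_def torus_def
      integral_restrict_space)

lemma L2_per0_L2: "u \<in> L2_per0 \<Longrightarrow> u \<in> L2"
  by (simp add: L2_per0_iff)

lemma L2_mult_integrable:
  assumes "u \<in> L2" "v \<in> L2" shows "integrable torus (\<lambda>p. u p * v p)"
proof (rule Bochner_Integration.integrable_bound)
  show "integrable torus (\<lambda>p. (u p)\<^sup>2 + (v p)\<^sup>2)"
    using assms by (simp add: L2_def)
  have "\<bar>a * b\<bar> \<le> a\<^sup>2 + b\<^sup>2" for a b :: real
  proof -
    have "0 \<le> (\<bar>a\<bar> - \<bar>b\<bar>)\<^sup>2" by simp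
    then have "2 * (\<bar>a\<bar> * \<bar>b\<bar>) \<le> a\<^sup>2 + b\<^sup>2" by (simp add: power2_diff)
    moreover have "0 \<le> \<bar>a\<bar> * \<bar>b\<bar>" by simp
    ultimately show ?thesis unfolding abs_mult by linarith
  qed
  then show "AE p in torus. norm (u p * v p) \<le> norm ((u p)\<^sup>2 + (v p)\<^sup>2)"
    by auto
  show "(\<lambda>p. u p * v p) \<in> borel_measurable torus"
    using assms by (auto intro!: measurable_torus simp: L2_def)
qed

lemma L2_bounded:
  assumes "u \<in> borel_measurable borel" "\<And>p. \<bar>u p\<bar> \<le> B" shows "u \<in> L2"
proof -
  have "(u p)\<^sup>2 \<le> B\<^sup>2" for p
    using power_mono[OF assms(2)[of p], of 2] by simp
  then have "integrable torus (\<lambda>p. (u p)\<^sup>2)"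
    using assms(1)
    by (intro torus.integrable_const_bound[where B="B\<^sup>2"] measurable_torus borel_measurable_power AE_I2)
      simp_all
  with assms(1) show ?thesis by (simp add: L2_def)
qed

lemma L2_const: "(\<lambda>p. c) \<in> L2"
  by (rule L2_bounded[of _ "\<bar>c\<bar>"]) auto

lemma L2_integrable: "u \<in> L2 \<Longrightarrow> integrable torus u"
  using L2_mult_integrable[OF _ L2_const[of 1]] by simp

lemma L2_add: assumes "u \<in> L2" "v \<in> L2" shows "(\<lambda>p. u p + v p) \<in> L2"
proof -
  have "integrable torus (\<lambda>p. (u p)\<^sup>2 + 2 * (u p * v p) + (v p)\<^sup>2)"
    using assms L2_mult_integrable[OF assms] by (simp add: L2_def)
  moreover have "(\<lambda>p. u p + v p) \<in> borel_measurable borel"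
    using assms by (intro borel_measurable_add) (simp_all add: L2_def)
  ultimately show ?thesis
    by (simp add: L2_def power2_sum algebra_simps)
qed

lemma L2_scale: assumes "u \<in> L2" shows "(\<lambda>p. c * u p) \<in> L2"
  using assms by (auto simp: L2_def power_mult_distrib intro!: borel_measurable_times)

lemma L2_minus: "u \<in> L2 \<Longrightarrow> (\<lambda>p. - u p) \<in> L2"
  using L2_scale[of u "-1"] by simp

lemma L2_diff: "u \<in> L2 \<Longrightarrow> v \<in> L2 \<Longrightarrow> (\<lambda>p. u p - v p) \<in> L2"
  using L2_add[of u "\<lambda>p. - v p"] L2_minus by simp

lemma L2_sum: "(\<And>i. i \<in> I \<Longrightarrow> f i \<in> L2) \<Longrightarrow> (\<lambda>p. \<Sum>i\<in>I. f i p) \<in> L2"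
  by (induction I rule: infinite_finite_induct) (auto intro: L2_add L2_const)

lemma L2_inner_commute: "L2_inner u v = L2_inner v u"
  by (simp add: L2_inner_def mult.commute)

lemma L2_inner_add: "\<lbrakk>u \<in> L2; v \<in> L2; w \<in> L2\<rbrakk> \<Longrightarrow>
    L2_inner (\<lambda>p. u p + v p) w = L2_inner u w + L2_inner v w"
  by (simp add: L2_inner_torus ring_distribs L2_mult_integrable)

lemma L2_inner_diff: "\<lbrakk>u \<in> L2; v \<in> L2; w \<in> L2\<rbrakk> \<Longrightarrow>
    L2_inner (\<lambda>p. u p - v p) w = L2_inner u w - L2_inner v w"
  by (simp add: L2_inner_torus left_diff_distrib L2_mult_integrable)

lemma L2_inner_scale: "L2_inner (\<lambda>p. c * u p) w = c * L2_inner u w"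
  by (simp add: L2_inner_torus mult.assoc)

lemma L2_inner_minus: "L2_inner (\<lambda>p. - u p) w = - L2_inner u w"
  using L2_inner_scale[of "-1"] by simp

lemma L2_inner_add_right: "\<lbrakk>u \<in> L2; v \<in> L2; w \<in> L2\<rbrakk> \<Longrightarrow>
    L2_inner w (\<lambda>p. u p + v p) = L2_inner w u + L2_inner w v"
  unfolding L2_inner_commute[of w] by (rule L2_inner_add)

lemma L2_inner_diff_right: "\<lbrakk>u \<in> L2; v \<in> L2; w \<in> L2\<rbrakk> \<Longrightarrow>
    L2_inner w (\<lambda>p. u p - v p) = L2_inner w u - L2_inner w v"
  unfolding L2_inner_commute[of w] by (rule L2_inner_diff)

lemma L2_inner_scale_right: "L2_inner w (\<lambda>p. c * u p) = c * L2_inner w u"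
  unfolding L2_inner_commute[of w] by (rule L2_inner_scale)

lemma L2_inner_sum: "\<lbrakk>\<And>i. i \<in> I \<Longrightarrow> f i \<in> L2; w \<in> L2\<rbrakk> \<Longrightarrow>
    L2_inner (\<lambda>p. \<Sum>i\<in>I. f i p) w = (\<Sum>i\<in>I. L2_inner (f i) w)"
proof (induction I rule: infinite_finite_induct)
  case (insert x F)
  then show ?case by (simp add: L2_inner_add L2_sum)
qed (simp_all add: L2_inner_def)

lemma L2_inner_cong_AE:
  assumes "AE p in torus. u p = u' p" "AE p in torus. v p = v' p"
    "u \<in> borel_measurable borel" "u' \<in> borel_measurable borel"
    "v \<in> borel_measurable borel" "v' \<in> borel_measurable borel"
  shows "L2_inner u v = L2_inner u' v'"
  unfolding L2_inner_torus
  by (rule integral_cong_AE) (use assms in \<open>auto intro!: measurable_torus\<close>)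

text \<open>The quadratic \<open>s\<^sup>2 (u,u) - 2 s r (u,v) + r\<^sup>2 (v,v)\<close> is nonnegative; take \<open>s = (v,v)\<close> and
  \<open>r = (u,v)\<close>.\<close>
lemma L2_Cauchy_Schwarz:
  assumes "u \<in> L2" "v \<in> L2"
  shows "\<bar>L2_inner u v\<bar> \<le> L2_norm u * L2_norm v"
proof -
  let ?a = "L2_inner u u" and ?b = "L2_inner u v" and ?c = "L2_inner v v"
  have *: "0 \<le> s\<^sup>2 * ?a - 2 * s * r * ?b + r\<^sup>2 * ?c" for s r
  proof -
    have su: "(\<lambda>p. s * u p) \<in> L2" and rv: "(\<lambda>p. r * v p) \<in> L2"
      by (auto intro: L2_scale assms)
    have "0 \<le> L2_inner (\<lambda>p. s * u p - r * v p) (\<lambda>p. s * u p - r * v p)"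
      by simp
    also have "\<dots> = s\<^sup>2 * ?a - 2 * s * r * ?b + r\<^sup>2 * ?c"
      using su rv assms
      by (simp add: L2_inner_diff L2_inner_diff_right L2_diff L2_inner_scale L2_inner_scale_right
          L2_inner_commute[of v u] power2_eq_square algebra_simps)
    finally show ?thesis .
  qed
  have "?b\<^sup>2 \<le> ?a * ?c"
  proof (cases "?c = 0")
    case True
    have "?b = 0"
    proof (rule ccontr)
      assume "?b \<noteq> 0"
      with *[of 1 "(?a + 1) / ?b"] True L2_inner_self_nonneg[of u] show False
        by simp
    qed
    then show ?thesis by (simp add: True)
  next
    case False
    then have "0 < ?c" using L2_inner_self_nonneg[of v] by linarith
    moreover have "0 \<le> ?c * (?a * ?c - ?b\<^sup>2)"
      using *[of ?c ?b] by (simp add: power2_eq_square algebra_simps)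
    ultimately show ?thesis by (simp add: zero_le_mult_iff)
  qed
  then have "sqrt (?b\<^sup>2) \<le> sqrt (?a * ?c)" by (rule real_sqrt_le_mono)
  then show ?thesis by (simp add: L2_norm_eq_sqrt real_sqrt_mult)
qed

lemma L2_norm_scale: "L2_norm (\<lambda>p. c * u p) = \<bar>c\<bar> * L2_norm u"
proof -
  have "(L2_norm (\<lambda>p. c * u p))\<^sup>2 = (\<bar>c\<bar> * L2_norm u)\<^sup>2"
    by (simp add: L2_norm_sq_integral power_mult_distrib)
  then show ?thesis by (rule power2_eq_imp_eq) simp_all
qed

lemma L2_norm_triangle:
  assumes "u \<in> L2" "v \<in> L2"
  shows "L2_norm (\<lambda>p. u p + v p) \<le> L2_norm u + L2_norm v"
proof (rule power2_le_imp_le)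
  have "(L2_norm (\<lambda>p. u p + v p))\<^sup>2 = (L2_norm u)\<^sup>2 + 2 * L2_inner u v + (L2_norm v)\<^sup>2"
    using assms by (simp add: L2_norm_sq L2_inner_add L2_inner_add_right L2_add
        L2_inner_commute[of v u])
  also have "\<dots> \<le> (L2_norm u + L2_norm v)\<^sup>2"
    using L2_Cauchy_Schwarz[OF assms] by (simp add: power2_sum)
  finally show "(L2_norm (\<lambda>p. u p + v p))\<^sup>2 \<le> (L2_norm u + L2_norm v)\<^sup>2" .
qed auto

lemma L2_norm_triangle_diff:
  assumes "u \<in> L2" "v \<in> L2"
  shows "L2_norm (\<lambda>p. u p - v p) \<le> L2_norm u + L2_norm v"
  using L2_norm_triangle[OF assms(1) L2_minus[OF assms(2)]] L2_norm_scale[of "-1" v] by simp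

lemma L2_bounded_mult:
  assumes "u \<in> L2" "b \<in> borel_measurable borel" "AE p in torus. \<bar>b p\<bar> \<le> B"
    and B: "0 \<le> B"
  shows "(\<lambda>p. u p * b p) \<in> L2" "L2_norm (\<lambda>p. u p * b p) \<le> B * L2_norm u"
proof -
  have ae: "AE p in torus. (u p * b p)\<^sup>2 \<le> B\<^sup>2 * (u p)\<^sup>2"
    using assms(3)
  proof eventually_elim
    case (elim p)
    then have "\<bar>b p\<bar>\<^sup>2 \<le> B\<^sup>2" by (intro power_mono) auto
    then show ?case by (simp add: power_mult_distrib mult.commute mult_right_mono)
  qed
  have i: "integrable torus (\<lambda>p. B\<^sup>2 * (u p)\<^sup>2)"
    using assms(1) by (simp add: L2_def)
  have m: "(\<lambda>p. u p * b p) \<in> borel_measurable borel"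
    using assms(1,2) by (auto simp: L2_def)
  have j: "integrable torus (\<lambda>p. (u p * b p)\<^sup>2)"
    by (rule Bochner_Integration.integrable_bound[OF i])
      (use ae m in \<open>auto intro!: measurable_torus\<close>)
  then show "(\<lambda>p. u p * b p) \<in> L2" using m by (simp add: L2_def)
  have "(L2_norm (\<lambda>p. u p * b p))\<^sup>2 \<le> (B * L2_norm u)\<^sup>2"
    using integral_mono_AE[OF j i ae]
    by (simp add: L2_norm_sq_integral power_mult_distrib)
  then show "L2_norm (\<lambda>p. u p * b p) \<le> B * L2_norm u"
    by (rule power2_le_imp_le) (simp add: B)
qed

lemma L2_norm_cong_AE:
  assumes "AE p in torus. u p = v p" "u \<in> borel_measurable borel" "v \<in> borel_measurable borel"
  shows "L2_norm u = L2_norm v"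
  by (simp add: L2_norm_eq_sqrt L2_inner_cong_AE[OF assms(1,1) assms(2,3,2,3)])

lemma L2_norm_zero_AE:
  assumes "u \<in> L2" "L2_norm u = 0" shows "AE p in torus. u p = 0"
proof -
  have "(\<integral>p. (u p)\<^sup>2 \<partial>torus) = 0"
    using assms(2) L2_norm_sq[of u] by (simp add: L2_inner_torus power2_eq_square)
  then have "AE p in torus. (u p)\<^sup>2 = 0"
    using assms(1) by (subst (asm) integral_nonneg_eq_0_iff_AE) (auto simp: L2_def)
  then show ?thesis by simp
qed

text \<open>The excess of \<open>\<bar>v\<bar>\<close> over \<open>B\<close> is at most \<open>\<bar>v - w n\<bar>\<close>, so its norm is zero. Pointwise bounds
  for weak derivatives come from this.\<close>
lemma L2_limit_bounded:
  assumes v: "v \<in> L2" and w: "\<And>n. w n \<in> L2" and bd: "\<And>n p. \<bar>w n p\<bar> \<le> B"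
    and lim: "(\<lambda>n::nat. L2_norm (\<lambda>p. v p - w n p)) \<longlonglongrightarrow> 0"
  shows "AE p in torus. \<bar>v p\<bar> \<le> B"
proof -
  define e where "e p = max 0 (\<bar>v p\<bar> - B)" for p
  have le: "(e p)\<^sup>2 \<le> (v p - w n p)\<^sup>2" for n p
    using bd[of n p] unfolding e_def abs_le_square_iff[symmetric] by (auto simp: max_def)
  have m: "e \<in> borel_measurable borel" unfolding e_def using v[THEN L2_measurable] by measurable
  have d: "integrable torus (\<lambda>p. (v p - w n p)\<^sup>2)" for n
    using L2_diff[OF v w[of n]] by (simp add: L2_def)
  have i: "integrable torus (\<lambda>p. (e p)\<^sup>2)"
    by (rule Bochner_Integration.integrable_bound[OF d[of 0]]) (use le m in \<open>auto intro!: measurable_torus\<close>)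
  then have e: "e \<in> L2" using m by (simp add: L2_def)
  have "(L2_norm e)\<^sup>2 \<le> (L2_norm (\<lambda>p. v p - w n p))\<^sup>2" for n
    using integral_mono[OF i d[of n] le] by (simp add: L2_norm_sq_integral)
  then have "L2_norm e \<le> L2_norm (\<lambda>p. v p - w n p)" for n
    by (rule power2_le_imp_le) simp
  then have "L2_norm e \<le> 0"
    by (intro LIMSEQ_le_const[OF lim]) auto
  then have "AE p in torus. e p = 0"
    using e by (intro L2_norm_zero_AE) (auto intro: antisym)
  then show ?thesis by eventually_elim (auto simp: e_def max_def split: if_splits)
qed

lemma cell_integrable:
  fixes f :: field
  assumes "continuous_on UNIV f"
  shows "integrable lborel (\<lambda>p. indicator period_cell p * f p)"
  using borel_integrable_compact[of period_cell f] continuous_on_subset[OF assms]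
  by (auto simp: period_cell_cbox)

lemma indicator_cell: "indicator period_cell (x, z) = indicator {0..1} x * (indicator {0..1::real} z :: real)"
  by (auto simp: period_cell_def indicator_def)

lemma torus_integral_lborel:
  fixes f :: field
  shows "(\<integral>p. f p \<partial>torus) = (\<integral>p. indicator period_cell p * f p \<partial>(lborel \<Otimes>\<^sub>M lborel))"
  by (simp add: torus_def integral_restrict_space lborel_prod)

text \<open>Fubini and the fundamental theorem of calculus. All integrations by parts below are
  instances of this lemma and the next one, applied to a product.\<close>
lemma integral_partial_x_zero:
  fixes f f' :: field
  assumes d: "\<And>x z. ((\<lambda>s. f (s, z)) has_real_derivative f' (x, z)) (at x)"
    and c: "continuous_on UNIV f'" and per: "\<And>z. f (1, z) = f (0, z)"
  shows "(\<integral>p. f' p \<partial>torus) = 0"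
proof -
  have i: "integrable (lborel \<Otimes>\<^sub>M lborel) (\<lambda>(x, z). indicator period_cell (x, z) * f' (x, z))"
    using cell_integrable[OF c] by (simp add: lborel_prod case_prod_unfold)
  have inner: "(\<integral>x. indicator period_cell (x, z) * f' (x, z) \<partial>lborel) = 0" for z
  proof -
    have "(\<integral>x. indicator {0..1} x *\<^sub>R f' (x, z) \<partial>lborel) = f (1, z) - f (0, z)"
    proof (rule integral_FTC_atLeastAtMost)
      show "((\<lambda>s. f (s, z)) has_vector_derivative f' (x, z)) (at x within {0..1})" for x
        using d[where x=x and z=z]
        by (simp add: has_real_derivative_iff_has_vector_derivative has_vector_derivative_at_within)
      show "continuous_on {0..1} (\<lambda>x. f' (x, z))"
        by (intro continuous_on_compose2[OF c] continuous_intros) auto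
    qed simp
    moreover have "(\<lambda>x. indicator period_cell (x, z) * f' (x, z))
        = (\<lambda>x. indicator {0..1} z * (indicator {0..1} x *\<^sub>R f' (x, z)))"
      by (auto simp: indicator_cell)
    ultimately show ?thesis by (simp add: per)
  qed
  show ?thesis
    using lborel_pair.integral_snd[OF i] by (simp add: torus_integral_lborel inner case_prod_unfold)
qed

lemma integral_partial_z_zero:
  fixes f f' :: field
  assumes d: "\<And>x z. ((\<lambda>s. f (x, s)) has_real_derivative f' (x, z)) (at z)"
    and c: "continuous_on UNIV f'" and per: "\<And>x. f (x, 1) = f (x, 0)"
  shows "(\<integral>p. f' p \<partial>torus) = 0"
proof -
  have i: "integrable (lborel \<Otimes>\<^sub>M lborel) (\<lambda>(x, z). indicator period_cell (x, z) * f' (x, z))"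
    using cell_integrable[OF c] by (simp add: lborel_prod case_prod_unfold)
  have inner: "(\<integral>z. indicator period_cell (x, z) * f' (x, z) \<partial>lborel) = 0" for x
  proof -
    have "(\<integral>z. indicator {0..1} z *\<^sub>R f' (x, z) \<partial>lborel) = f (x, 1) - f (x, 0)"
    proof (rule integral_FTC_atLeastAtMost)
      show "((\<lambda>s. f (x, s)) has_vector_derivative f' (x, z)) (at z within {0..1})" for z
        using d[where x=x and z=z]
        by (simp add: has_real_derivative_iff_has_vector_derivative has_vector_derivative_at_within)
      show "continuous_on {0..1} (\<lambda>z. f' (x, z))"
        by (intro continuous_on_compose2[OF c] continuous_intros) auto
    qed simp
    moreover have "(\<lambda>z. indicator period_cell (x, z) * f' (x, z))
        = (\<lambda>z. indicator {0..1} x * (indicator {0..1} z *\<^sub>R f' (x, z)))"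
      by (auto simp: indicator_cell)
    ultimately show ?thesis by (simp add: per)
  qed
  show ?thesis
    using lborel_pair.integral_fst[OF i] by (simp add: torus_integral_lborel inner case_prod_unfold)
qed

section \<open>A real orthonormal basis\<close>

definition phase :: "int \<times> int \<Rightarrow> field" where
  "phase k p = 2 * pi * (of_int (fst k) * fst p + of_int (snd k) * snd p)"

text \<open>Hartley's function. Compared with complex exponentials it keeps coefficients real, which
  suits real test functions, and it gives one basis function for every \<open>k\<close>.\<close>
definition cas :: "int \<times> int \<Rightarrow> field" where
  "cas k p = cos (phase k p) + sin (phase k p)"

lemma phase_add: "phase (k + l) p = phase k p + phase l p"
  and phase_diff: "phase (k - l) p = phase k p - phase l p"
  and phase_minus: "phase (- k) p = - phase k p"
  and phase_zero [simp]: "phase 0 p = 0"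
  by (simp_all add: phase_def algebra_simps)

lemma continuous_phase [continuous_intros]: "continuous_on S (phase k)"
  unfolding phase_def by (intro continuous_intros)

lemma continuous_cas [continuous_intros]: "continuous_on S (cas k)"
  unfolding cas_def by (intro continuous_intros)

lemma cas_measurable [measurable]: "cas k \<in> borel_measurable borel"
  by (intro borel_measurable_continuous_onI continuous_intros)

lemma cas_zero [simp]: "cas 0 p = 1"
  by (simp add: cas_def)

lemma abs_cas: "\<bar>cas k p\<bar> \<le> 2"
proof -
  have "\<bar>cos (phase k p)\<bar> \<le> 1" "\<bar>sin (phase k p)\<bar> \<le> 1" by simp_all
  then show ?thesis unfolding cas_def by linarith
qed

lemma cas_L2: "cas k \<in> L2"
  by (rule L2_bounded[OF _ abs_cas]) simp

lemma cos_phase_period: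
  "cos (phase k (x + 1, z)) = cos (phase k (x, z))" "sin (phase k (x + 1, z)) = sin (phase k (x, z))"
  "cos (phase k (x, z + 1)) = cos (phase k (x, z))" "sin (phase k (x, z + 1)) = sin (phase k (x, z))"
proof -
  have "phase k (x + 1, z) = phase k (x, z) + of_int (fst k) * (2 * pi)"
    "phase k (x, z + 1) = phase k (x, z) + of_int (snd k) * (2 * pi)"
    by (simp_all add: phase_def algebra_simps)
  then show "cos (phase k (x + 1, z)) = cos (phase k (x, z))" "sin (phase k (x + 1, z)) = sin (phase k (x, z))"
  "cos (phase k (x, z + 1)) = cos (phase k (x, z))" "sin (phase k (x, z + 1)) = sin (phase k (x, z))"
    using cos.plus_of_int[of "phase k (x, z)"] sin.plus_of_int[of "phase k (x, z)"] by simp_all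
qed

lemma cas_periodic: "periodic (cas k)"
  by (simp add: periodic_def cas_def cos_phase_period)

lemma cas_unit_period: "cas k (1, z) = cas k (0, z)" "cas k (x, 1) = cas k (x, 0)"
  using cos_phase_period[of k 0 z] cos_phase_period[of k x 0] by (simp_all add: cas_def)

lemma phase_deriv_x: "((\<lambda>s. phase k (s, z)) has_real_derivative 2 * pi * of_int (fst k)) (at x)"
  and phase_deriv_z: "((\<lambda>s. phase k (x, s)) has_real_derivative 2 * pi * of_int (snd k)) (at z)"
  unfolding phase_def by (auto intro!: derivative_eq_intros)

lemma cas_deriv_x: "((\<lambda>s. cas k (s, z)) has_real_derivative 2 * pi * of_int (fst k) * cas (- k) (x, z)) (at x)"
  unfolding cas_def phase_minus
  by (rule derivative_eq_intros DERIV_chain2[OF DERIV_cos] DERIV_chain2[OF DERIV_sin] phase_deriv_x refl)+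
     (simp add: algebra_simps)

lemma cas_deriv_z: "((\<lambda>s. cas k (x, s)) has_real_derivative 2 * pi * of_int (snd k) * cas (- k) (x, z)) (at z)"
  unfolding cas_def phase_minus
  by (rule derivative_eq_intros DERIV_chain2[OF DERIV_cos] DERIV_chain2[OF DERIV_sin] phase_deriv_z refl)+
     (simp add: algebra_simps)

lemma continuous_integrable_torus:
  fixes f :: field
  assumes "continuous_on UNIV f" shows "integrable torus f"
  using cell_integrable[OF assms] by (simp add: torus_def integrable_restrict_space)

text \<open>A nonconstant basis function is a partial derivative of another one.\<close>
lemma integral_cas: "(\<integral>p. cas k p \<partial>torus) = (if k = 0 then 1 else 0)"
proof (cases "k = 0")
  case True then show ?thesis by simp
next
  case False
  then have "fst k \<noteq> 0 \<or> snd k \<noteq> 0" by (simp add: prod_eq_iff)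
  then show ?thesis
  proof
    assume "fst k \<noteq> 0"
    then have "((\<lambda>s. - cas (- k) (s, z) / (2 * pi * of_int (fst k))) has_real_derivative cas k (x, z)) (at x)" for x z
      using DERIV_cmult[OF cas_deriv_x[of "- k" z x], of "- 1 / (2 * pi * of_int (fst k))"] by simp
    then have "(\<integral>p. cas k p \<partial>torus) = 0"
      by (intro integral_partial_x_zero[where f="\<lambda>p. - cas (- k) p / (2 * pi * of_int (fst k))"])
         (use cas_unit_period[of "- k"] in \<open>auto intro: continuous_intros\<close>)
    with False show ?thesis by simp
  next
    assume "snd k \<noteq> 0"
    then have "((\<lambda>s. - cas (- k) (x, s) / (2 * pi * of_int (snd k))) has_real_derivative cas k (x, z)) (at z)" for x z
      using DERIV_cmult[OF cas_deriv_z[of "- k" x z], of "- 1 / (2 * pi * of_int (snd k))"] by simp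
    then have "(\<integral>p. cas k p \<partial>torus) = 0"
      by (intro integral_partial_z_zero[where f="\<lambda>p. - cas (- k) p / (2 * pi * of_int (snd k))"])
         (use cas_unit_period[of "- k"] in \<open>auto intro: continuous_intros\<close>)
    with False show ?thesis by simp
  qed
qed

lemma cas_mult: "cas k p * cas l p = (cas (k - l) p + cas (l - k) p + cas (k + l) p - cas (- (k + l)) p) / 2"
  unfolding cas_def phase_add phase_diff phase_minus
  by (simp add: cos_add cos_diff sin_add sin_diff field_simps)

text \<open>Of the four basis functions in \<open>cas_mult\<close>, the first two have frequency zero exactly if
  \<open>k = l\<close>, and the means of the last two cancel.\<close>
lemma cas_orthonormal: "L2_inner (cas k) (cas l) = (if k = l then 1 else 0)"
proof -
  have i: "integrable torus (cas m)" for m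
    by (rule L2_integrable[OF cas_L2])
  have "L2_inner (cas k) (cas l) =
      ((\<integral>p. cas (k - l) p \<partial>torus) + (\<integral>p. cas (l - k) p \<partial>torus) + (\<integral>p. cas (k + l) p \<partial>torus)
        - (\<integral>p. cas (- (k + l)) p \<partial>torus)) / 2"
    by (simp only: L2_inner_torus cas_mult Bochner_Integration.integral_divide_zero
      Bochner_Integration.integral_add Bochner_Integration.integral_diff i Bochner_Integration.integrable_add)
  also have "\<dots> = (if k = l then 1 else 0)"
    by (simp add: integral_cas neg_equal_0_iff_equal[of "k + l"] del: minus_add_distrib)
  finally show ?thesis .
qed

lemma pdx_scaled_cas: "pdx (\<lambda>p. a * cas k p) = (\<lambda>p. (2 * pi * of_int (fst k) * a) * cas (- k) p)"
  unfolding pdx_def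
proof (rule ext, clarify)
  fix x z
  show "deriv (\<lambda>s. a * cas k (s, z)) x = (2 * pi * of_int (fst k) * a) * cas (- k) (x, z)"
    using DERIV_imp_deriv[OF DERIV_cmult[OF cas_deriv_x[of k z x], of a]] by simp
qed

lemma pdz_scaled_cas: "pdz (\<lambda>p. a * cas k p) = (\<lambda>p. (2 * pi * of_int (snd k) * a) * cas (- k) p)"
  unfolding pdz_def
proof (rule ext, clarify)
  fix x z
  show "deriv (\<lambda>s. a * cas k (x, s)) z = (2 * pi * of_int (snd k) * a) * cas (- k) (x, z)"
    using DERIV_imp_deriv[OF DERIV_cmult[OF cas_deriv_z[of k x z], of a]] by simp
qed

text \<open>The scalar is there for the coinduction: multiples of basis functions are closed under
  both partial derivatives.\<close>
lemma smooth_scaled_cas: "smooth (\<lambda>p. a * cas k p)"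
proof -
  define X where "X f \<longleftrightarrow> (\<exists>a k. f = (\<lambda>p. a * cas k p))" for f
  have "X (\<lambda>p. a * cas k p)" unfolding X_def by blast
  then show ?thesis
  proof (rule smooth.coinduct[of X])
    fix f assume "X f"
    then obtain b l where f: "f = (\<lambda>p. b * cas l p)" unfolding X_def by blast
    have "f differentiable at p" for p
      unfolding differentiable_def f cas_def phase_def
      by (rule exI, (rule derivative_eq_intros refl)+)
    moreover have "X (pdx f)" "X (pdz f)"
      unfolding f pdx_scaled_cas pdz_scaled_cas X_def by blast+
    ultimately show "\<exists>\<phi>. f = \<phi> \<and> (\<forall>p. \<phi> differentiable at p) \<and> (X (pdx \<phi>) \<or> smooth (pdx \<phi>)) \<and> (X (pdz \<phi>) \<or> smooth (pdz \<phi>))"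
      by blast
  qed
qed

lemma cas_test: "cas k \<in> test_functions"
  using smooth_scaled_cas[of 1 k] cas_periodic by (simp add: test_functions_def)


section \<open>Completeness of the basis\<close>

definition coef :: "field \<Rightarrow> int \<times> int \<Rightarrow> real" where
  "coef u k = L2_inner u (cas k)"

text \<open>The flag selects the coordinate.\<close>
definition shifted_cos :: "bool \<Rightarrow> real \<Rightarrow> field" where
  "shifted_cos b c p = cos (2 * pi * ((if b then fst p else snd p) - c))"

definition axis :: "bool \<Rightarrow> int \<times> int" where
  "axis b = (if b then (1, 0) else (0, 1))"

text \<open>Multiplication by a shifted cosine stays in the span of the basis. Hence orthogonality to
  the basis survives multiplication by such cosines, and then by polynomials in them
  (\<open>orth_polynomial\<close>).\<close>
lemma shifted_cos_cas:
  "shifted_cos b c p * cas k p =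
     cos (2 * pi * c) / 2 * (cas (k + axis b) p + cas (k - axis b) p)
      + sin (2 * pi * c) / 2 * (cas (- (k - axis b)) p - cas (- (k + axis b)) p)"
proof -
  have "2 * pi * ((if b then fst p else snd p) - c) = phase (axis b) p - 2 * pi * c"
    by (simp add: axis_def phase_def algebra_simps)
  then show ?thesis
    unfolding shifted_cos_def cas_def phase_minus phase_add phase_diff
    by (simp add: cos_add cos_diff sin_add sin_diff field_simps)
qed

lemma continuous_shifted_cos: "continuous_on S (shifted_cos b c)"
  unfolding shifted_cos_def by (cases b) (auto intro!: continuous_intros)

lemma shifted_cos_measurable [measurable]: "shifted_cos b c \<in> borel_measurable borel"
  by (intro borel_measurable_continuous_onI continuous_shifted_cos)

lemma abs_shifted_cos: "\<bar>shifted_cos b c p\<bar> \<le> 1"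
  by (simp add: shifted_cos_def)

definition orth :: "field set" where
  "orth = {u \<in> L2. \<forall>k. coef u k = 0}"

lemma orth_L2: "u \<in> orth \<Longrightarrow> u \<in> L2"
  by (simp add: orth_def)

lemma L2_mult_shifted_cos: "u \<in> L2 \<Longrightarrow> (\<lambda>p. u p * shifted_cos b c p) \<in> L2"
  by (rule L2_bounded_mult(1)[where B=1]) (auto simp: abs_shifted_cos)

lemma orth_shifted_cos:
  assumes "u \<in> orth" shows "(\<lambda>p. u p * shifted_cos b c p) \<in> orth"
proof -
  have u: "u \<in> L2" and z: "L2_inner u (cas k) = 0" for k
    using assms unfolding orth_def coef_def by blast+
  have "coef (\<lambda>p. u p * shifted_cos b c p) k = 0" for k
  proof -
    have "coef (\<lambda>p. u p * shifted_cos b c p) k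
        = L2_inner u (\<lambda>p. cos (2 * pi * c) / 2 * (cas (k + axis b) p + cas (k - axis b) p)
            + sin (2 * pi * c) / 2 * (cas (- (k - axis b)) p - cas (- (k + axis b)) p))"
      unfolding coef_def L2_inner_torus mult.assoc shifted_cos_cas ..
    also have "\<dots> = 0"
      by (simp only: L2_inner_add_right L2_inner_diff_right L2_inner_scale_right
          L2_scale L2_add L2_diff cas_L2 u z) simp
    finally show ?thesis .
  qed
  then show ?thesis
    using L2_mult_shifted_cos[OF u] by (simp add: orth_def)
qed

lemma orth_add: "u \<in> orth \<Longrightarrow> v \<in> orth \<Longrightarrow> (\<lambda>p. u p + v p) \<in> orth"
  by (auto simp: orth_def coef_def L2_add L2_inner_add cas_L2)

lemma orth_scale: "u \<in> orth \<Longrightarrow> (\<lambda>p. a * u p) \<in> orth"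
  by (auto simp: orth_def coef_def L2_scale L2_inner_scale)

lemma orth_sum: "(\<And>i. i \<in> I \<Longrightarrow> f i \<in> orth) \<Longrightarrow> (\<lambda>p. \<Sum>i\<in>I. f i p) \<in> orth"
proof (induction I rule: infinite_finite_induct)
  case (insert x F)
  then show ?case using orth_add[of "f x" "\<lambda>p. \<Sum>i\<in>F. f i p"] by simp
qed (auto simp: orth_def coef_def L2_const L2_inner_def)

lemma orth_shifted_cos_power: "u \<in> orth \<Longrightarrow> (\<lambda>p. u p * shifted_cos b c p ^ j) \<in> orth"
proof (induction j)
  case (Suc j)
  from orth_shifted_cos[OF Suc.IH[OF Suc.prems], of b c] show ?case
    by (simp add: mult.assoc mult.commute[of "shifted_cos b c _"])
qed simp

lemma orth_polynomial:
  assumes "u \<in> orth" "real_polynomial_function q"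
  shows "(\<lambda>p. u p * q (shifted_cos b c p)) \<in> orth"
proof -
  obtain a n where q: "q = (\<lambda>x. \<Sum>i\<le>n. a i * x ^ i)"
    using assms(2) unfolding real_polynomial_function_iff_sum by blast
  have "(\<lambda>p. u p * q (shifted_cos b c p)) = (\<lambda>p. \<Sum>i\<le>n. a i * (u p * shifted_cos b c p ^ i))"
    by (simp add: q sum_distrib_left mult_ac)
  also have "\<dots> \<in> orth"
    by (intro orth_sum orth_scale orth_shifted_cos_power assms)
  finally show ?thesis .
qed

text \<open>Ramps of slope \<open>n\<close> converge to the step, and Weierstrass's theorem replaces the ramp by a
  polynomial up to \<open>1 / (n + 1)\<close>. The uniform bound serves dominated convergence.\<close>
lemma step_polynomials:
  fixes \<tau> :: real
  obtains q where "\<And>n. real_polynomial_function (q n)"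
    "\<And>n t. \<bar>t\<bar> \<le> 1 \<Longrightarrow> \<bar>q n t\<bar> \<le> 2"
    "\<And>t. \<bar>t\<bar> \<le> 1 \<Longrightarrow> (\<lambda>n. q n t) \<longlonglongrightarrow> (if t > \<tau> then 1 else 0)"
proof -
  define f where "f n t = max 0 (min 1 (real n * (t - \<tau>)))" for n t
  have "\<exists>g. real_polynomial_function g \<and> (\<forall>t\<in>{-1..1}. \<bar>f n t - g t\<bar> < 1 / real (Suc n))" for n
  proof -
    have "continuous_on {-1..1} (f n)"
      unfolding f_def by (intro continuous_intros)
    show ?thesis
      by (rule Stone_Weierstrass_real_polynomial_function
          [OF compact_Icc \<open>continuous_on {-1..1} (f n)\<close>, of "1 / real (Suc n)"]) (simp, blast)
  qed
  then obtain q where q: "\<And>n. real_polynomial_function (q n)"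
    and close: "\<And>n t. t \<in> {-1..1} \<Longrightarrow> \<bar>f n t - q n t\<bar> < 1 / real (Suc n)"
    by metis
  have f01: "0 \<le> f n t" "f n t \<le> 1" for n t by (auto simp: f_def)
  show ?thesis
  proof (rule that[OF q])
    fix n and t :: real assume "\<bar>t\<bar> \<le> 1"
    then have "t \<in> {-1..1}" by (auto simp: abs_le_iff)
    then have "\<bar>f n t - q n t\<bar> < 1 / real (Suc n)" by (rule close)
    moreover have "1 / real (Suc n) \<le> 1" by simp
    ultimately show "\<bar>q n t\<bar> \<le> 2" using f01[of n t] by linarith
  next
    fix t :: real assume t: "\<bar>t\<bar> \<le> 1"
    have "(\<lambda>n. f n t) \<longlonglongrightarrow> (if t > \<tau> then 1 else 0)"
    proof (cases "t > \<tau>")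
      case True
      obtain m where m: "1 / (t - \<tau>) \<le> real m" using real_arch_simple by blast
      have "f n t = 1" if "n \<ge> m" for n
      proof -
        have "1 / (t - \<tau>) \<le> real n" using m of_nat_mono[OF that, where 'a=real] by linarith
        then have "1 \<le> real n * (t - \<tau>)" using True by (simp add: divide_simps)
        then show ?thesis by (simp add: f_def)
      qed
      then have "eventually (\<lambda>n. f n t = 1) sequentially"
        by (auto simp: eventually_sequentially)
      then show ?thesis using True by (simp add: tendsto_eventually)
    next
      case False
      then have "real n * (t - \<tau>) \<le> 0" for n by (intro mult_nonneg_nonpos) auto
      then have "f n t = 0" for n using f01[of n t] unfolding f_def by (metis max.absorb1 min.coboundedI2)
      then show ?thesis using False by simp
    qed
    moreover have "(\<lambda>n. q n t - f n t) \<longlonglongrightarrow> 0"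
    proof (rule Lim_null_comparison[OF _ LIMSEQ_inverse_real_of_nat])
      show "\<forall>\<^sub>F n in sequentially. norm (q n t - f n t) \<le> inverse (real (Suc n))"
      proof (intro always_eventually allI)
        fix n
        have "t \<in> {-1..1}" using t by (auto simp: abs_le_iff)
        then have "\<bar>f n t - q n t\<bar> < inverse (real (Suc n))"
          using close[of t n] by (simp only: inverse_eq_divide)
        then show "norm (q n t - f n t) \<le> inverse (real (Suc n))"
          unfolding real_norm_def by linarith
      qed
    qed
    ultimately show "(\<lambda>n. q n t) \<longlonglongrightarrow> (if t > \<tau> then 1 else 0)"
      using tendsto_add[of "\<lambda>n. q n t - f n t" 0 sequentially "\<lambda>n. f n t"] by simp
  qed
qed

text \<open>Within one period, an interval is where the cosine centred at its midpoint exceeds its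
  value at the endpoints. This turns indicators of boxes into limits of trigonometric
  polynomials.\<close>
lemma arc_cos_iff:
  fixes a b x :: real
  assumes "0 \<le> a" "a < b" "b \<le> 1" "0 \<le> x" "x \<le> 1"
  shows "cos (2 * pi * (x - (a + b) / 2)) > cos (pi * (b - a)) \<longleftrightarrow> a < x \<and> x < b"
proof -
  define w where "w = (b - a) / 2"
  define y where "y = \<bar>x - (a + b) / 2\<bar>"
  have w: "0 < w" "w \<le> 1 / 2" using assms by (auto simp: w_def)
  have y: "0 \<le> y" "y \<le> 1 - w" using assms by (auto simp: y_def w_def field_simps abs_if)
  have 1: "cos (2 * pi * (x - (a + b) / 2)) = cos (2 * pi * y)"
    unfolding y_def using cos_abs_real[of "2 * pi * (x - (a + b) / 2)"] by (simp add: abs_mult)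
  have 2: "cos (pi * (b - a)) = cos (2 * pi * w)" by (simp add: w_def)
  have 3: "a < x \<and> x < b \<longleftrightarrow> y < w" by (auto simp: y_def w_def field_simps abs_if)
  have "cos (2 * pi * w) < cos (2 * pi * y) \<longleftrightarrow> y < w"
  proof (cases "y \<le> 1 / 2")
    case True
    then show ?thesis using w y by (subst cos_mono_less_eq) auto
  next
    case False
    have "cos (2 * pi * y) = cos (2 * pi * (1 - y))"
      using cos_2pi_minus[of "2 * pi * y"] by (simp add: algebra_simps)
    moreover have "cos (2 * pi * (1 - y)) \<le> cos (2 * pi * w)"
      using w y False by (subst cos_mono_le_eq) auto
    ultimately show ?thesis using False w by auto
  qed
  then show ?thesis using 1 2 3 by simp
qed

lemma AE_torus_interior: "AE p in torus. p \<in> box (0, 0) (1, 1)"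
proof -
  have "emeasure lborel (cbox (0, 0) (1, 1) - box (0, 0) (1, 1) :: (real \<times> real) set) = 0"
    by (subst emeasure_Diff) (auto simp: emeasure_lborel_box_eq emeasure_lborel_cbox_eq box_subset_cbox)
  then have "AE p in lborel. p \<notin> cbox (0::real, 0::real) (1, 1) - box (0, 0) (1, 1)"
    by (intro AE_not_in) (auto simp: null_sets_def)
  then show ?thesis
    unfolding torus_def by (subst AE_restrict_space_iff) (auto simp: period_cell_cbox)
qed

text \<open>The indicator of the box is the bounded pointwise limit of products of two step
  polynomials, one in a shifted cosine of each coordinate.\<close>
lemma orth_box:
  assumes u: "u \<in> orth" and a: "0 \<le> a" "a < b" "b \<le> 1" and c: "0 \<le> c" "c < d" "d \<le> 1"
  shows "(\<integral>p. indicator (box (a, c) (b, d)) p * u p \<partial>torus) = 0"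
proof -
  obtain q where q: "\<And>n. real_polynomial_function (q n)"
    "\<And>n t. \<bar>t\<bar> \<le> 1 \<Longrightarrow> \<bar>q n t\<bar> \<le> 2"
    "\<And>t. \<bar>t\<bar> \<le> 1 \<Longrightarrow> (\<lambda>n. q n t) \<longlonglongrightarrow> (if t > cos (pi * (b - a)) then 1 else 0)"
    using step_polynomials by blast
  obtain r where r: "\<And>n. real_polynomial_function (r n)"
    "\<And>n t. \<bar>t\<bar> \<le> 1 \<Longrightarrow> \<bar>r n t\<bar> \<le> 2"
    "\<And>t. \<bar>t\<bar> \<le> 1 \<Longrightarrow> (\<lambda>n. r n t) \<longlonglongrightarrow> (if t > cos (pi * (d - c)) then 1 else 0)"
    using step_polynomials by blast
  let ?x = "shifted_cos True ((a + b) / 2)" and ?z = "shifted_cos False ((c + d) / 2)"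
  define s where "s n p = u p * q n (?x p) * r n (?z p)" for n p
  have s: "s n \<in> orth" for n
    unfolding s_def by (intro orth_polynomial u q r)
  have sm: "s n \<in> borel_measurable torus" for n
    by (intro measurable_torus L2_measurable orth_L2 s)
  have int0: "(\<integral>p. s n p \<partial>torus) = 0" for n
  proof -
    have "coef (s n) 0 = 0" using s[of n] unfolding orth_def by blast
    then show ?thesis by (simp add: coef_def L2_inner_torus)
  qed
  have um: "u \<in> borel_measurable borel" by (intro L2_measurable orth_L2 u)
  have "(\<lambda>n. \<integral>p. s n p \<partial>torus) \<longlonglongrightarrow> (\<integral>p. indicator (box (a, c) (b, d)) p * u p \<partial>torus)"
  proof (rule integral_dominated_convergence[where w="\<lambda>p. 4 * \<bar>u p\<bar>"])
    show "(\<lambda>p. indicator (box (a, c) (b, d)) p * u p) \<in> borel_measurable torus"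
      using um by (intro measurable_torus) measurable
    show "integrable torus (\<lambda>p. 4 * \<bar>u p\<bar>)"
      using L2_integrable[OF orth_L2[OF u]] by simp
    show "AE p in torus. norm (s n p) \<le> 4 * \<bar>u p\<bar>" for n
    proof (rule AE_I2)
      fix p
      have "\<bar>q n (?x p)\<bar> * \<bar>r n (?z p)\<bar> \<le> 2 * 2"
        by (intro mult_mono q r abs_shifted_cos) auto
      then have "\<bar>u p\<bar> * (\<bar>q n (?x p)\<bar> * \<bar>r n (?z p)\<bar>) \<le> \<bar>u p\<bar> * 4"
        by (intro mult_left_mono) auto
      then show "norm (s n p) \<le> 4 * \<bar>u p\<bar>"
        by (simp add: s_def abs_mult mult_ac)
    qed
    show "AE p in torus. (\<lambda>n. s n p) \<longlonglongrightarrow> indicator (box (a, c) (b, d)) p * u p"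
    proof (rule AE_I2)
      fix p assume "p \<in> space torus"
      then obtain x z where p: "p = (x, z)" "0 \<le> x" "x \<le> 1" "0 \<le> z" "z \<le> 1"
        by (auto simp: period_cell_def)
      have lim: "(\<lambda>n. u p * q n (?x p) * r n (?z p)) \<longlonglongrightarrow>
          u p * (if ?x p > cos (pi * (b - a)) then 1 else 0) * (if ?z p > cos (pi * (d - c)) then 1 else 0)"
        by (intro tendsto_mult tendsto_const q r abs_shifted_cos)
      have "(?x p > cos (pi * (b - a))) = (a < x \<and> x < b)"
        using arc_cos_iff[of a b x] a p by (simp add: shifted_cos_def)
      moreover have "(?z p > cos (pi * (d - c))) = (c < z \<and> z < d)"
        using arc_cos_iff[of c d z] c p by (simp add: shifted_cos_def)
      moreover have "p \<in> box (a, c) (b, d) \<longleftrightarrow> (a < x \<and> x < b) \<and> (c < z \<and> z < d)"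
        by (auto simp: p box_prod)
      ultimately have "u p * (if ?x p > cos (pi * (b - a)) then 1 else 0) * (if ?z p > cos (pi * (d - c)) then 1 else 0)
          = indicator (box (a, c) (b, d)) p * u p"
        by (simp only: indicator_def) auto
      with lim show "(\<lambda>n. s n p) \<longlonglongrightarrow> indicator (box (a, c) (b, d)) p * u p"
        by (simp only: s_def)
    qed
  qed (rule sm)
  then have "(\<lambda>n. 0) \<longlonglongrightarrow> (\<integral>p. indicator (box (a, c) (b, d)) p * u p \<partial>torus)"
    by (simp add: int0)
  then show ?thesis by (simp add: LIMSEQ_const_iff)
qed

lemma orth_box_any:
  assumes u: "u \<in> orth"
  shows "(\<integral>p. indicator (box a b) p * u p \<partial>torus) = 0"
proof -
  obtain a1 a2 b1 b2 where ab: "a = (a1, a2)" "b = (b1, b2)" by (cases a, cases b)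
  let ?a1 = "max 0 a1" and ?a2 = "max 0 a2" and ?b1 = "min 1 b1" and ?b2 = "min 1 b2"
  have um: "u \<in> borel_measurable borel" by (intro L2_measurable orth_L2 u)
  have "(\<integral>p. indicator (box a b) p * u p \<partial>torus)
      = (\<integral>p. indicator (box (?a1, ?a2) (?b1, ?b2)) p * u p \<partial>torus)"
  proof (rule integral_cong_AE)
    show "AE p in torus. indicator (box a b) p * u p = indicator (box (?a1, ?a2) (?b1, ?b2)) p * u p"
      using AE_torus_interior
      by eventually_elim (auto simp: ab box_prod indicator_def)
  qed (use um in \<open>(intro measurable_torus, measurable)+\<close>)
  also have "\<dots> = 0"
  proof (cases "?a1 < ?b1 \<and> ?a2 < ?b2")
    case True
    then show ?thesis by (intro orth_box u) auto
  next
    case False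
    then have "box (?a1, ?a2) (?b1, ?b2) = {}"
      by (auto simp: box_prod)
    then show ?thesis by simp
  qed
  finally show ?thesis .
qed

text \<open>Completeness of the basis. The Borel sets over which \<open>u\<close> integrates to zero form a Dynkin
  system that contains the boxes, which are stable under intersection and generate.\<close>
lemma orth_imp_zero:
  assumes u: "u \<in> orth" shows "AE p in torus. u p = 0"
proof (rule torus.density_zero)
  show i: "integrable torus u" by (intro L2_integrable orth_L2 u)
  have si: "set_integrable torus A u" if "A \<in> sets borel" for A
  proof -
    have "A \<inter> period_cell \<in> sets torus"
      using that by (auto simp: torus_def sets_restrict_space)
    then have "integrable torus (\<lambda>p. indicator (A \<inter> period_cell) p *\<^sub>R u p)"
      using i by (rule integrable_mult_indicator)
    then show ?thesis
      unfolding set_integrable_def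
      by (rule Bochner_Integration.integrable_cong[THEN iffD1, rotated -1]) (auto simp: indicator_def)
  qed
  have borel: "sets borel = sigma_sets UNIV (range (\<lambda>(a, b). box a b :: (real \<times> real) set))"
    unfolding borel_eq_box by simp
  have z: "(\<integral>p. indicator A p *\<^sub>R u p \<partial>torus) = 0" if "A \<in> sets borel" for A
  proof -
    have "Int_stable (range (\<lambda>(a, b). box a b :: (real \<times> real) set))"
      by (auto simp: Int_stable_def box_Int_box)
    moreover have "range (\<lambda>(a, b). box a b :: (real \<times> real) set) \<subseteq> Pow UNIV" by simp
    moreover note that[unfolded borel]
    ultimately show ?thesis
    proof (induction rule: sigma_sets_induct_disjoint)
      case (basic A) then show ?case using orth_box_any[OF u] by auto
    next
      case empty show ?case by simp
    next
      case (compl A)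
      then have A: "A \<in> sets borel" by (simp add: borel)
      have "(\<integral>p. indicator (UNIV - A) p *\<^sub>R u p \<partial>torus) = (\<integral>p. u p - indicator A p *\<^sub>R u p \<partial>torus)"
        by (intro Bochner_Integration.integral_cong) (auto simp: indicator_def)
      also have "\<dots> = (\<integral>p. u p \<partial>torus)"
        using si[OF A] compl i by (simp add: set_integrable_def)
      also have "\<dots> = coef u 0" by (simp add: coef_def L2_inner_torus)
      also have "\<dots> = 0" using u unfolding orth_def by blast
      finally show ?case .
    next
      case (union A)
      have Ab: "A i \<in> sets borel" for i using union by (auto simp: borel)
      let ?B = "\<lambda>i. A i \<inter> period_cell"
      have "?B i \<in> sets torus" for i using Ab by (auto simp: torus_def sets_restrict_space)
      moreover have "?B i \<inter> ?B j = {}" if "i \<noteq> j" for i j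
        using union(1) that by (auto simp: disjoint_family_on_def)
      moreover have eq: "(\<integral>p. indicator (C \<inter> period_cell) p *\<^sub>R u p \<partial>torus) = (\<integral>p. indicator C p *\<^sub>R u p \<partial>torus)" for C
        by (intro Bochner_Integration.integral_cong) (auto simp: indicator_def)
      moreover have "set_integrable torus (\<Union>i. ?B i) u"
        by (intro si) (use Ab in auto)
      ultimately have "(LINT p:(\<Union>i. ?B i)|torus. u p) = (\<Sum>i. (LINT p:?B i|torus. u p))"
        by (intro lebesgue_integral_countable_add) auto
      also have "\<dots> = 0" unfolding set_lebesgue_integral_def eq union.IH by simp
      finally show ?case
        using eq[of "\<Union>i. A i"] by (simp add: set_lebesgue_integral_def flip: UN_extend_simps(4))
    qed
  qed
  show "set_lebesgue_integral torus A u = 0" if "A \<in> sets torus" for A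
  proof -
    have "A \<in> sets borel"
      using that by (auto simp: torus_def sets_restrict_space)
    then show ?thesis using z by (simp add: set_lebesgue_integral_def)
  qed
qed

section \<open>Riesz--Fischer and Parseval\<close>

definition freqs :: "nat \<Rightarrow> (int \<times> int) set" where
  "freqs n = {- int n..int n} \<times> {- int n..int n}"

definition tpoly :: "(int \<times> int \<Rightarrow> real) \<Rightarrow> nat \<Rightarrow> field" where
  "tpoly \<alpha> n p = (\<Sum>k\<in>freqs n. \<alpha> k * cas k p)"

lemma finite_freqs [simp]: "finite (freqs n)"
  by (simp add: freqs_def)

lemma freqs_mono: "n \<le> m \<Longrightarrow> freqs n \<subseteq> freqs m"
  by (auto simp: freqs_def)

lemma freqs_uminus [simp]: "- k \<in> freqs n \<longleftrightarrow> k \<in> freqs n"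
  by (cases k) (auto simp: freqs_def)

lemma freqs_eventually: "eventually (\<lambda>n. k \<in> freqs n) sequentially"
  unfolding eventually_sequentially
  by (intro exI[of _ "nat (\<bar>fst k\<bar> + \<bar>snd k\<bar>)"]) (cases k, auto simp: freqs_def)

lemma sum_freqs_uminus: "(\<Sum>k\<in>freqs n. f (- k)) = (\<Sum>k\<in>freqs n. f k)"
  by (rule sum.reindex_bij_witness[of _ uminus uminus]) auto

lemma tpoly_L2: "tpoly \<alpha> n \<in> L2"
  unfolding tpoly_def by (intro L2_sum L2_scale cas_L2)

lemma tpoly_periodic: "periodic (tpoly \<alpha> n)"
  using cas_periodic by (simp add: periodic_def tpoly_def)

lemma continuous_tpoly [continuous_intros]: "continuous_on S (tpoly \<alpha> n)"
  unfolding tpoly_def by (intro continuous_intros)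

lemma tpoly_measurable [measurable]: "tpoly \<alpha> n \<in> borel_measurable borel"
  by (rule L2_measurable[OF tpoly_L2])

lemma L2_inner_tpoly: "u \<in> L2 \<Longrightarrow> L2_inner (tpoly \<alpha> n) u = (\<Sum>k\<in>freqs n. \<alpha> k * coef u k)"
  unfolding tpoly_def
  by (subst L2_inner_sum) (auto intro: L2_scale cas_L2 simp: L2_inner_scale coef_def L2_inner_commute)

lemma coef_tpoly: "coef (tpoly \<alpha> n) k = (if k \<in> freqs n then \<alpha> k else 0)"
  unfolding coef_def L2_inner_tpoly[OF cas_L2]
  by (simp add: coef_def cas_orthonormal if_distrib[of "\<lambda>x. _ * x"] cong: if_cong)

lemma L2_inner_tpoly_tpoly:
  assumes "n \<le> m"
  shows "L2_inner (tpoly \<alpha> n) (tpoly \<beta> m) = (\<Sum>k\<in>freqs n. \<alpha> k * \<beta> k)"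
  using freqs_mono[OF assms] by (auto simp: L2_inner_tpoly tpoly_L2 coef_tpoly intro!: sum.cong)

lemma L2_norm_tpoly: "(L2_norm (tpoly \<alpha> n))\<^sup>2 = (\<Sum>k\<in>freqs n. (\<alpha> k)\<^sup>2)"
  unfolding L2_norm_sq by (simp add: L2_inner_tpoly_tpoly power2_eq_square)

lemma L2_norm_diff_sq:
  assumes "u \<in> L2" "v \<in> L2"
  shows "(L2_norm (\<lambda>p. u p - v p))\<^sup>2 = (L2_norm u)\<^sup>2 - 2 * L2_inner u v + (L2_norm v)\<^sup>2"
  using assms by (simp add: L2_norm_sq L2_inner_diff L2_inner_diff_right L2_diff L2_inner_commute[of v u])

lemma L2_norm_tpoly_diff:
  assumes "n \<le> m"
  shows "(L2_norm (\<lambda>p. tpoly \<alpha> m p - tpoly \<alpha> n p))\<^sup>2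
      = (\<Sum>k\<in>freqs m. (\<alpha> k)\<^sup>2) - (\<Sum>k\<in>freqs n. (\<alpha> k)\<^sup>2)"
  unfolding L2_norm_diff_sq[OF tpoly_L2 tpoly_L2] L2_norm_tpoly
    L2_inner_commute[of "tpoly \<alpha> m" "tpoly \<alpha> n"] L2_inner_tpoly_tpoly[OF assms]
  by (simp add: power2_eq_square)

lemma integral_abs_le_L2_norm:
  assumes "u \<in> L2" shows "(\<integral>p. \<bar>u p\<bar> \<partial>torus) \<le> L2_norm u"
proof -
  have a: "(\<lambda>p. \<bar>u p\<bar>) \<in> L2"
    using assms by (auto simp: L2_def)
  have "(L2_norm (\<lambda>p. 1))\<^sup>2 = 1" by (simp add: L2_norm_sq_integral)
  then have "L2_norm (\<lambda>p. 1) = 1" by (simp add: power2_eq_1_iff) (smt (verit) L2_norm_nonneg)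
  moreover have "(L2_norm (\<lambda>p. \<bar>u p\<bar>))\<^sup>2 = (L2_norm u)\<^sup>2" by (simp add: L2_norm_sq_integral)
  then have "L2_norm (\<lambda>p. \<bar>u p\<bar>) = L2_norm u" by (rule power2_eq_imp_eq) auto
  ultimately have "\<bar>L2_inner (\<lambda>p. \<bar>u p\<bar>) (\<lambda>p. 1)\<bar> \<le> L2_norm u"
    using L2_Cauchy_Schwarz[OF a L2_const[of 1]] by simp
  then show ?thesis by (simp add: L2_inner_torus)
qed

text \<open>Along a fast subsequence the partial sums converge almost everywhere, because the sum of
  the mean absolute differences is finite. The limit is periodic since the partial sums are, and
  Fatou's lemma bounds its distance to every partial sum.\<close>
theorem riesz_fischer:
  assumes bd: "\<And>n. (\<Sum>k\<in>freqs n. (\<alpha> k)\<^sup>2) \<le> B"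
  obtains v where "v \<in> L2" "periodic v" "\<And>k. coef v k = \<alpha> k"
    "(\<lambda>n. L2_norm (\<lambda>p. v p - tpoly \<alpha> n p)) \<longlonglongrightarrow> 0"
proof -
  define A where "A n = (\<Sum>k\<in>freqs n. (\<alpha> k)\<^sup>2)" for n
  have inc: "incseq A"
    unfolding A_def incseq_def by (auto intro!: sum_mono2 freqs_mono)
  obtain S where S: "A \<longlonglongrightarrow> S" "\<And>n. A n \<le> S"
    using incseq_convergent[OF inc, of B] bd unfolding A_def by blast
  have "\<exists>N. \<forall>n\<ge>N. S - A n \<le> (1 / 4) ^ j" for j :: nat
  proof -
    have "eventually (\<lambda>n. S - (1 / 4) ^ j < A n) sequentially"
      by (rule order_tendstoD(1)[OF S(1)]) simp
    then obtain N where "\<forall>n\<ge>N. S - (1 / 4) ^ j < A n"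
      by (auto simp: eventually_sequentially)
    then show ?thesis by (intro exI[of _ N]) (auto simp: algebra_simps dest: less_imp_le)
  qed
  then obtain N where N: "\<And>j n. n \<ge> N j \<Longrightarrow> S - A n \<le> (1 / 4) ^ j" by metis
  \<comment> \<open>The partial sums make \<open>r\<close> monotone and at least \<open>N j\<close>, the summand \<open>j\<close> makes it unbounded.\<close>
  define r where "r j = (\<Sum>i\<le>j. N i) + j" for j
  have rN: "N j \<le> r j" for j
    unfolding r_def by (rule order_trans[OF member_le_sum[of j "{..j}" N]]) auto
  have rj: "j \<le> r j" and rSuc: "r j \<le> r (Suc j)" for j by (auto simp: r_def)
  define s where "s = tpoly \<alpha>"
  define d where "d j p = s (r (Suc j)) p - s (r j) p" for j p
  have dL2: "d j \<in> L2" for j unfolding d_def s_def by (intro L2_diff tpoly_L2)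
  have dn: "L2_norm (d j) \<le> (1 / 2) ^ j" for j
  proof (rule power2_le_imp_le)
    have "(L2_norm (d j))\<^sup>2 = A (r (Suc j)) - A (r j)"
      unfolding d_def s_def A_def by (rule L2_norm_tpoly_diff[OF rSuc])
    also have "\<dots> \<le> S - A (r j)" using S(2) by simp
    also have "\<dots> \<le> (1 / 4) ^ j" by (rule N[OF rN])
    also have "\<dots> = ((1 / 2) ^ j)\<^sup>2" by (simp add: power_even_eq power_divide power_mult[symmetric] mult.commute power2_eq_square flip: power_mult_distrib)
    finally show "(L2_norm (d j))\<^sup>2 \<le> ((1 / 2) ^ j)\<^sup>2" .
  qed simp
  have dm: "(\<lambda>p. ennreal \<bar>d j p\<bar>) \<in> borel_measurable torus" for j
    using L2_measurable[OF dL2[of j]] by (intro measurable_torus) simp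
  have "(\<integral>\<^sup>+p. (\<Sum>j. ennreal \<bar>d j p\<bar>) \<partial>torus) = (\<Sum>j. \<integral>\<^sup>+p. ennreal \<bar>d j p\<bar> \<partial>torus)"
    by (rule nn_integral_suminf[OF dm])
  also have "\<dots> \<le> (\<Sum>j. ennreal ((1 / 2) ^ j))"
  proof (rule suminf_le)
    fix j
    have "(\<integral>\<^sup>+p. ennreal \<bar>d j p\<bar> \<partial>torus) = ennreal (\<integral>p. \<bar>d j p\<bar> \<partial>torus)"
      using L2_integrable[OF dL2[of j]] by (intro nn_integral_eq_integral) auto
    also have "\<dots> \<le> ennreal ((1 / 2) ^ j)"
      using integral_abs_le_L2_norm[OF dL2[of j]] dn[of j] by (intro ennreal_leI) simp
    finally show "(\<integral>\<^sup>+p. ennreal \<bar>d j p\<bar> \<partial>torus) \<le> ennreal ((1 / 2) ^ j)" .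
  qed auto
  also have "\<dots> = ennreal (\<Sum>j. (1 / 2) ^ j)"
    by (rule suminf_ennreal2) (auto intro: summable_geometric)
  finally have fin: "(\<integral>\<^sup>+p. (\<Sum>j. ennreal \<bar>d j p\<bar>) \<partial>torus) < \<infinity>"
    by (rule order.strict_trans1) simp
  have "AE p in torus. (\<Sum>j. ennreal \<bar>d j p\<bar>) \<noteq> \<infinity>"
    using dm fin by (intro nn_integral_noteq_infinite borel_measurable_suminf_order) (auto simp: less_top)
  then have conv: "AE p in torus. convergent (\<lambda>j. s (r j) p)"
  proof eventually_elim
    case (elim p)
    then have "summable (\<lambda>j. \<bar>d j p\<bar>)"
      by (intro summable_suminf_not_top) auto
    then have "summable (\<lambda>j. d j p)" by (rule summable_rabs_cancel)
    then have "convergent (\<lambda>n. \<Sum>j<n. d j p)" by (simp add: summable_iff_convergent)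
    moreover have "(\<Sum>j<n. d j p) = s (r n) p - s (r 0) p" for n
      unfolding d_def by (rule sum_lessThan_telescope)
    ultimately have "convergent (\<lambda>n. (s (r n) p - s (r 0) p) + s (r 0) p)"
      by (intro convergent_add convergent_const) simp
    then show ?case by simp
  qed
  \<comment> \<open>Where the limit does not exist, \<open>v\<close> is still periodic: the sequences at congruent points are equal.\<close>
  define v where "v p = lim (\<lambda>j. s (r j) p)" for p
  have vm: "v \<in> borel_measurable borel"
    unfolding v_def s_def by measurable
  have vper: "periodic v"
    using tpoly_periodic[of \<alpha>] by (simp add: periodic_def v_def s_def)
  have est: "(\<integral>\<^sup>+p. ennreal ((v p - s n p)\<^sup>2) \<partial>torus) \<le> ennreal (S - A n)" for n
  proof -
    have "(\<integral>\<^sup>+p. ennreal ((v p - s n p)\<^sup>2) \<partial>torus)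
        = (\<integral>\<^sup>+p. liminf (\<lambda>j. ennreal ((s (r j) p - s n p)\<^sup>2)) \<partial>torus)"
    proof (rule nn_integral_cong_AE)
      show "AE p in torus. ennreal ((v p - s n p)\<^sup>2) = liminf (\<lambda>j. ennreal ((s (r j) p - s n p)\<^sup>2))"
        using conv
      proof eventually_elim
        case (elim p)
        then have "(\<lambda>j. s (r j) p) \<longlonglongrightarrow> v p" by (simp add: v_def convergent_LIMSEQ_iff)
        then have *: "(\<lambda>j. ennreal ((s (r j) p - s n p)\<^sup>2)) \<longlonglongrightarrow> ennreal ((v p - s n p)\<^sup>2)"
          by (intro tendsto_ennrealI tendsto_power tendsto_diff tendsto_const)
        show ?case by (rule lim_imp_Liminf[OF trivial_limit_sequentially *, symmetric])
      qed
    qed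
    also have "\<dots> \<le> liminf (\<lambda>j. \<integral>\<^sup>+p. ennreal ((s (r j) p - s n p)\<^sup>2) \<partial>torus)"
      unfolding s_def by (intro nn_integral_liminf measurable_torus) simp
    also have "\<dots> \<le> liminf (\<lambda>j. ennreal (S - A n))"
    proof (rule Liminf_mono)
      show "\<forall>\<^sub>F j in sequentially. (\<integral>\<^sup>+p. ennreal ((s (r j) p - s n p)\<^sup>2) \<partial>torus) \<le> ennreal (S - A n)"
        using eventually_ge_at_top[of n]
      proof eventually_elim
        case (elim j)
        then have nr: "n \<le> r j" using rj[of j] by simp
        have "(\<lambda>p. s (r j) p - s n p) \<in> L2" unfolding s_def by (intro L2_diff tpoly_L2)
        then have "(\<integral>\<^sup>+p. ennreal ((s (r j) p - s n p)\<^sup>2) \<partial>torus)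
            = ennreal ((L2_norm (\<lambda>p. s (r j) p - s n p))\<^sup>2)"
          unfolding L2_norm_sq_integral by (intro nn_integral_eq_integral) (auto simp: L2_def)
        also have "\<dots> = ennreal (A (r j) - A n)"
          unfolding s_def A_def by (simp only: L2_norm_tpoly_diff[OF nr])
        also have "\<dots> \<le> ennreal (S - A n)" using S(2) by (intro ennreal_leI) simp
        finally show ?case .
      qed
    qed
    also have "\<dots> = ennreal (S - A n)" by (simp add: Liminf_const)
    finally show ?thesis .
  qed
  have diffL2: "(\<lambda>p. v p - s n p) \<in> L2" for n
  proof -
    have m: "(\<lambda>p. v p - s n p) \<in> borel_measurable borel"
      using vm unfolding s_def by simp
    moreover have "integrable torus (\<lambda>p. (v p - s n p)\<^sup>2)"
    proof (rule integrableI_bounded)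
      show "(\<lambda>p. (v p - s n p)\<^sup>2) \<in> borel_measurable torus"
        using m by (intro measurable_torus borel_measurable_power)
      show "(\<integral>\<^sup>+p. ennreal (norm ((v p - s n p)\<^sup>2)) \<partial>torus) < \<infinity>"
        using est[of n] by (auto intro: order.strict_trans1)
    qed
    ultimately show ?thesis by (simp add: L2_def)
  qed
  have norm_le: "(L2_norm (\<lambda>p. v p - s n p))\<^sup>2 \<le> S - A n" for n
  proof -
    have "ennreal ((L2_norm (\<lambda>p. v p - s n p))\<^sup>2) = (\<integral>\<^sup>+p. ennreal ((v p - s n p)\<^sup>2) \<partial>torus)"
      unfolding L2_norm_sq_integral
      using diffL2[of n] by (intro nn_integral_eq_integral[symmetric]) (auto simp: L2_def)
    also have "\<dots> \<le> ennreal (S - A n)" by (rule est)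
    finally show ?thesis using S(2)[of n] by simp
  qed
  have "(\<lambda>n. (L2_norm (\<lambda>p. v p - s n p))\<^sup>2) \<longlonglongrightarrow> 0"
  proof (rule tendsto_sandwich[OF _ _ tendsto_const])
    show "(\<lambda>n. S - A n) \<longlonglongrightarrow> 0" using tendsto_diff[OF tendsto_const S(1), of S] by simp
  qed (use norm_le in auto)
  from tendsto_real_sqrt[OF this] have lim: "(\<lambda>n. L2_norm (\<lambda>p. v p - s n p)) \<longlonglongrightarrow> 0" by simp
  have vL2: "v \<in> L2"
    using L2_add[OF diffL2[of 0] tpoly_L2[of \<alpha> 0]] by (simp add: s_def)
  have "coef v k = \<alpha> k" for k
  proof -
    have "(\<lambda>n. coef v k - coef (s n) k) \<longlonglongrightarrow> 0"
    proof (rule Lim_null_comparison)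
      show "\<forall>\<^sub>F n in sequentially. norm (coef v k - coef (s n) k) \<le> L2_norm (\<lambda>p. v p - s n p) * L2_norm (cas k)"
        using L2_Cauchy_Schwarz[OF diffL2 cas_L2, of _ k]
        by (intro always_eventually allI)
           (simp add: coef_def s_def vL2 tpoly_L2 cas_L2 flip: L2_inner_diff)
      show "(\<lambda>n. L2_norm (\<lambda>p. v p - s n p) * L2_norm (cas k)) \<longlonglongrightarrow> 0"
        by (rule tendsto_mult_left_zero[OF lim])
    qed
    moreover have "(\<lambda>n. coef v k - coef (s n) k) \<longlonglongrightarrow> coef v k - \<alpha> k"
    proof (rule tendsto_eventually)
      show "\<forall>\<^sub>F n in sequentially. coef v k - coef (s n) k = coef v k - \<alpha> k"
        using freqs_eventually[of k] by eventually_elim (simp add: s_def coef_tpoly)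
    qed
    ultimately show ?thesis using LIMSEQ_unique by fastforce
  qed
  then show ?thesis using that[OF vL2 vper] lim by (simp add: s_def)
qed

lemma coef_diff: "u \<in> L2 \<Longrightarrow> v \<in> L2 \<Longrightarrow> coef (\<lambda>p. u p - v p) k = coef u k - coef v k"
  by (simp add: coef_def L2_inner_diff cas_L2)

lemma coef_eq_imp_AE:
  assumes "u \<in> L2" "v \<in> L2" "\<And>k. coef u k = coef v k"
  shows "AE p in torus. u p = v p"
proof -
  have "(\<lambda>p. u p - v p) \<in> orth"
    unfolding orth_def using assms by (auto simp: coef_diff L2_diff)
  from orth_imp_zero[OF this] show ?thesis by eventually_elim simp
qed

lemma bessel:
  assumes "u \<in> L2" shows "(\<Sum>k\<in>freqs n. (coef u k)\<^sup>2) \<le> (L2_norm u)\<^sup>2"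
proof -
  have "0 \<le> (L2_norm (\<lambda>p. u p - tpoly (coef u) n p))\<^sup>2" by simp
  also have "\<dots> = (L2_norm u)\<^sup>2 - (\<Sum>k\<in>freqs n. (coef u k)\<^sup>2)"
    unfolding L2_norm_diff_sq[OF assms tpoly_L2] L2_norm_tpoly
      L2_inner_commute[of u "tpoly _ _"] L2_inner_tpoly[OF assms]
    by (simp flip: power2_eq_square)
  finally show ?thesis by simp
qed

text \<open>Bessel's inequality and Riesz--Fischer provide a function with the coefficients of \<open>u\<close>
  that is the limit of the partial sums; by completeness it is \<open>u\<close>.\<close>
theorem parseval_limit:
  assumes u: "u \<in> L2" shows "(\<lambda>n. L2_norm (\<lambda>p. u p - tpoly (coef u) n p)) \<longlonglongrightarrow> 0"
proof -
  obtain v where v: "v \<in> L2" "\<And>k. coef v k = coef u k"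
    "(\<lambda>n. L2_norm (\<lambda>p. v p - tpoly (coef u) n p)) \<longlonglongrightarrow> 0"
    using riesz_fischer[OF bessel[OF u]] by metis
  have ae: "AE p in torus. u p = v p"
    using coef_eq_imp_AE[OF u v(1)] v(2) by simp
  have "L2_norm (\<lambda>p. u p - tpoly (coef u) n p) = L2_norm (\<lambda>p. v p - tpoly (coef u) n p)" for n
    by (rule L2_norm_cong_AE) (use ae L2_measurable[OF u] L2_measurable[OF v(1)] in auto)
  then show ?thesis using v(3) by simp
qed

theorem parseval:
  assumes "u \<in> L2" "v \<in> L2"
  shows "(\<lambda>n. \<Sum>k\<in>freqs n. coef u k * coef v k) \<longlonglongrightarrow> L2_inner u v"
proof -
  have "(\<lambda>n. L2_inner u v - L2_inner (tpoly (coef u) n) v) \<longlonglongrightarrow> 0"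
  proof (rule Lim_null_comparison)
    show "\<forall>\<^sub>F n in sequentially. norm (L2_inner u v - L2_inner (tpoly (coef u) n) v)
        \<le> L2_norm (\<lambda>p. u p - tpoly (coef u) n p) * L2_norm v"
      using L2_Cauchy_Schwarz[OF L2_diff[OF assms(1) tpoly_L2] assms(2)]
      by (intro always_eventually allI) (simp add: assms tpoly_L2 flip: L2_inner_diff)
    show "(\<lambda>n. L2_norm (\<lambda>p. u p - tpoly (coef u) n p) * L2_norm v) \<longlonglongrightarrow> 0"
      by (rule tendsto_mult_left_zero[OF parseval_limit[OF assms(1)]])
  qed
  from tendsto_diff[OF tendsto_const[of "L2_inner u v"] this] show ?thesis
    by (simp add: L2_inner_tpoly assms)
qed

lemma parseval_norm:
  "u \<in> L2 \<Longrightarrow> (\<lambda>n. \<Sum>k\<in>freqs n. (coef u k)\<^sup>2) \<longlonglongrightarrow> (L2_norm u)\<^sup>2"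
  unfolding L2_norm_sq using parseval[of u u] by (simp add: power2_eq_square)

section \<open>Sobolev norms in terms of coefficients\<close>

text \<open>The eigenvalue of the negative Laplacian at frequency \<open>k\<close>.\<close>
definition eig :: "int \<times> int \<Rightarrow> real" where
  "eig k = (2 * pi * of_int (fst k))\<^sup>2 + (2 * pi * of_int (snd k))\<^sup>2"

text \<open>The effect of \<open>\<partial>/\<partial>x\<close> on coefficients.\<close>
definition dxc :: "(int \<times> int \<Rightarrow> real) \<Rightarrow> int \<times> int \<Rightarrow> real" where
  "dxc \<alpha> k = - (2 * pi * of_int (fst k)) * \<alpha> (- k)"

definition dzc :: "(int \<times> int \<Rightarrow> real) \<Rightarrow> int \<times> int \<Rightarrow> real" where
  "dzc \<alpha> k = - (2 * pi * of_int (snd k)) * \<alpha> (- k)"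

text \<open>The smallest nonzero eigenvalue of the negative Laplacian.\<close>
definition lambda1 :: real where "lambda1 = 4 * pi\<^sup>2"

definition ssum :: "nat \<Rightarrow> field \<Rightarrow> nat \<Rightarrow> real" where
  "ssum m u n = (\<Sum>k\<in>freqs n. eig k ^ m * (coef u k)\<^sup>2)"

text \<open>Finiteness of the squared seminorm of order \<open>m\<close>; its value is \<open>sob m u\<close> below.\<close>
definition sobfin :: "nat \<Rightarrow> field \<Rightarrow> bool" where
  "sobfin m u \<longleftrightarrow> (\<exists>B. \<forall>n. ssum m u n \<le> B)"

definition sob :: "nat \<Rightarrow> field \<Rightarrow> real" where
  "sob m u = lim (ssum m u)"

lemma eig_nonneg [simp]: "0 \<le> eig k" and eig_uminus [simp]: "eig (- k) = eig k" and eig_zero [simp]: "eig 0 = 0"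
  by (simp_all add: eig_def)

lemma lambda1_ge_1: "1 \<le> lambda1" and lambda1_pos: "0 < lambda1"
proof -
  have "1 * 1 \<le> pi * pi" using pi_ge_two by (intro mult_mono) auto
  then show "1 \<le> lambda1" "0 < lambda1" by (auto simp: lambda1_def power2_eq_square)
qed

lemma eig_lower: "k \<noteq> 0 \<Longrightarrow> lambda1 \<le> eig k"
proof -
  assume "k \<noteq> 0"
  then have "fst k \<noteq> 0 \<or> snd k \<noteq> 0" by (simp add: prod_eq_iff)
  then have "1 \<le> (fst k)\<^sup>2 + (snd k)\<^sup>2"
    by (smt (verit) zero_less_power2 zero_le_power2)
  then have "1 \<le> (of_int (fst k))\<^sup>2 + (of_int (snd k))\<^sup>2 * (1 :: real)"
    by (metis mult.right_neutral of_int_1_le_iff of_int_add of_int_power)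
  then have "lambda1 * 1 \<le> lambda1 * ((of_int (fst k))\<^sup>2 + (of_int (snd k))\<^sup>2)"
    using lambda1_pos by (intro mult_left_mono) auto
  then show ?thesis by (simp add: eig_def lambda1_def power_mult_distrib algebra_simps)
qed

lemma ssum_nonneg: "0 \<le> ssum m u n"
  unfolding ssum_def by (intro sum_nonneg) simp

lemma incseq_ssum: "incseq (ssum m u)"
  unfolding ssum_def incseq_def by (auto intro!: sum_mono2 freqs_mono)

lemma ssum_tendsto: assumes "sobfin m u" shows "ssum m u \<longlonglongrightarrow> sob m u"
proof -
  obtain B where "\<And>n. ssum m u n \<le> B" using assms unfolding sobfin_def by blast
  then obtain L where "ssum m u \<longlonglongrightarrow> L" using incseq_convergent[OF incseq_ssum] by blast
  then show ?thesis by (simp add: sob_def limI)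
qed

lemma sobfinI: "ssum m u \<longlonglongrightarrow> L \<Longrightarrow> sobfin m u"
  unfolding sobfin_def using incseq_le[OF incseq_ssum] by blast

lemma ssum_le_sob: "sobfin m u \<Longrightarrow> ssum m u n \<le> sob m u"
  using incseq_le[OF incseq_ssum ssum_tendsto] .

lemma sob_nonneg: "sobfin m u \<Longrightarrow> 0 \<le> sob m u"
  using order_trans[OF ssum_nonneg ssum_le_sob] .

lemma sob_leI: "sobfin m u \<Longrightarrow> (\<And>n. ssum m u n \<le> B) \<Longrightarrow> sob m u \<le> B"
  by (rule LIMSEQ_le_const2[OF ssum_tendsto]) auto

lemma sob_0: assumes "u \<in> L2" shows "sobfin 0 u" "sob 0 u = (L2_norm u)\<^sup>2"
proof -
  have "ssum 0 u \<longlonglongrightarrow> (L2_norm u)\<^sup>2"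
    using parseval_norm[OF assms] by (simp add: ssum_def[abs_def])
  then show "sobfin 0 u" "sob 0 u = (L2_norm u)\<^sup>2" by (auto intro: sobfinI simp: sob_def limI)
qed

lemma coef_zero_mean: "u \<in> L2_per0 \<Longrightarrow> coef u 0 = 0"
  by (simp add: L2_per0_iff coef_def L2_inner_torus)

lemma ssum_Suc_lower:
  assumes "coef u 0 = 0" shows "lambda1 * ssum m u n \<le> ssum (Suc m) u n"
  unfolding ssum_def sum_distrib_left
proof (rule sum_mono)
  fix k
  show "lambda1 * (eig k ^ m * (coef u k)\<^sup>2) \<le> eig k ^ Suc m * (coef u k)\<^sup>2"
  proof (cases "k = 0")
    case False
    have "lambda1 * (eig k ^ m * (coef u k)\<^sup>2) \<le> eig k * (eig k ^ m * (coef u k)\<^sup>2)"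
      using eig_lower[OF False] by (intro mult_right_mono) auto
    then show ?thesis by (simp add: mult_ac)
  qed (simp add: assms)
qed

text \<open>The Poincare inequality: with zero mean only eigenvalues of size at least \<open>lambda1\<close>
  contribute.\<close>
lemma sobfin_Suc:
  assumes "coef u 0 = 0" "sobfin (Suc m) u"
  shows "sobfin m u" "lambda1 * sob m u \<le> sob (Suc m) u" "sob m u \<le> sob (Suc m) u"
proof -
  have le: "lambda1 * ssum m u n \<le> sob (Suc m) u" for n
    using order_trans[OF ssum_Suc_lower[OF assms(1)] ssum_le_sob[OF assms(2)]] .
  have "ssum m u n \<le> sob (Suc m) u / lambda1" for n
    using le[of n] lambda1_pos by (simp add: field_simps)
  then show fin: "sobfin m u" unfolding sobfin_def by blast
  show l: "lambda1 * sob m u \<le> sob (Suc m) u"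
    by (rule LIMSEQ_le_const2[OF tendsto_mult_left[OF ssum_tendsto[OF fin]]]) (use le in auto)
  have "1 * sob m u \<le> lambda1 * sob m u"
    using lambda1_ge_1 sob_nonneg[OF fin] by (intro mult_right_mono) auto
  then show "sob m u \<le> sob (Suc m) u" using l by simp
qed

lemma sobfin_mono:
  assumes "coef u 0 = 0" "sobfin m u" "j \<le> m"
  shows "sobfin j u \<and> sob j u \<le> sob m u"
proof -
  have "sobfin (m - i) u \<and> sob (m - i) u \<le> sob m u" if "i \<le> m" for i
    using that
  proof (induction i)
    case (Suc i)
    then have eq: "m - i = Suc (m - Suc i)" by simp
    from Suc have IH: "sobfin (m - i) u" "sob (m - i) u \<le> sob m u" by auto
    show ?case using sobfin_Suc[OF assms(1) IH(1)[unfolded eq]] IH(2) eq by simp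
  qed (use assms in auto)
  from this[of "m - j"] show ?thesis using assms(3) by simp
qed

subsection \<open>Test functions\<close>

lemma smooth_continuous: "smooth \<phi> \<Longrightarrow> continuous_on UNIV \<phi>"
  by (erule smooth.cases) (auto simp: continuous_on_eq_continuous_at differentiable_imp_continuous_within)

lemma smooth_pdx: "smooth \<phi> \<Longrightarrow> smooth (pdx \<phi>)" and smooth_pdz: "smooth \<phi> \<Longrightarrow> smooth (pdz \<phi>)"
  by (erule smooth.cases, simp)+

lemma periodic_pdx: "periodic \<phi> \<Longrightarrow> periodic (pdx \<phi>)"
proof -
  assume p: "periodic \<phi>"
  have "deriv (\<lambda>s. \<phi> (s, z)) (x + 1) = deriv (\<lambda>s. \<phi> (s, z)) x" for x z
  proof -
    have "(\<lambda>s. \<phi> (s, z)) \<circ> (\<lambda>s. s + 1) = (\<lambda>s. \<phi> (s, z))" using p by (auto simp: periodic_def)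
    then have "((\<lambda>s. \<phi> (s, z)) has_real_derivative D) (at (x + 1)) \<longleftrightarrow> ((\<lambda>s. \<phi> (s, z)) has_real_derivative D) (at x)" for D
      using DERIV_shift[of "\<lambda>s. \<phi> (s, z)" D x 1] p by (simp add: periodic_def)
    then show ?thesis by (simp add: deriv_def)
  qed
  moreover have "(\<lambda>s. \<phi> (s, z + 1)) = (\<lambda>s. \<phi> (s, z))" for z using p by (simp add: periodic_def)
  ultimately show ?thesis by (simp add: periodic_def pdx_def)
qed

lemma periodic_pdz: "periodic \<phi> \<Longrightarrow> periodic (pdz \<phi>)"
proof -
  assume p: "periodic \<phi>"
  have "deriv (\<lambda>s. \<phi> (x, s)) (z + 1) = deriv (\<lambda>s. \<phi> (x, s)) z" for x z
  proof -
    have "((\<lambda>s. \<phi> (x, s)) has_real_derivative D) (at (z + 1)) \<longleftrightarrow> ((\<lambda>s. \<phi> (x, s)) has_real_derivative D) (at z)" for D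
      using DERIV_shift[of "\<lambda>s. \<phi> (x, s)" D z 1] p by (simp add: periodic_def)
    then show ?thesis by (simp add: deriv_def)
  qed
  moreover have "(\<lambda>s. \<phi> (x + 1, s)) = (\<lambda>s. \<phi> (x, s))" for x using p by (simp add: periodic_def)
  ultimately show ?thesis by (simp add: periodic_def pdz_def)
qed

lemma test_pdx: "\<phi> \<in> test_functions \<Longrightarrow> pdx \<phi> \<in> test_functions"
  and test_pdz: "\<phi> \<in> test_functions \<Longrightarrow> pdz \<phi> \<in> test_functions"
  by (auto simp: test_functions_def smooth_pdx smooth_pdz periodic_pdx periodic_pdz)

lemma test_continuous: "\<phi> \<in> test_functions \<Longrightarrow> continuous_on UNIV \<phi>"
  by (simp add: test_functions_def smooth_continuous)

lemma test_L2: assumes "\<phi> \<in> test_functions" shows "\<phi> \<in> L2"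
proof -
  have c: "continuous_on UNIV \<phi>" by (rule test_continuous[OF assms])
  have "integrable torus (\<lambda>p. (\<phi> p)\<^sup>2)"
    by (intro continuous_integrable_torus continuous_on_power c)
  then show ?thesis using borel_measurable_continuous_onI[OF c] by (simp add: L2_def)
qed

lemma smooth_deriv_x: "smooth \<phi> \<Longrightarrow> ((\<lambda>s. \<phi> (s, z)) has_real_derivative pdx \<phi> (x, z)) (at x)"
proof -
  assume "smooth \<phi>"
  then have "\<phi> differentiable (at (x, z))" by (auto elim: smooth.cases)
  then have "(\<lambda>s. \<phi> (s, z)) differentiable (at x)"
    using differentiable_chain_at[of "\<lambda>s. (s, z)" x \<phi>] by (simp add: o_def)
  then have "(\<lambda>s. \<phi> (s, z)) field_differentiable (at x)"
    unfolding field_differentiable_def differentiable_def has_field_derivative_def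
    using has_real_derivative has_field_derivative_def by metis
  then show ?thesis by (simp add: pdx_def DERIV_deriv_iff_field_differentiable)
qed

lemma smooth_deriv_z: "smooth \<phi> \<Longrightarrow> ((\<lambda>s. \<phi> (x, s)) has_real_derivative pdz \<phi> (x, z)) (at z)"
proof -
  assume "smooth \<phi>"
  then have "\<phi> differentiable (at (x, z))" by (auto elim: smooth.cases)
  then have "(\<lambda>s. \<phi> (x, s)) differentiable (at z)"
    using differentiable_chain_at[of "\<lambda>s. (x, s)" z \<phi>] by (simp add: o_def)
  then have "(\<lambda>s. \<phi> (x, s)) field_differentiable (at z)"
    unfolding field_differentiable_def differentiable_def has_field_derivative_def
    using has_real_derivative has_field_derivative_def by metis
  then show ?thesis by (simp add: pdz_def DERIV_deriv_iff_field_differentiable)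
qed

lemma periodic_unit: "periodic \<phi> \<Longrightarrow> \<phi> (1, z) = \<phi> (0, z)" "periodic \<phi> \<Longrightarrow> \<phi> (x, 1) = \<phi> (x, 0)"
  unfolding periodic_def by (metis add_0)+

text \<open>Integration by parts against a basis function.\<close>
lemma coef_pdx: assumes "\<phi> \<in> test_functions" shows "coef (pdx \<phi>) k = dxc (coef \<phi>) k"
proof -
  let ?c = "2 * pi * of_int (fst k)"
  have s: "smooth \<phi>" and p: "periodic \<phi>" using assms by (auto simp: test_functions_def)
  have "0 = (\<integral>p. pdx \<phi> p * cas k p + ?c * (\<phi> p * cas (- k) p) \<partial>torus)"
  proof (rule integral_partial_x_zero[where f="\<lambda>p. \<phi> p * cas k p", symmetric])
    show "((\<lambda>s. \<phi> (s, z) * cas k (s, z)) has_real_derivative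
        pdx \<phi> (x, z) * cas k (x, z) + ?c * (\<phi> (x, z) * cas (- k) (x, z))) (at x)" for x z
      using DERIV_mult[OF smooth_deriv_x[OF s, of z x] cas_deriv_x[of k z x]] by (simp add: mult_ac)
    show "continuous_on UNIV (\<lambda>p. pdx \<phi> p * cas k p + ?c * (\<phi> p * cas (- k) p))"
      by (intro continuous_intros smooth_continuous s smooth_pdx)
  qed (simp add: periodic_unit[OF p] cas_unit_period)
  also have "\<dots> = coef (pdx \<phi>) k + ?c * coef \<phi> (- k)"
    unfolding coef_def L2_inner_torus
    by (simp add: L2_mult_integrable test_L2 test_pdx assms cas_L2)
  finally show ?thesis by (simp add: dxc_def)
qed

lemma coef_pdz: assumes "\<phi> \<in> test_functions" shows "coef (pdz \<phi>) k = dzc (coef \<phi>) k"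
proof -
  let ?c = "2 * pi * of_int (snd k)"
  have s: "smooth \<phi>" and p: "periodic \<phi>" using assms by (auto simp: test_functions_def)
  have "0 = (\<integral>p. pdz \<phi> p * cas k p + ?c * (\<phi> p * cas (- k) p) \<partial>torus)"
  proof (rule integral_partial_z_zero[where f="\<lambda>p. \<phi> p * cas k p", symmetric])
    show "((\<lambda>s. \<phi> (x, s) * cas k (x, s)) has_real_derivative
        pdz \<phi> (x, z) * cas k (x, z) + ?c * (\<phi> (x, z) * cas (- k) (x, z))) (at z)" for x z
      using DERIV_mult[OF smooth_deriv_z[OF s, of x z] cas_deriv_z[of k x z]] by (simp add: mult_ac)
    show "continuous_on UNIV (\<lambda>p. pdz \<phi> p * cas k p + ?c * (\<phi> p * cas (- k) p))"
      by (intro continuous_intros smooth_continuous s smooth_pdz)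
  qed (simp add: periodic_unit[OF p] cas_unit_period)
  also have "\<dots> = coef (pdz \<phi>) k + ?c * coef \<phi> (- k)"
    unfolding coef_def L2_inner_torus
    by (simp add: L2_mult_integrable test_L2 test_pdz assms cas_L2)
  finally show ?thesis by (simp add: dzc_def)
qed

subsection \<open>Weak derivatives\<close>

lemma sum_odd_adjoint:
  fixes a b m :: "int \<times> int \<Rightarrow> real"
  assumes "\<And>k. m (- k) = - m k"
  shows "(\<Sum>k\<in>freqs n. a k * (- m k * b (- k))) = - (\<Sum>k\<in>freqs n. (- m k * a (- k)) * b k)"
proof -
  have "(\<Sum>k\<in>freqs n. a k * (- m k * b (- k))) = (\<Sum>k\<in>freqs n. a (- k) * (- m (- k) * b (- (- k))))"
    by (rule sum_freqs_uminus[symmetric])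
  also have "\<dots> = (\<Sum>k\<in>freqs n. - ((- m k * a (- k)) * b k))"
    by (rule sum.cong) (auto simp: assms)
  finally show ?thesis by (simp add: sum_negf)
qed

lemma sum_dxc_adjoint: "(\<Sum>k\<in>freqs n. a k * dxc b k) = - (\<Sum>k\<in>freqs n. dxc a k * b k)"
  and sum_dzc_adjoint: "(\<Sum>k\<in>freqs n. a k * dzc b k) = - (\<Sum>k\<in>freqs n. dzc a k * b k)"
  unfolding dxc_def dzc_def by (rule sum_odd_adjoint, simp)+

text \<open>A weak identity is decided by its coefficients: the basis functions are test functions,
  and Parseval's identity extends equality of coefficients to every test function.\<close>
lemma weak_formulation_coef:
  assumes g: "g \<in> L2"
    and T: "\<And>\<phi>. \<phi> \<in> test_functions \<Longrightarrow> (\<lambda>n. \<Sum>k\<in>freqs n. \<alpha> k * coef \<phi> k) \<longlonglongrightarrow> T \<phi>"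
  shows "(\<forall>\<phi>\<in>test_functions. T \<phi> = L2_inner g \<phi>) \<longleftrightarrow> coef g = \<alpha>"
proof
  assume w: "\<forall>\<phi>\<in>test_functions. T \<phi> = L2_inner g \<phi>"
  show "coef g = \<alpha>"
  proof
    fix k
    have c: "coef (cas k) j = (if j = k then 1 else 0)" for j
      by (simp add: coef_def cas_orthonormal)
    have "\<forall>\<^sub>F n in sequentially. (\<Sum>j\<in>freqs n. \<alpha> j * coef (cas k) j) = \<alpha> k"
      using freqs_eventually[of k]
      by eventually_elim (simp add: c if_distrib[of "\<lambda>x. _ * x"] cong: if_cong)
    then have "(\<lambda>n. \<Sum>j\<in>freqs n. \<alpha> j * coef (cas k) j) \<longlonglongrightarrow> \<alpha> k"
      by (rule tendsto_eventually)
    then have "T (cas k) = \<alpha> k" using T[OF cas_test] LIMSEQ_unique by blast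
    then show "coef g k = \<alpha> k" using w cas_test[of k] by (simp add: coef_def)
  qed
next
  assume "coef g = \<alpha>"
  then show "\<forall>\<phi>\<in>test_functions. T \<phi> = L2_inner g \<phi>"
    using T parseval[OF g test_L2] LIMSEQ_unique by blast
qed

lemma weak_dx_iff:
  assumes "u \<in> L2" "g \<in> L2" shows "weak_dx u g \<longleftrightarrow> coef g = dxc (coef u)"
proof -
  have "(\<lambda>n. \<Sum>k\<in>freqs n. dxc (coef u) k * coef \<phi> k) \<longlonglongrightarrow> - L2_inner u (pdx \<phi>)" if t: "\<phi> \<in> test_functions" for \<phi>
    using tendsto_minus[OF parseval[OF assms(1) test_L2[OF test_pdx[OF t]]]]
    by (simp add: coef_pdx[OF t] sum_dxc_adjoint)
  from weak_formulation_coef[OF assms(2) this] show ?thesis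
    by (simp add: weak_dx_def minus_equation_iff[of "L2_inner u _"] eq_commute[of "- L2_inner g _"])
qed

lemma weak_dz_iff:
  assumes "u \<in> L2" "g \<in> L2" shows "weak_dz u g \<longleftrightarrow> coef g = dzc (coef u)"
proof -
  have "(\<lambda>n. \<Sum>k\<in>freqs n. dzc (coef u) k * coef \<phi> k) \<longlonglongrightarrow> - L2_inner u (pdz \<phi>)" if t: "\<phi> \<in> test_functions" for \<phi>
    using tendsto_minus[OF parseval[OF assms(1) test_L2[OF test_pdz[OF t]]]]
    by (simp add: coef_pdz[OF t] sum_dzc_adjoint)
  from weak_formulation_coef[OF assms(2) this] show ?thesis
    by (simp add: weak_dz_def minus_equation_iff[of "L2_inner u _"] eq_commute[of "- L2_inner g _"])
qed

lemma dxc_dxc: "dxc (dxc a) k = - (2 * pi * of_int (fst k))\<^sup>2 * a k"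
  and dzc_dzc: "dzc (dzc a) k = - (2 * pi * of_int (snd k))\<^sup>2 * a k"
  by (simp_all add: dxc_def dzc_def power2_eq_square)

lemma coef_lap_test:
  assumes "\<phi> \<in> test_functions"
  shows "coef (\<lambda>p. pdx (pdx \<phi>) p + pdz (pdz \<phi>) p) k = - eig k * coef \<phi> k"
proof -
  have "coef (\<lambda>p. pdx (pdx \<phi>) p + pdz (pdz \<phi>) p) k = coef (pdx (pdx \<phi>)) k + coef (pdz (pdz \<phi>)) k"
    unfolding coef_def by (intro L2_inner_add test_L2 test_pdx test_pdz assms cas_L2)
  also have "\<dots> = dxc (dxc (coef \<phi>)) k + dzc (dzc (coef \<phi>)) k"
    using assms by (simp add: coef_pdx coef_pdz test_pdx test_pdz dxc_def dzc_def)
  finally show ?thesis by (simp add: dxc_dxc dzc_dzc eig_def algebra_simps)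
qed

lemma weak_lap_iff:
  assumes "u \<in> L2" "g \<in> L2" shows "weak_lap u g \<longleftrightarrow> coef g = (\<lambda>k. - eig k * coef u k)"
  unfolding weak_lap_def
proof (rule weak_formulation_coef[OF assms(2)])
  fix \<phi> assume t: "\<phi> \<in> test_functions"
  from parseval[OF assms(1) L2_add[OF test_L2[OF test_pdx[OF test_pdx[OF t]]] test_L2[OF test_pdz[OF test_pdz[OF t]]]]]
  show "(\<lambda>n. \<Sum>k\<in>freqs n. - eig k * coef u k * coef \<phi> k) \<longlonglongrightarrow> L2_inner u (\<lambda>p. pdx (pdx \<phi>) p + pdz (pdz \<phi>) p)"
    by (simp add: coef_lap_test[OF t] mult_ac)
qed

text \<open>This is where functions are constructed rather than given, namely the weak derivatives of
  \<open>\<psi> t\<close> and \<open>\<rho> t\<close>.\<close>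
lemma L2_per0_from_coef:
  assumes "\<And>n. (\<Sum>k\<in>freqs n. (\<alpha> k)\<^sup>2) \<le> B" "\<alpha> 0 = 0"
  obtains v where "v \<in> L2_per0" "coef v = \<alpha>"
proof -
  obtain v where v: "v \<in> L2" "periodic v" "\<And>k. coef v k = \<alpha> k"
    using riesz_fischer[OF assms(1)] by blast
  have "(\<integral>p. v p \<partial>torus) = coef v 0" by (simp add: coef_def L2_inner_torus)
  then have "v \<in> L2_per0" using v assms(2) by (simp add: L2_per0_iff)
  with v(3) that show ?thesis by blast
qed

lemma sum_dxc_dzc_sq:
  "(\<Sum>k\<in>freqs n. eig k ^ m * (dxc a k)\<^sup>2) + (\<Sum>k\<in>freqs n. eig k ^ m * (dzc a k)\<^sup>2)
    = (\<Sum>k\<in>freqs n. eig k ^ Suc m * (a k)\<^sup>2)"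
proof -
  have "(\<Sum>k\<in>freqs n. eig k ^ Suc m * (a k)\<^sup>2) = (\<Sum>k\<in>freqs n. eig (- k) ^ Suc m * (a (- k))\<^sup>2)"
    by (rule sum_freqs_uminus[symmetric])
  also have "\<dots> = (\<Sum>k\<in>freqs n. eig k ^ m * (dxc a k)\<^sup>2 + eig k ^ m * (dzc a k)\<^sup>2)"
  proof (rule sum.cong)
    fix k
    have "(dxc a k)\<^sup>2 + (dzc a k)\<^sup>2 = eig k * (a (- k))\<^sup>2"
      by (simp add: dxc_def dzc_def eig_def power_mult_distrib algebra_simps)
    then show "eig (- k) ^ Suc m * (a (- k))\<^sup>2 = eig k ^ m * (dxc a k)\<^sup>2 + eig k ^ m * (dzc a k)\<^sup>2"
      by (simp flip: distrib_left)
  qed simp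
  finally show ?thesis by (simp add: sum.distrib)
qed

lemma ssum_gradient:
  "coef g = dxc (coef u) \<Longrightarrow> coef h = dzc (coef u) \<Longrightarrow> ssum m g n + ssum m h n = ssum (Suc m) u n"
  unfolding ssum_def by (simp only: sum_dxc_dzc_sq)

lemma sob_gradient:
  assumes g: "coef g = dxc (coef u)" and h: "coef h = dzc (coef u)" and f: "sobfin (Suc m) u"
  shows "sobfin m g" "sobfin m h" "sob m g + sob m h = sob (Suc m) u"
proof -
  have le: "ssum m g n \<le> sob (Suc m) u" "ssum m h n \<le> sob (Suc m) u" for n
    using ssum_gradient[OF g h, of m n] ssum_nonneg[of m g n] ssum_nonneg[of m h n] ssum_le_sob[OF f, of n] by auto
  then show fin: "sobfin m g" "sobfin m h" unfolding sobfin_def by blast+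
  have "(\<lambda>n. ssum m g n + ssum m h n) \<longlonglongrightarrow> sob m g + sob m h"
    by (intro tendsto_add ssum_tendsto fin)
  then have "ssum (Suc m) u \<longlonglongrightarrow> sob m g + sob m h" by (simp add: ssum_gradient[OF g h])
  then show "sob m g + sob m h = sob (Suc m) u" by (simp add: sob_def limI)
qed

lemma Dx_Dz_exist:
  assumes u: "u \<in> L2_per0" and f: "sobfin 1 u"
  shows "\<exists>g\<in>L2_per0. weak_dx u g" "\<exists>g\<in>L2_per0. weak_dz u g"
proof -
  obtain B where "\<And>n. ssum 1 u n \<le> B" using f unfolding sobfin_def by blast
  moreover have "(\<Sum>k\<in>freqs n. (dxc (coef u) k)\<^sup>2) + (\<Sum>k\<in>freqs n. (dzc (coef u) k)\<^sup>2) = ssum 1 u n" for n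
    using sum_dxc_dzc_sq[of 0 "coef u" n] by (simp add: ssum_def)
  moreover have "0 \<le> (\<Sum>k\<in>freqs n. (dxc (coef u) k)\<^sup>2)" "0 \<le> (\<Sum>k\<in>freqs n. (dzc (coef u) k)\<^sup>2)" for n
    by (simp_all add: sum_nonneg)
  ultimately have B: "(\<Sum>k\<in>freqs n. (dxc (coef u) k)\<^sup>2) \<le> B" "(\<Sum>k\<in>freqs n. (dzc (coef u) k)\<^sup>2) \<le> B" for n
    by (smt (verit))+
  have z: "dxc (coef u) 0 = 0" "dzc (coef u) 0 = 0" by (simp_all add: dxc_def dzc_def)
  obtain g where "g \<in> L2_per0" "coef g = dxc (coef u)"
    by (rule L2_per0_from_coef[OF B(1) z(1)])
  then show "\<exists>g\<in>L2_per0. weak_dx u g" using u weak_dx_iff L2_per0_L2 by blast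
  obtain g where "g \<in> L2_per0" "coef g = dzc (coef u)"
    by (rule L2_per0_from_coef[OF B(2) z(2)])
  then show "\<exists>g\<in>L2_per0. weak_dz u g" using u weak_dz_iff L2_per0_L2 by blast
qed

lemma Dx_props: assumes "u \<in> L2_per0" "sobfin 1 u"
  shows "Dx u \<in> L2_per0" "coef (Dx u) = dxc (coef u)"
proof -
  have "\<exists>g. g \<in> L2_per0 \<and> weak_dx u g" using Dx_Dz_exist(1)[OF assms] by blast
  then have "Dx u \<in> L2_per0 \<and> weak_dx u (Dx u)" unfolding Dx_def by (rule someI_ex)
  then show "Dx u \<in> L2_per0" "coef (Dx u) = dxc (coef u)"
    using assms weak_dx_iff[of u "Dx u"] L2_per0_L2 by blast+
qed

lemma Dz_props: assumes "u \<in> L2_per0" "sobfin 1 u"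
  shows "Dz u \<in> L2_per0" "coef (Dz u) = dzc (coef u)"
proof -
  have "\<exists>g. g \<in> L2_per0 \<and> weak_dz u g" using Dx_Dz_exist(2)[OF assms] by blast
  then have "Dz u \<in> L2_per0 \<and> weak_dz u (Dz u)" unfolding Dz_def by (rule someI_ex)
  then show "Dz u \<in> L2_per0" "coef (Dz u) = dzc (coef u)"
    using assms weak_dz_iff[of u "Dz u"] L2_per0_L2 by blast+
qed

lemma H2_per0_props:
  assumes "u \<in> H2_per0"
  shows "u \<in> L2_per0" "Lap u \<in> L2_per0" "coef (Lap u) k = - eig k * coef u k" "sobfin 2 u"
proof -
  show u: "u \<in> L2_per0" using assms by (simp add: H2_per0_def)
  have "\<exists>g. g \<in> L2_per0 \<and> weak_lap u g" using assms unfolding H2_per0_def by blast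
  then have L: "Lap u \<in> L2_per0 \<and> weak_lap u (Lap u)" unfolding Lap_def by (rule someI_ex)
  then show "Lap u \<in> L2_per0" ..
  have c: "coef (Lap u) k = - eig k * coef u k" for k
    using L u weak_lap_iff[of u "Lap u"] L2_per0_L2 by auto
  then show "coef (Lap u) k = - eig k * coef u k" .
  have "ssum 2 u n = ssum 0 (Lap u) n" for n
    by (simp add: ssum_def c power_mult_distrib)
  then show "sobfin 2 u"
    using sob_0(1)[OF L2_per0_L2[of "Lap u"]] L by (simp add: sobfin_def)
qed

lemma sob_Lap:
  assumes "\<And>k. coef v k = - eig k * coef u k"
  shows "sobfin m v \<longleftrightarrow> sobfin (m + 2) u" "sob m v = sob (m + 2) u"
proof -
  have "ssum m v = ssum (m + 2) u"
    unfolding ssum_def assms by (simp add: power_mult_distrib power_add power2_eq_square mult_ac)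
  then show "sobfin m v \<longleftrightarrow> sobfin (m + 2) u" "sob m v = sob (m + 2) u"
    by (simp_all add: sobfin_def sob_def)
qed

text \<open>The squared seminorm of order \<open>m + 1\<close> of a function is the sum of those of order \<open>m\<close> of
  its two derivatives, so the recursion that defines the spaces can be followed.\<close>
theorem H_per0_iff: "u \<in> H_per0 m \<longleftrightarrow> u \<in> L2_per0 \<and> sobfin m u"
proof (induction m arbitrary: u)
  case 0 then show ?case using sob_0(1) L2_per0_L2 by auto
next
  case (Suc m)
  show ?case
  proof
    assume "u \<in> H_per0 (Suc m)"
    then obtain g h where u: "u \<in> L2_per0" and g: "g \<in> H_per0 m" "weak_dx u g" and h: "h \<in> H_per0 m" "weak_dz u h"
      by auto
    then have gh: "g \<in> L2_per0" "sobfin m g" "h \<in> L2_per0" "sobfin m h" using Suc by auto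
    have c: "coef g = dxc (coef u)" "coef h = dzc (coef u)"
      using weak_dx_iff[of u g] weak_dz_iff[of u h] u g h gh L2_per0_L2 by blast+
    have "ssum (Suc m) u n \<le> sob m g + sob m h" for n
      using ssum_gradient[OF c, of m n] ssum_le_sob[OF gh(2), of n] ssum_le_sob[OF gh(4), of n] by linarith
    then show "u \<in> L2_per0 \<and> sobfin (Suc m) u" using u unfolding sobfin_def by blast
  next
    assume a: "u \<in> L2_per0 \<and> sobfin (Suc m) u"
    then have s1: "sobfin 1 u" using sobfin_mono[of u "Suc m" 1] coef_zero_mean by auto
    note x = Dx_props[OF _ s1] and z = Dz_props[OF _ s1]
    have "Dx u \<in> H_per0 m" "Dz u \<in> H_per0 m"
      using a x z sob_gradient[of "Dx u" u "Dz u" m] by (auto simp: Suc)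
    moreover have "weak_dx u (Dx u)" "weak_dz u (Dz u)"
      using a x z weak_dx_iff[of u "Dx u"] weak_dz_iff[of u "Dz u"] L2_per0_L2 by blast+
    ultimately show "u \<in> H_per0 (Suc m)" using a by auto
  qed
qed

lemma grad_norm_eq: "(grad_norm u)\<^sup>2 = (L2_norm (Dx u))\<^sup>2 + (L2_norm (Dz u))\<^sup>2"
  by (simp add: grad_norm_def)

lemma grad_norm_sq: assumes "u \<in> L2_per0" "sobfin 1 u" shows "(grad_norm u)\<^sup>2 = sob 1 u"
  using sob_gradient(3)[OF Dx_props(2)[OF assms] Dz_props(2)[OF assms], of 0] assms(2)
    sob_0(2)[OF L2_per0_L2[OF Dx_props(1)[OF assms]]] sob_0(2)[OF L2_per0_L2[OF Dz_props(1)[OF assms]]]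
  by (simp add: grad_norm_eq)

text \<open>Each derivative trades one order, and the other half of the gradient is dropped.\<close>
lemma derivative_power:
  assumes "D = Dx \<or> D = Dz" "u \<in> L2_per0" "sobfin m u" "j \<le> m"
  shows "(D ^^ j) u \<in> L2_per0 \<and> sobfin (m - j) ((D ^^ j) u) \<and> sob (m - j) ((D ^^ j) u) \<le> sob m u"
  using assms(4)
proof (induction j)
  case (Suc j)
  let ?v = "(D ^^ j) u"
  have eq: "m - j = Suc (m - Suc j)" using Suc.prems by simp
  from Suc have IH: "?v \<in> L2_per0" "sobfin (Suc (m - Suc j)) ?v" "sob (Suc (m - Suc j)) ?v \<le> sob m u"
    by (auto simp flip: eq)
  have s1: "sobfin 1 ?v" using sobfin_mono[OF coef_zero_mean[OF IH(1)] IH(2), of 1] by auto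
  note c = Dx_props[OF IH(1) s1] Dz_props[OF IH(1) s1]
  note g = sob_gradient[OF c(2,4) IH(2)]
  show ?case using assms(1) c g IH(3) sob_nonneg[OF g(1)] sob_nonneg[OF g(2)] by auto
qed (use assms in auto)

lemma finite_orders: "finite {(i, j). i + j \<le> (m::nat)}"
  by (rule finite_subset[of _ "{..m} \<times> {..m}"]) auto

text \<open>By the Poincare inequality every derivative of order at most \<open>m\<close> is controlled by the
  seminorm of order \<open>m\<close>.\<close>
lemma H_norm_le:
  assumes "u \<in> L2_per0" "sobfin m u"
  shows "H_norm m u \<le> sqrt (card {(i, j). i + j \<le> m}) * sqrt (sob m u)"
proof -
  have "(L2_norm ((Dx ^^ i) ((Dz ^^ j) u)))\<^sup>2 \<le> sob m u" if "i + j \<le> m" for i j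
  proof -
    let ?v = "(Dz ^^ j) u"
    have v: "?v \<in> L2_per0" "sobfin (m - j) ?v" "sob (m - j) ?v \<le> sob m u"
      using derivative_power[of Dz, OF _ assms, of j] that by auto
    let ?w = "(Dx ^^ i) ?v"
    have w: "?w \<in> L2_per0" "sobfin (m - j - i) ?w" "sob (m - j - i) ?w \<le> sob (m - j) ?v"
      using derivative_power[of Dx, OF _ v(1,2), of i] that by auto
    have "sob 0 ?w \<le> sob (m - j - i) ?w"
      using sobfin_mono[OF coef_zero_mean[OF w(1)] w(2), of 0] by simp
    then show ?thesis using sob_0(2)[OF L2_per0_L2[OF w(1)]] w(3) v(3) by simp
  qed
  then have "(\<Sum>(i, j)\<in>{(i, j). i + j \<le> m}. (L2_norm ((Dx ^^ i) ((Dz ^^ j) u)))\<^sup>2)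
      \<le> (\<Sum>(i, j)\<in>{(i, j). i + j \<le> m}. sob m u)"
    by (intro sum_mono) auto
  then show ?thesis
    unfolding H_norm_def by (simp add: case_prod_unfold flip: real_sqrt_mult)
qed

lemma H_norm_sq: "(H_norm m u)\<^sup>2 = (\<Sum>(i, j)\<in>{(i, j). i + j \<le> m}. (L2_norm ((Dx ^^ i) ((Dz ^^ j) u)))\<^sup>2)"
  unfolding H_norm_def by (rule real_sqrt_pow2) (auto intro: sum_nonneg)

lemma L2_norm_le_H_norm:
  assumes "A \<subseteq> {(i, j). i + j \<le> m}"
  shows "(\<Sum>(i, j)\<in>A. (L2_norm ((Dx ^^ i) ((Dz ^^ j) u)))\<^sup>2) \<le> (H_norm m u)\<^sup>2"
  unfolding H_norm_sq by (intro sum_mono2 finite_orders assms) auto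

lemma sob_1_le_H_norm:
  assumes "u \<in> H_per0 1" shows "sob 1 u \<le> (H_norm 1 u)\<^sup>2"
proof -
  have "(grad_norm u)\<^sup>2 = sob 1 u" using assms grad_norm_sq unfolding H_per0_iff by blast
  moreover have "(grad_norm u)\<^sup>2 = (\<Sum>(i, j)\<in>{(1, 0), (0, 1)}. (L2_norm ((Dx ^^ i) ((Dz ^^ j) u)))\<^sup>2)"
    by (simp add: grad_norm_def)
  ultimately show ?thesis using L2_norm_le_H_norm[of "{(1, 0), (0, 1)}" 1 u] by auto
qed

lemma square_sum_le: "(a + b)\<^sup>2 \<le> 2 * (a\<^sup>2 + b\<^sup>2)" for a b :: real
proof -
  have "0 \<le> (a - b)\<^sup>2" by simp
  then show ?thesis by (simp add: power2_sum power2_diff)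
qed

text \<open>The pure second derivatives already control the Laplacian, because
  \<open>(a + b)\<^sup>2 \<le> 2 (a\<^sup>2 + b\<^sup>2)\<close>.\<close>
lemma sob_2_le_H_norm:
  assumes u: "u \<in> L2_per0" and f: "sobfin 2 u" shows "sob 2 u \<le> 2 * (H_norm 2 u)\<^sup>2"
proof -
  have s1: "sobfin 1 u" using sobfin_mono[OF coef_zero_mean[OF u] f, of 1] by simp
  note x = Dx_props[OF u s1] and z = Dz_props[OF u s1]
  have f': "sobfin (Suc 1) u" using f by (simp add: numeral_2_eq_2)
  note g = sob_gradient[OF x(2) z(2) f']
  note xx = Dx_props[OF x(1) g(1)] and zz = Dz_props[OF z(1) g(2)]
  have "ssum 2 u n \<le> 2 * (H_norm 2 u)\<^sup>2" for n
  proof -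
    have "ssum 2 u n \<le> (\<Sum>k\<in>freqs n. 2 * ((coef (Dx (Dx u)) k)\<^sup>2 + (coef (Dz (Dz u)) k)\<^sup>2))"
      unfolding ssum_def
    proof (rule sum_mono)
      fix k
      let ?a = "(2 * pi * of_int (fst k))\<^sup>2 * coef u k" and ?b = "(2 * pi * of_int (snd k))\<^sup>2 * coef u k"
      have "eig k ^ 2 * (coef u k)\<^sup>2 = (?a + ?b)\<^sup>2"
        by (simp add: eig_def power_mult_distrib flip: distrib_right)
      also have "\<dots> \<le> 2 * (?a\<^sup>2 + ?b\<^sup>2)"
        by (rule square_sum_le)
      also have "?a\<^sup>2 = (coef (Dx (Dx u)) k)\<^sup>2" unfolding xx(2) x(2) dxc_dxc by simp
      also have "?b\<^sup>2 = (coef (Dz (Dz u)) k)\<^sup>2" unfolding zz(2) z(2) dzc_dzc by simp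
      finally show "eig k ^ 2 * (coef u k)\<^sup>2 \<le> 2 * ((coef (Dx (Dx u)) k)\<^sup>2 + (coef (Dz (Dz u)) k)\<^sup>2)" .
    qed
    also have "\<dots> \<le> 2 * ((L2_norm (Dx (Dx u)))\<^sup>2 + (L2_norm (Dz (Dz u)))\<^sup>2)"
      using bessel[OF L2_per0_L2[OF xx(1)], of n] bessel[OF L2_per0_L2[OF zz(1)], of n]
      by (simp add: sum.distrib flip: sum_distrib_left)
    also have "(L2_norm (Dx (Dx u)))\<^sup>2 + (L2_norm (Dz (Dz u)))\<^sup>2
        = (\<Sum>(i, j)\<in>{(2, 0), (0, 2)}. (L2_norm ((Dx ^^ i) ((Dz ^^ j) u)))\<^sup>2)"
      by (simp add: numeral_2_eq_2)
    also have "\<dots> \<le> (H_norm 2 u)\<^sup>2" by (rule L2_norm_le_H_norm) auto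
    finally show ?thesis by simp
  qed
  then show ?thesis by (rule sob_leI[OF f])
qed

section \<open>The Jacobian\<close>

subsection \<open>A sup bound for functions with two derivatives\<close>

text \<open>The bound telescopes: \<open>2 / (1 + (n + 1)\<^sup>2) \<le> 4 / (n + 1) - 4 / (n + 2)\<close>.\<close>
lemma sum_inverse_1_plus_sq: "(\<Sum>i\<in>{- int n..int n}. 1 / (1 + (of_int i)\<^sup>2)) \<le> (5 - 4 / (real n + 1) :: real)"
proof (induction n)
  case (Suc n)
  have "{- int (Suc n)..int (Suc n)} = insert (int (Suc n)) (insert (- int (Suc n)) {- int n..int n})"
    by auto
  then have "(\<Sum>i\<in>{- int (Suc n)..int (Suc n)}. 1 / (1 + (of_int i)\<^sup>2))
      = 2 * (1 / (1 + (real n + 1)\<^sup>2)) + (\<Sum>i\<in>{- int n..int n}. 1 / (1 + (of_int i)\<^sup>2))"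
    by simp (simp add: power2_eq_square algebra_simps)
  also have "\<dots> \<le> 2 * (1 / (1 + (real n + 1)\<^sup>2)) + (5 - 4 / (real n + 1))"
    using Suc by simp
  also have "2 * (1 / (1 + (real n + 1)\<^sup>2)) \<le> 4 / (real n + 1) - 4 / (real n + 2)"
  proof -
    have "4 / (real n + 1) - 4 / (real n + 2) = 4 / ((real n + 1) * (real n + 2))"
      by (simp add: field_simps)
    moreover have "2 * (1 / c) = 4 / (2 * c)" for c :: real by (cases "c = 0") (simp_all add: field_simps)
    then have "2 * (1 / (1 + (real n + 1)\<^sup>2)) = 4 / (2 * (1 + (real n + 1)\<^sup>2))" .
    moreover have "4 / (2 * (1 + (real n + 1)\<^sup>2)) \<le> 4 / ((real n + 1) * (real n + 2))"
      by (rule divide_left_mono) (auto simp: power2_eq_square algebra_simps add_pos_nonneg)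
    ultimately show ?thesis by simp
  qed
  finally show ?case by (simp add: algebra_simps)
qed simp

text \<open>For \<open>k \<noteq> 0\<close> the eigenvalue is at least \<open>\<bar>k\<bar>\<^sup>2\<close>, and \<open>(1 + k\<^sub>1\<^sup>2) (1 + k\<^sub>2\<^sup>2) \<le> 4 \<bar>k\<bar>\<^sup>4\<close>,
  so the double sum is at most four times the square of a single one.\<close>
lemma sum_inverse_eig_sq: "(\<Sum>k\<in>freqs n - {0}. (1 / eig k)\<^sup>2) \<le> 100"
proof -
  let ?f = "\<lambda>i::int. 1 / (1 + (of_int i)\<^sup>2) :: real"
  have pt: "(1 / eig k)\<^sup>2 \<le> 4 * (?f (fst k) * ?f (snd k))" if "k \<noteq> 0" for k
  proof -
    define a where "a = (of_int (fst k))\<^sup>2 + ((of_int (snd k))\<^sup>2 :: real)"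
    have eig: "eig k = lambda1 * a" by (simp add: eig_def lambda1_def a_def power_mult_distrib algebra_simps)
    have a1: "1 \<le> a" using eig_lower[OF that] lambda1_pos unfolding eig by simp
    have "a * 1 \<le> eig k" unfolding eig using lambda1_ge_1 a1 by (simp add: mult.commute)
    then have "a\<^sup>2 \<le> (eig k)\<^sup>2" using a1 by (intro power_mono) auto
    have "(1 + (of_int (fst k))\<^sup>2) * (1 + (of_int (snd k))\<^sup>2) \<le> (2 * a) * (2 * a)"
    proof (rule mult_mono)
      have "0 \<le> (of_int (fst k) :: real)\<^sup>2" "0 \<le> (of_int (snd k) :: real)\<^sup>2" by simp_all
      note nn = this a1[unfolded a_def]
      have *: "1 + x \<le> 2 * (x + y) \<and> 1 + y \<le> 2 * (x + y)" if "0 \<le> x" "0 \<le> y" "1 \<le> x + y" for x y :: real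
        using that by auto
      show "1 + (of_int (fst k))\<^sup>2 \<le> 2 * a" unfolding a_def by (rule *[OF nn, THEN conjunct1])
      show "1 + (of_int (snd k))\<^sup>2 \<le> 2 * a" unfolding a_def by (rule *[OF nn, THEN conjunct2])
    qed (use a1 in auto)
    also have "\<dots> \<le> 4 * (eig k)\<^sup>2" using \<open>a\<^sup>2 \<le> (eig k)\<^sup>2\<close> by (simp add: power2_eq_square)
    finally have le: "(1 + (of_int (fst k))\<^sup>2) * (1 + (of_int (snd k))\<^sup>2) \<le> 4 * (eig k)\<^sup>2" .
    have p: "0 < (1 + (of_int (fst k))\<^sup>2) * (1 + (of_int (snd k))\<^sup>2 :: real)"
      by (intro mult_pos_pos add_pos_nonneg) auto
    have "4 / (4 * (eig k)\<^sup>2) \<le> 4 / ((1 + (of_int (fst k))\<^sup>2) * (1 + (of_int (snd k))\<^sup>2))"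
    proof (rule divide_left_mono[OF le])
      have "0 < eig k" using eig_lower[OF that] lambda1_pos by linarith
      then have "0 < 4 * (eig k)\<^sup>2" by simp
      then show "0 < 4 * (eig k)\<^sup>2 * ((1 + (of_int (fst k))\<^sup>2) * (1 + (of_int (snd k))\<^sup>2))"
        using p by (rule mult_pos_pos)
    qed simp
    then show ?thesis by (simp add: power_divide)
  qed
  have "(\<Sum>k\<in>freqs n - {0}. (1 / eig k)\<^sup>2) \<le> (\<Sum>k\<in>freqs n - {0}. 4 * (?f (fst k) * ?f (snd k)))"
    by (intro sum_mono pt) auto
  also have "\<dots> \<le> (\<Sum>k\<in>freqs n. 4 * (?f (fst k) * ?f (snd k)))"
    by (intro sum_mono2) auto
  also have "\<dots> = 4 * (\<Sum>k\<in>freqs n. ?f (fst k) * ?f (snd k))"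
    by (simp only: sum_distrib_left)
  also have "(\<Sum>k\<in>freqs n. ?f (fst k) * ?f (snd k))
      = (\<Sum>i\<in>{- int n..int n}. ?f i) * (\<Sum>i\<in>{- int n..int n}. ?f i)"
    unfolding freqs_def sum_product sum.cartesian_product case_prod_unfold ..
  also have "\<dots> \<le> 5 * 5"
  proof -
    have "(\<Sum>i\<in>{- int n..int n}. ?f i) \<le> 5"
      by (rule order_trans[OF sum_inverse_1_plus_sq]) simp
    moreover have "0 \<le> (\<Sum>i\<in>{- int n..int n}. ?f i)" by (intro sum_nonneg) auto
    ultimately show ?thesis by (intro mult_mono) auto
  qed
  finally show ?thesis by simp
qed

text \<open>Cauchy--Schwarz for \<open>\<Sum> (\<lambda>\<^sub>k \<bar>c\<^sub>k\<bar>) (1 / \<lambda>\<^sub>k)\<close>. The constant is \<open>2 \<surd>100\<close>: basis functions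
  are bounded by 2.\<close>
lemma abs_tpoly_le:
  assumes "coef v 0 = 0" "ssum 2 v n \<le> C"
  shows "\<bar>tpoly (coef v) n p\<bar> \<le> 20 * sqrt C"
proof -
  have "\<bar>tpoly (coef v) n p\<bar> = \<bar>\<Sum>k\<in>freqs n - {0}. coef v k * cas k p\<bar>"
    unfolding tpoly_def
    by (rule arg_cong[where f=abs], rule sum.mono_neutral_right) (auto simp: assms(1))
  also have "\<dots> \<le> (\<Sum>k\<in>freqs n - {0}. 2 * (\<bar>eig k * coef v k\<bar> * \<bar>1 / eig k\<bar>))"
  proof (rule order_trans[OF sum_abs], rule sum_mono)
    fix k assume "k \<in> freqs n - {0}"
    then have "eig k \<noteq> 0" using eig_lower[of k] lambda1_pos by auto
    then have "\<bar>eig k * coef v k\<bar> * \<bar>1 / eig k\<bar> = \<bar>coef v k\<bar>" by (simp add: abs_mult)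
    moreover have "\<bar>coef v k * cas k p\<bar> \<le> \<bar>coef v k\<bar> * 2"
      unfolding abs_mult by (intro mult_left_mono abs_cas) auto
    ultimately show "\<bar>coef v k * cas k p\<bar> \<le> 2 * (\<bar>eig k * coef v k\<bar> * \<bar>1 / eig k\<bar>)" by simp
  qed
  also have "\<dots> = 2 * (\<Sum>k\<in>freqs n - {0}. \<bar>eig k * coef v k\<bar> * \<bar>1 / eig k\<bar>)"
    by (simp only: sum_distrib_left)
  also have "\<dots> \<le> 2 * (L2_set (\<lambda>k. eig k * coef v k) (freqs n - {0}) * L2_set (\<lambda>k. 1 / eig k) (freqs n - {0}))"
    by (intro mult_left_mono L2_set_mult_ineq) auto
  also have "\<dots> \<le> 2 * (sqrt C * 10)"
  proof (intro mult_left_mono mult_mono)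
    have "(\<Sum>k\<in>freqs n - {0}. (eig k * coef v k)\<^sup>2) \<le> (\<Sum>k\<in>freqs n. (eig k * coef v k)\<^sup>2)"
      by (intro sum_mono2) auto
    also have "\<dots> = ssum 2 v n" by (simp add: ssum_def power_mult_distrib)
    finally show "L2_set (\<lambda>k. eig k * coef v k) (freqs n - {0}) \<le> sqrt C"
      unfolding L2_set_def using assms(2) by (intro real_sqrt_le_mono) simp
    have "sqrt (\<Sum>k\<in>freqs n - {0}. (1 / eig k)\<^sup>2) \<le> sqrt 100"
      by (intro real_sqrt_le_mono sum_inverse_eig_sq)
    also have "sqrt 100 = (10::real)" by (rule real_sqrt_unique) auto
    finally show "L2_set (\<lambda>k. 1 / eig k) (freqs n - {0}) \<le> 10" by (simp add: L2_set_def)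
    show "0 \<le> sqrt C" using order_trans[OF ssum_nonneg assms(2)] by simp
  qed (auto simp: L2_set_def intro: sum_nonneg)
  finally show ?thesis by simp
qed

text \<open>The Sobolev embedding of second order into bounded functions, in two dimensions.\<close>
lemma sup_bound:
  assumes v: "v \<in> L2" "coef v 0 = 0" and C: "\<And>n. ssum 2 v n \<le> C"
  shows "AE p in torus. \<bar>v p\<bar> \<le> 20 * sqrt C"
  by (rule L2_limit_bounded[OF v(1) tpoly_L2 _ parseval_limit[OF v(1)]]) (intro abs_tpoly_le v C)

text \<open>The previous bound applied to the remainder shows that the partial sums converge
  uniformly.\<close>
lemma sup_bound_tail:
  assumes v: "v \<in> L2" "coef v 0 = 0" and f: "sobfin 2 v"
  shows "AE p in torus. \<bar>v p - tpoly (coef v) m p\<bar> \<le> 20 * sqrt (sob 2 v - ssum 2 v m)"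
proof (rule sup_bound)
  let ?w = "\<lambda>p. v p - tpoly (coef v) m p"
  show "?w \<in> L2" by (intro L2_diff v tpoly_L2)
  have c: "coef ?w k = (if k \<in> freqs m then 0 else coef v k)" for k
    by (simp add: coef_diff v tpoly_L2 coef_tpoly)
  show "coef ?w 0 = 0" by (simp add: c v)
  show "ssum 2 ?w n \<le> sob 2 v - ssum 2 v m" for n
  proof -
    have "ssum 2 ?w n \<le> (\<Sum>k\<in>freqs (max n m). eig k ^ 2 * (coef ?w k)\<^sup>2)"
      unfolding ssum_def by (intro sum_mono2 freqs_mono) auto
    also have "\<dots> = (\<Sum>k\<in>freqs (max n m) - freqs m. eig k ^ 2 * (coef v k)\<^sup>2)"
      by (rule sum.mono_neutral_cong_right) (auto simp: c)
    also have "\<dots> = ssum 2 v (max n m) - ssum 2 v m"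
      unfolding ssum_def by (rule sum_diff) (simp_all add: freqs_mono)
    also have "\<dots> \<le> sob 2 v - ssum 2 v m" using ssum_le_sob[OF f] by simp
    finally show ?thesis .
  qed
qed

subsection \<open>Cancellation for trigonometric polynomials\<close>

lemma tpoly_deriv_x: "((\<lambda>s. tpoly \<alpha> n (s, z)) has_real_derivative tpoly (dxc \<alpha>) n (x, z)) (at x)"
proof -
  have "((\<lambda>s. tpoly \<alpha> n (s, z)) has_real_derivative
      (\<Sum>k\<in>freqs n. \<alpha> k * (2 * pi * of_int (fst k) * cas (- k) (x, z)))) (at x)"
    unfolding tpoly_def by (intro DERIV_sum DERIV_cmult cas_deriv_x)
  also have "(\<Sum>k\<in>freqs n. \<alpha> k * (2 * pi * of_int (fst k) * cas (- k) (x, z)))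
      = (\<Sum>k\<in>freqs n. \<alpha> (- k) * (2 * pi * of_int (fst (- k)) * cas (- (- k)) (x, z)))"
    by (rule sum_freqs_uminus[symmetric])
  also have "\<dots> = tpoly (dxc \<alpha>) n (x, z)"
    unfolding tpoly_def by (rule sum.cong) (auto simp: dxc_def)
  finally show ?thesis .
qed

lemma tpoly_deriv_z: "((\<lambda>s. tpoly \<alpha> n (x, s)) has_real_derivative tpoly (dzc \<alpha>) n (x, z)) (at z)"
proof -
  have "((\<lambda>s. tpoly \<alpha> n (x, s)) has_real_derivative
      (\<Sum>k\<in>freqs n. \<alpha> k * (2 * pi * of_int (snd k) * cas (- k) (x, z)))) (at z)"
    unfolding tpoly_def by (intro DERIV_sum DERIV_cmult cas_deriv_z)
  also have "(\<Sum>k\<in>freqs n. \<alpha> k * (2 * pi * of_int (snd k) * cas (- k) (x, z)))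
      = (\<Sum>k\<in>freqs n. \<alpha> (- k) * (2 * pi * of_int (snd (- k)) * cas (- (- k)) (x, z)))"
    by (rule sum_freqs_uminus[symmetric])
  also have "\<dots> = tpoly (dzc \<alpha>) n (x, z)"
    unfolding tpoly_def by (rule sum.cong) (auto simp: dzc_def)
  finally show ?thesis .
qed

lemma dzc_dxc: "dzc (dxc \<alpha>) = dxc (dzc \<alpha>)"
  by (rule ext) (simp add: dxc_def dzc_def)

text \<open>With periodicity this follows from \<open>J(a,b) a = (a\<^sup>2 b\<^sub>z / 2)\<^sub>x - (a\<^sup>2 b\<^sub>x / 2)\<^sub>z\<close>.\<close>
lemma tpoly_jacobian_self:
  "(\<integral>p. (tpoly (dxc \<alpha>) n p * tpoly (dzc \<beta>) m p - tpoly (dzc \<alpha>) n p * tpoly (dxc \<beta>) m p) * tpoly \<alpha> n p \<partial>torus) = 0"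
proof -
  let ?a = "tpoly \<alpha> n" and ?ax = "tpoly (dxc \<alpha>) n" and ?az = "tpoly (dzc \<alpha>) n"
  let ?bx = "tpoly (dxc \<beta>) m" and ?bz = "tpoly (dzc \<beta>) m" and ?bxz = "tpoly (dxc (dzc \<beta>)) m"
  let ?f = "\<lambda>p. ?a p * ?ax p * ?bz p + ?a p * ?a p * ?bxz p / 2"
  let ?g = "\<lambda>p. ?a p * ?az p * ?bx p + ?a p * ?a p * ?bxz p / 2"
  note per = periodic_unit[OF tpoly_periodic]
  have cf: "continuous_on UNIV ?f" and cg: "continuous_on UNIV ?g" by (intro continuous_intros; simp)+
  have "(\<integral>p. ?f p \<partial>torus) = 0"
  proof (rule integral_partial_x_zero[where f="\<lambda>p. ?a p * ?a p * ?bz p / 2", OF _ cf])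
    show "((\<lambda>s. ?a (s, z) * ?a (s, z) * ?bz (s, z) / 2) has_real_derivative ?f (x, z)) (at x)" for x z
      by (rule derivative_eq_intros tpoly_deriv_x refl | simp)+
  qed (simp add: per)
  moreover have "(\<integral>p. ?g p \<partial>torus) = 0"
  proof (rule integral_partial_z_zero[where f="\<lambda>p. ?a p * ?a p * ?bx p / 2", OF _ cg])
    show "((\<lambda>s. ?a (x, s) * ?a (x, s) * ?bx (x, s) / 2) has_real_derivative ?g (x, z)) (at z)" for x z
      by (rule derivative_eq_intros tpoly_deriv_z refl | simp)+ (simp add: algebra_simps dzc_dxc)
  qed (simp add: per)
  ultimately have *: "(\<integral>p. ?f p - ?g p \<partial>torus) = 0"
    by (subst Bochner_Integration.integral_diff[OF continuous_integrable_torus[OF cf] continuous_integrable_torus[OF cg]])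
      (simp only: diff_self)
  have "?f p - ?g p = (?ax p * ?bz p - ?az p * ?bx p) * ?a p" for p
    by (simp add: algebra_simps)
  with * show ?thesis by (simp only:)
qed

text \<open>The Jacobian is antisymmetric.\<close>
lemma tpoly_jacobian_other:
  "(\<integral>p. (tpoly (dxc \<alpha>) n p * tpoly (dzc \<beta>) m p - tpoly (dzc \<alpha>) n p * tpoly (dxc \<beta>) m p) * tpoly \<beta> m p \<partial>torus) = 0"
  using tpoly_jacobian_self[of \<beta> m \<alpha> n]
    Bochner_Integration.integral_minus[of torus "\<lambda>p. (tpoly (dxc \<beta>) m p * tpoly (dzc \<alpha>) n p - tpoly (dzc \<beta>) m p * tpoly (dxc \<alpha>) n p) * tpoly \<beta> m p"]
  by (simp add: algebra_simps)

subsection \<open>Passing to the limit\<close>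

definition L2_lim :: "(nat \<Rightarrow> field) \<Rightarrow> field \<Rightarrow> bool" where
  "L2_lim f F \<longleftrightarrow> F \<in> L2 \<and> (\<forall>n. f n \<in> L2) \<and> (\<lambda>n. L2_norm (\<lambda>p. F p - f n p)) \<longlonglongrightarrow> 0"

lemma L2_lim_tpoly: "u \<in> L2 \<Longrightarrow> L2_lim (tpoly (coef u)) u"
  by (simp add: L2_lim_def tpoly_L2 parseval_limit)

lemma L2_lim_const: "u \<in> L2 \<Longrightarrow> L2_lim (\<lambda>n. u) u"
  by (simp add: L2_lim_def L2_norm_eq_sqrt L2_inner_torus)

lemma L2_lim_inner:
  assumes "L2_lim f F" "L2_lim g G"
  shows "(\<lambda>n. L2_inner (f n) (g n)) \<longlonglongrightarrow> L2_inner F G"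
proof -
  have L: "F \<in> L2" "G \<in> L2" "\<And>n. f n \<in> L2" "\<And>n. g n \<in> L2" using assms by (auto simp: L2_lim_def)
  let ?d = "\<lambda>n. L2_norm (\<lambda>p. F p - f n p)" and ?e = "\<lambda>n. L2_norm (\<lambda>p. G p - g n p)"
  have d: "?d \<longlonglongrightarrow> 0" and e: "?e \<longlonglongrightarrow> 0" using assms by (auto simp: L2_lim_def)
  have "(\<lambda>n. L2_inner F G - L2_inner (f n) (g n)) \<longlonglongrightarrow> 0"
  proof (rule Lim_null_comparison)
    show "\<forall>\<^sub>F n in sequentially. norm (L2_inner F G - L2_inner (f n) (g n))
        \<le> ?d n * L2_norm G + (L2_norm F + ?d n) * ?e n"
    proof (intro always_eventually allI)
      fix n
      have fn: "L2_norm (f n) \<le> L2_norm F + ?d n"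
        using L2_norm_triangle_diff[OF L(1) L2_diff[OF L(1) L(3)[of n]]] by simp
      have "L2_inner F G - L2_inner (f n) (g n)
          = L2_inner (\<lambda>p. F p - f n p) G + L2_inner (f n) (\<lambda>p. G p - g n p)"
        by (simp add: L2_inner_diff L2_inner_diff_right L)
      also have "norm \<dots> \<le> ?d n * L2_norm G + L2_norm (f n) * ?e n"
        unfolding real_norm_def
        by (intro order_trans[OF abs_triangle_ineq] add_mono L2_Cauchy_Schwarz L2_diff L)
      also have "\<dots> \<le> ?d n * L2_norm G + (L2_norm F + ?d n) * ?e n"
        by (intro add_left_mono mult_right_mono fn) simp
      finally show "norm (L2_inner F G - L2_inner (f n) (g n)) \<le> ?d n * L2_norm G + (L2_norm F + ?d n) * ?e n" .
    qed
    have "(\<lambda>n. ?d n * L2_norm G + (L2_norm F + ?d n) * ?e n) \<longlonglongrightarrow> 0 * L2_norm G + (L2_norm F + 0) * 0"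
      by (intro tendsto_intros d e)
    then show "(\<lambda>n. ?d n * L2_norm G + (L2_norm F + ?d n) * ?e n) \<longlonglongrightarrow> 0" by simp
  qed
  from tendsto_diff[OF tendsto_const[of "L2_inner F G"] this] show ?thesis by simp
qed

lemma L2_lim_diff:
  assumes "L2_lim f F" "L2_lim g G"
  shows "L2_lim (\<lambda>n p. f n p - g n p) (\<lambda>p. F p - G p)"
proof -
  have L: "F \<in> L2" "G \<in> L2" "\<And>n. f n \<in> L2" "\<And>n. g n \<in> L2" using assms by (auto simp: L2_lim_def)
  have "(\<lambda>n. L2_norm (\<lambda>p. (F p - G p) - (f n p - g n p))) \<longlonglongrightarrow> 0"
  proof (rule tendsto_sandwich[OF _ _ tendsto_const])
    show "\<forall>\<^sub>F n in sequentially. L2_norm (\<lambda>p. (F p - G p) - (f n p - g n p))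
        \<le> L2_norm (\<lambda>p. F p - f n p) + L2_norm (\<lambda>p. G p - g n p)"
    proof (intro always_eventually allI)
      fix n
      have "(\<lambda>p. (F p - G p) - (f n p - g n p)) = (\<lambda>p. (F p - f n p) - (G p - g n p))" by auto
      then show "L2_norm (\<lambda>p. (F p - G p) - (f n p - g n p))
        \<le> L2_norm (\<lambda>p. F p - f n p) + L2_norm (\<lambda>p. G p - g n p)"
        using L2_norm_triangle_diff[OF L2_diff[OF L(1) L(3)] L2_diff[OF L(2) L(4)]] by simp
    qed
    show "(\<lambda>n. L2_norm (\<lambda>p. F p - f n p) + L2_norm (\<lambda>p. G p - g n p)) \<longlonglongrightarrow> 0"
      using assms tendsto_add[of "\<lambda>n. L2_norm (\<lambda>p. F p - f n p)" 0 sequentially "\<lambda>n. L2_norm (\<lambda>p. G p - g n p)" 0]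
      by (simp add: L2_lim_def)
  qed auto
  then show ?thesis using L by (simp add: L2_lim_def L2_diff)
qed

lemma L2_lim_mult_bounded:
  assumes "L2_lim f F" "b \<in> borel_measurable borel" "AE p in torus. \<bar>b p\<bar> \<le> B" "0 \<le> B"
  shows "L2_lim (\<lambda>n p. f n p * b p) (\<lambda>p. F p * b p)"
proof -
  have L: "F \<in> L2" "\<And>n. f n \<in> L2" using assms by (auto simp: L2_lim_def)
  have "(\<lambda>n. L2_norm (\<lambda>p. F p * b p - f n p * b p)) \<longlonglongrightarrow> 0"
  proof (rule tendsto_sandwich[OF _ _ tendsto_const])
    show "\<forall>\<^sub>F n in sequentially. L2_norm (\<lambda>p. F p * b p - f n p * b p) \<le> B * L2_norm (\<lambda>p. F p - f n p)"
      using L2_bounded_mult(2)[OF L2_diff[OF L(1) L(2)] assms(2-4)]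
      by (intro always_eventually allI) (simp add: left_diff_distrib)
    show "(\<lambda>n. B * L2_norm (\<lambda>p. F p - f n p)) \<longlonglongrightarrow> 0"
      using assms(1) by (intro tendsto_mult_right_zero) (simp add: L2_lim_def)
  qed auto
  then show ?thesis
    using L2_bounded_mult(1)[OF _ assms(2-4)] L by (simp add: L2_lim_def)
qed

text \<open>In \<open>J(a,b)\<close> the derivatives of \<open>a\<close> converge in mean square only and those of \<open>b\<close> even
  uniformly. The limit is therefore taken in \<open>a\<close> first, by the previous lemma with \<open>b\<close>
  truncated, and then in \<open>b\<close>, by this one.\<close>
lemma L2_lim_mult_uniform:
  assumes u: "u \<in> L2" and b: "\<And>n. b n \<in> borel_measurable borel" "b' \<in> borel_measurable borel"
    and e: "\<And>n. AE p in torus. \<bar>b' p - b n p\<bar> \<le> \<epsilon> n" "\<epsilon> \<longlonglongrightarrow> 0" "\<And>n. 0 \<le> \<epsilon> n"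
    and B: "AE p in torus. \<bar>b' p\<bar> \<le> B" "0 \<le> B"
  shows "L2_lim (\<lambda>n p. u p * b n p) (\<lambda>p. u p * b' p)"
proof -
  have F: "(\<lambda>p. u p * b' p) \<in> L2" by (rule L2_bounded_mult(1)[OF u b(2) B])
  have d: "(\<lambda>p. u p * (b' p - b n p)) \<in> L2" "L2_norm (\<lambda>p. u p * (b' p - b n p)) \<le> \<epsilon> n * L2_norm u" for n
    using L2_bounded_mult[OF u _ e(1,3), of n] b by auto
  have f: "(\<lambda>p. u p * b n p) \<in> L2" for n
    using L2_diff[OF F d(1)[of n]] by (simp add: right_diff_distrib)
  have "(\<lambda>n. L2_norm (\<lambda>p. u p * b' p - u p * b n p)) \<longlonglongrightarrow> 0"
  proof (rule tendsto_sandwich[OF _ _ tendsto_const])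
    show "\<forall>\<^sub>F n in sequentially. L2_norm (\<lambda>p. u p * b' p - u p * b n p) \<le> \<epsilon> n * L2_norm u"
      using d(2) by (intro always_eventually allI) (simp add: right_diff_distrib)
    show "(\<lambda>n. \<epsilon> n * L2_norm u) \<longlonglongrightarrow> 0"
      by (intro tendsto_mult_left_zero e)
  qed auto
  then show ?thesis using F f by (simp add: L2_lim_def)
qed

lemma bounded_tpoly: "\<exists>B\<ge>0. AE p in torus. \<bar>tpoly \<alpha> n p\<bar> \<le> B"
proof -
  have "\<bar>tpoly \<alpha> n p\<bar> \<le> (\<Sum>k\<in>freqs n. \<bar>\<alpha> k\<bar> * 2)" for p
    unfolding tpoly_def
    by (rule order_trans[OF sum_abs], rule sum_mono) (auto simp: abs_mult intro: mult_left_mono abs_cas)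
  then show ?thesis by (intro exI[of _ "\<Sum>k\<in>freqs n. \<bar>\<alpha> k\<bar> * 2"]) (auto intro: sum_nonneg)
qed

lemma gradient_sup_bound:
  assumes b: "b \<in> L2_per0" "sobfin 3 b"
  shows "Dx b \<in> L2_per0" "Dz b \<in> L2_per0" "sobfin 2 (Dx b)" "sobfin 2 (Dz b)"
    "AE p in torus. \<bar>Dx b p\<bar> \<le> 20 * sqrt (sob 3 b)" "AE p in torus. \<bar>Dz b p\<bar> \<le> 20 * sqrt (sob 3 b)"
    "coef (Dx b) = dxc (coef b)" "coef (Dz b) = dzc (coef b)"
proof -
  have s1: "sobfin 1 b" using sobfin_mono[OF coef_zero_mean[OF b(1)] b(2), of 1] by simp
  note x = Dx_props[OF b(1) s1] and z = Dz_props[OF b(1) s1]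
  have s3: "sobfin (Suc 2) b" using b(2) by (simp add: numeral_3_eq_3 numeral_2_eq_2)
  note g = sob_gradient[OF x(2) z(2) s3]
  show "Dx b \<in> L2_per0" "Dz b \<in> L2_per0" "sobfin 2 (Dx b)" "sobfin 2 (Dz b)"
    "coef (Dx b) = dxc (coef b)" "coef (Dz b) = dzc (coef b)"
    using x z g by auto
  have eq: "sob (Suc 2) b = sob 3 b" by (simp add: numeral_3_eq_3 numeral_2_eq_2)
  have "sob 2 (Dx b) \<le> sob 3 b" "sob 2 (Dz b) \<le> sob 3 b"
    using g(3) sob_nonneg[OF g(1)] sob_nonneg[OF g(2)] unfolding eq by auto
  then show "AE p in torus. \<bar>Dx b p\<bar> \<le> 20 * sqrt (sob 3 b)" "AE p in torus. \<bar>Dz b p\<bar> \<le> 20 * sqrt (sob 3 b)"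
    using ssum_le_sob[OF g(1)] ssum_le_sob[OF g(2)] x z
    by (auto intro!: sup_bound coef_zero_mean intro: L2_per0_L2 order_trans)
qed

lemma sup_bound_tail_limit:
  assumes "sobfin 2 v" shows "(\<lambda>m. 20 * sqrt (sob 2 v - ssum 2 v m)) \<longlonglongrightarrow> 0"
proof -
  have "(\<lambda>m. 20 * sqrt (sob 2 v - ssum 2 v m)) \<longlonglongrightarrow> 20 * sqrt (sob 2 v - sob 2 v)"
    by (intro tendsto_intros ssum_tendsto assms)
  then show ?thesis by simp
qed

text \<open>The constant is \<open>20 + 20\<close>, from the sup bounds of the two derivatives of \<open>b\<close>. The
  cancellations pass from trigonometric polynomials to the limit, first in \<open>a\<close> and then in \<open>b\<close>.\<close>
theorem jacobian:
  assumes a: "a \<in> L2_per0" "sobfin 1 a" and b: "b \<in> L2_per0" "sobfin 3 b"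
  shows "Jac a b \<in> L2" "L2_norm (Jac a b) \<le> 40 * sqrt (sob 3 b) * sqrt (sob 1 a)"
    "L2_inner (Jac a b) a = 0" "L2_inner (Jac a b) b = 0"
proof -
  note ax = Dx_props[OF a] and az = Dz_props[OF a]
  note axL = L2_per0_L2[OF ax(1)] and azL = L2_per0_L2[OF az(1)]
  note bp = gradient_sup_bound[OF b]
  note bxL = L2_per0_L2[OF bp(1)] and bzL = L2_per0_L2[OF bp(2)]
  have aL: "a \<in> L2" and bL: "b \<in> L2" using a b L2_per0_L2 by auto
  let ?B = "20 * sqrt (sob 3 b)"
  have B: "0 \<le> ?B" using sob_nonneg[OF b(2)] by simp
  have J: "Jac a b = (\<lambda>p. Dx a p * Dz b p - Dz a p * Dx b p)" by (simp add: Jac_def)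
  note m1 = L2_bounded_mult[OF axL L2_measurable[OF bzL] bp(6) B]
  note m2 = L2_bounded_mult[OF azL L2_measurable[OF bxL] bp(5) B]
  show "Jac a b \<in> L2" unfolding J by (intro L2_diff m1 m2)
  have n: "L2_norm (Dx a) \<le> sqrt (sob 1 a)" "L2_norm (Dz a) \<le> sqrt (sob 1 a)"
    using grad_norm_sq[OF a] zero_le_power2[of "L2_norm (Dx a)"] zero_le_power2[of "L2_norm (Dz a)"]
    unfolding grad_norm_eq by (intro real_le_rsqrt; linarith)+
  have "L2_norm (Jac a b) \<le> ?B * L2_norm (Dx a) + ?B * L2_norm (Dz a)"
    unfolding J using L2_norm_triangle_diff[OF m1(1) m2(1)] m1(2) m2(2) by linarith
  also have "\<dots> \<le> ?B * sqrt (sob 1 a) + ?B * sqrt (sob 1 a)"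
    by (intro add_mono mult_left_mono n B)
  finally show "L2_norm (Jac a b) \<le> 40 * sqrt (sob 3 b) * sqrt (sob 1 a)" by (simp add: mult_ac)
  let ?bx = "\<lambda>m. tpoly (coef (Dx b)) m" and ?bz = "\<lambda>m. tpoly (coef (Dz b)) m"
  let ?Jm = "\<lambda>m p. Dx a p * ?bz m p - Dz a p * ?bx m p"
  let ?Jnm = "\<lambda>n m p. tpoly (coef (Dx a)) n p * ?bz m p - tpoly (coef (Dz a)) n p * ?bx m p"
  have lim1: "L2_lim (\<lambda>n. ?Jnm n m) (?Jm m)" for m
  proof -
    obtain B1 B2 where "0 \<le> B1" "AE p in torus. \<bar>?bz m p\<bar> \<le> B1" "0 \<le> B2" "AE p in torus. \<bar>?bx m p\<bar> \<le> B2"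
      using bounded_tpoly by meson
    then show ?thesis
      by (intro L2_lim_diff L2_lim_mult_bounded L2_lim_tpoly axL azL tpoly_measurable)
  qed
  have lim2: "L2_lim ?Jm (Jac a b)"
    unfolding J
    by (intro L2_lim_diff L2_lim_mult_uniform[OF _ _ _ sup_bound_tail sup_bound_tail_limit _ bp(5) B]
        L2_lim_mult_uniform[OF _ _ _ sup_bound_tail sup_bound_tail_limit _ bp(6) B]
        axL azL bxL bzL tpoly_measurable L2_measurable coef_zero_mean bp(1-4))
      (use ssum_le_sob[OF bp(3)] ssum_le_sob[OF bp(4)] in auto)
  have "L2_inner (?Jnm n m) (tpoly (coef a) n) = 0" for n m
    using tpoly_jacobian_self[of "coef a" n "coef b" m]
    by (simp add: L2_inner_torus ax(2) az(2) bp(7,8))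
  then have "L2_inner (?Jm m) a = 0" for m
    using L2_lim_inner[OF lim1[of m] L2_lim_tpoly[OF aL]] by (simp add: LIMSEQ_const_iff)
  then show "L2_inner (Jac a b) a = 0"
    using L2_lim_inner[OF lim2 L2_lim_const[OF aL]] by (simp add: LIMSEQ_const_iff)
  have "L2_inner (?Jnm n m) (tpoly (coef b) m) = 0" for n m
    using tpoly_jacobian_other[of "coef a" n "coef b" m]
    by (simp add: L2_inner_torus ax(2) az(2) bp(7,8))
  then have "L2_inner (?Jm m) (tpoly (coef b) m) = 0" for m
    using L2_lim_inner[OF lim1[of m] L2_lim_const[OF tpoly_L2[of "coef b" m]]] by (simp add: LIMSEQ_const_iff)
  then show "L2_inner (Jac a b) b = 0"
    using L2_lim_inner[OF lim2 L2_lim_tpoly[OF bL]] by (simp add: LIMSEQ_const_iff)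
qed

section \<open>Absolutely continuous functions of time\<close>

text \<open>\<open>F\<close> is absolutely continuous on \<open>[0, \<infinity>)\<close> with derivative \<open>f\<close>, in integrated form.\<close>
definition prim :: "(real \<Rightarrow> real) \<Rightarrow> (real \<Rightarrow> real) \<Rightarrow> bool" where
  "prim F f \<longleftrightarrow> (\<forall>t\<ge>0. set_integrable lborel {0..t} f \<and> F t = F 0 + (LINT s:{0..t}|lborel. f s))"

lemma primD: "prim F f \<Longrightarrow> 0 \<le> t \<Longrightarrow> set_integrable lborel {0..t} f"
  "prim F f \<Longrightarrow> 0 \<le> t \<Longrightarrow> F t = F 0 + (LINT s:{0..t}|lborel. f s)"
  unfolding prim_def by blast+

lemma prim_integrable: "prim F f \<Longrightarrow> 0 \<le> t \<Longrightarrow> integrable lborel (\<lambda>s. indicator {0..t} s * f s)"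
  using primD(1)[of F f t] unfolding set_integrable_def real_scaleR_def .

lemma prim_value: "prim F f \<Longrightarrow> 0 \<le> t \<Longrightarrow> F t = F 0 + (\<integral>s. indicator {0..t} s * f s \<partial>lborel)"
  using primD(2)[of F f t] unfolding set_lebesgue_integral_def real_scaleR_def .

lemma primI:
  assumes "\<And>t. 0 \<le> t \<Longrightarrow> integrable lborel (\<lambda>s. indicator {0..t} s * f s)"
    "\<And>t. 0 \<le> t \<Longrightarrow> F t = F 0 + (\<integral>s. indicator {0..t} s * f s \<partial>lborel)"
  shows "prim F f"
  unfolding prim_def set_integrable_def set_lebesgue_integral_def real_scaleR_def
  using assms by blast

lemma prim_const: "prim (\<lambda>t. c) (\<lambda>t. 0)"
  by (rule primI) auto

lemma prim_add:
  assumes "prim F f" "prim G g" shows "prim (\<lambda>t. F t + G t) (\<lambda>t. f t + g t)"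
proof (rule primI)
  fix t :: real assume t: "0 \<le> t"
  note i = prim_integrable[OF assms(1) t] prim_integrable[OF assms(2) t]
  show "integrable lborel (\<lambda>s. indicator {0..t} s * (f s + g s))"
    using i by (simp add: distrib_left)
  show "F t + G t = F 0 + G 0 + (\<integral>s. indicator {0..t} s * (f s + g s) \<partial>lborel)"
    using prim_value[OF assms(1) t] prim_value[OF assms(2) t] i by (simp add: distrib_left)
qed

lemma prim_cmult:
  assumes "prim F f" shows "prim (\<lambda>t. c * F t) (\<lambda>t. c * f t)"
proof (rule primI)
  fix t :: real assume t: "0 \<le> t"
  have eq: "(\<lambda>s. indicator {0..t} s * (c * f s)) = (\<lambda>s. c * (indicator {0..t} s * f s))"
    by (simp add: mult_ac)
  show "integrable lborel (\<lambda>s. indicator {0..t} s * (c * f s))"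
    unfolding eq using prim_integrable[OF assms t] by simp
  show "c * F t = c * F 0 + (\<integral>s. indicator {0..t} s * (c * f s) \<partial>lborel)"
    unfolding eq by (simp add: prim_value[OF assms t] distrib_left)
qed

lemma prim_sum:
  assumes "\<And>i. i \<in> I \<Longrightarrow> prim (F i) (f i)"
  shows "prim (\<lambda>t. \<Sum>i\<in>I. F i t) (\<lambda>t. \<Sum>i\<in>I. f i t)"
  using assms by (induction I rule: infinite_finite_induct) (auto intro: prim_const prim_add)

lemma prim_mono:
  assumes F: "prim F f" and st: "0 \<le> s" "s \<le> t" and pos: "AE r in lborel. s < r \<and> r < t \<longrightarrow> 0 \<le> f r"
  shows "F s \<le> F t"
proof -
  have t: "0 \<le> t" using st by simp
  have "(\<integral>r. indicator {0..s} r * f r \<partial>lborel) \<le> (\<integral>r. indicator {0..t} r * f r \<partial>lborel)"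
  proof (rule integral_mono_AE)
    show "AE r in lborel. indicator {0..s} r * f r \<le> indicator {0..t} r * f r"
      using pos AE_lborel_singleton[of t] AE_lborel_singleton[of s]
      by eventually_elim (use st in \<open>auto simp: indicator_def\<close>)
  qed (intro prim_integrable[OF F] st t)+
  then show ?thesis using prim_value[OF F st(1)] prim_value[OF F t] by simp
qed

lemma prim_continuous:
  assumes "prim F f" "0 \<le> t" shows "continuous_on {0..t} F"
proof -
  have i: "f integrable_on {0..t}"
    using set_borel_integral_eq_integral(1)[OF primD(1)[OF assms]] .
  have eq: "F s = F 0 + integral {0..s} f" if "s \<in> {0..t}" for s
    using primD[OF assms(1), of s] that set_borel_integral_eq_integral(2)[of "{0..s}" f] by simp
  have cont: "continuous_on {0..t} (\<lambda>s. F 0 + integral {0..s} f)"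
    by (intro continuous_intros indefinite_integral_continuous_1 i)
  show ?thesis by (rule continuous_on_eq[OF cont]) (rule eq[symmetric])
qed

lemma integrable_product_lborel:
  fixes f g :: "real \<Rightarrow> real"
  assumes "integrable lborel f" "integrable lborel g"
  shows "integrable (lborel \<Otimes>\<^sub>M lborel) (\<lambda>p. f (fst p) * g (snd p))"
proof (rule lborel_pair.Fubini_integrable)
  show "(\<lambda>p. f (fst p) * g (snd p)) \<in> borel_measurable (lborel \<Otimes>\<^sub>M lborel)"
    using borel_measurable_integrable[OF assms(1)] borel_measurable_integrable[OF assms(2)]
    by measurable
qed (use assms in \<open>simp_all add: abs_mult\<close>)

text \<open>The product of the two integrals is an integral over a square, which the diagonal splits
  into two triangles; Fubini turns each triangle into one term of the rule.\<close>
lemma prim_mult: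
  assumes F: "prim F f" and G: "prim G g"
  shows "prim (\<lambda>t. F t * G t) (\<lambda>t. f t * G t + F t * g t)"
proof -
  have "integrable lborel (\<lambda>s. indicator {0..t} s * (f s * G s + F s * g s)) \<and>
      F t * G t = F 0 * G 0 + (\<integral>s. indicator {0..t} s * (f s * G s + F s * g s) \<partial>lborel)"
    if t: "0 \<le> t" for t
  proof -
    define a where "a s = indicator {0..t} s * f s" for s
    define b where "b s = indicator {0..t} s * g s" for s
    have ia: "integrable lborel a" and ib: "integrable lborel b"
      using prim_integrable[OF F t] prim_integrable[OF G t] by (simp_all add: a_def[abs_def] b_def[abs_def])
    \<comment> \<open>The two triangles. The diagonal goes to the first; it is a null set.\<close>
    define H where "H s r = (if r \<le> s then a s * b r else 0)" for s r
    define H' where "H' s r = (if s < r then a s * b r else 0)" for s r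
    note [measurable] = borel_measurable_integrable[OF ia] borel_measurable_integrable[OF ib]
    have K: "integrable (lborel \<Otimes>\<^sub>M lborel) (\<lambda>p. a (fst p) * b (snd p))"
      by (rule integrable_product_lborel[OF ia ib])
    have iH: "integrable (lborel \<Otimes>\<^sub>M lborel) (\<lambda>(s, r). H s r)"
      by (rule Bochner_Integration.integrable_bound[OF K]) (auto simp: H_def case_prod_unfold)
    have iH': "integrable (lborel \<Otimes>\<^sub>M lborel) (\<lambda>(s, r). H' s r)"
      by (rule Bochner_Integration.integrable_bound[OF K]) (auto simp: H'_def case_prod_unfold)
    have Gs: "G s = G 0 + (\<integral>r. (if r \<le> s then b r else 0) \<partial>lborel)" if "s \<in> {0..t}" for s
    proof -
      have "(\<lambda>r. indicator {0..s} r * g r) = (\<lambda>r. if r \<le> s then b r else 0)"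
        using that by (auto simp: b_def indicator_def)
      then show ?thesis using prim_value[OF G, of s] that by simp
    qed
    have Fs: "F r = F 0 + (\<integral>s. (if s < r then a s else 0) \<partial>lborel)" if "r \<in> {0..t}" for r
    proof -
      have "(\<integral>s. indicator {0..r} s * f s \<partial>lborel) = (\<integral>s. (if s < r then a s else 0) \<partial>lborel)"
      proof (rule integral_cong_AE)
        show "AE s in lborel. indicator {0..r} s * f s = (if s < r then a s else 0)"
          using AE_lborel_singleton[of r] by eventually_elim (use that in \<open>auto simp: a_def indicator_def\<close>)
        show "(\<lambda>s. indicator {0..r} s * f s) \<in> borel_measurable lborel"
          using prim_integrable[OF F, of r] that by auto
      qed measurable
      then show ?thesis using prim_value[OF F, of r] that by simp
    qed
    have e1: "indicator {0..t} s * (f s * G s) = G 0 * a s + (\<integral>r. H s r \<partial>lborel)" for s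
    proof (cases "s \<in> {0..t}")
      case True
      have "(\<integral>r. H s r \<partial>lborel) = (\<integral>r. a s * (if r \<le> s then b r else 0) \<partial>lborel)"
        by (intro Bochner_Integration.integral_cong) (auto simp: H_def)
      then show ?thesis using Gs[OF True] True by (simp add: a_def algebra_simps)
    next
      case False
      then have "a s = 0" by (simp add: a_def)
      then have "H s r = 0" for r by (simp add: H_def)
      then show ?thesis using False \<open>a s = 0\<close> by simp
    qed
    have e2: "indicator {0..t} r * (F r * g r) = F 0 * b r + (\<integral>s. H' s r \<partial>lborel)" for r
    proof (cases "r \<in> {0..t}")
      case True
      have "(\<integral>s. H' s r \<partial>lborel) = (\<integral>s. b r * (if s < r then a s else 0) \<partial>lborel)"
        by (intro Bochner_Integration.integral_cong) (auto simp: H'_def)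
      then show ?thesis using Fs[OF True] True by (simp add: b_def algebra_simps)
    next
      case False
      then have "b r = 0" by (simp add: b_def)
      then have "H' s r = 0" for s by (simp add: H'_def)
      then show ?thesis using False \<open>b r = 0\<close> by simp
    qed
    have i1: "integrable lborel (\<lambda>s. \<integral>r. H s r \<partial>lborel)" and i2: "integrable lborel (\<lambda>r. \<integral>s. H' s r \<partial>lborel)"
      using lborel_pair.integrable_fst[OF iH] lborel_pair.integrable_snd[OF iH'] by auto
    have "(\<integral>s. (\<integral>r. H s r \<partial>lborel) \<partial>lborel) + (\<integral>r. (\<integral>s. H' s r \<partial>lborel) \<partial>lborel)
        = (\<integral>p. H (fst p) (snd p) + H' (fst p) (snd p) \<partial>(lborel \<Otimes>\<^sub>M lborel))"
      using lborel_pair.integral_fst[OF iH] lborel_pair.integral_snd[OF iH'] iH iH'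
      by (simp add: case_prod_unfold)
    also have "\<dots> = (\<integral>p. a (fst p) * b (snd p) \<partial>(lborel \<Otimes>\<^sub>M lborel))"
      by (intro Bochner_Integration.integral_cong) (auto simp: H_def H'_def)
    also have "\<dots> = (\<integral>s. (\<integral>r. a s * b r \<partial>lborel) \<partial>lborel)"
      using lborel_pair.integral_fst[of "\<lambda>s r. a s * b r"] K by (simp add: case_prod_unfold)
    also have "\<dots> = (\<integral>s. a s \<partial>lborel) * (\<integral>r. b r \<partial>lborel)" by simp
    finally have sum: "(\<integral>s. (\<integral>r. H s r \<partial>lborel) \<partial>lborel) + (\<integral>r. (\<integral>s. H' s r \<partial>lborel) \<partial>lborel)
        = (\<integral>s. a s \<partial>lborel) * (\<integral>r. b r \<partial>lborel)" .
    have e: "(\<lambda>s. indicator {0..t} s * (f s * G s + F s * g s)) =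
        (\<lambda>s. (G 0 * a s + (\<integral>r. H s r \<partial>lborel)) + (F 0 * b s + (\<integral>r. H' r s \<partial>lborel)))"
      unfolding e1[symmetric] e2[symmetric] by (simp add: distrib_left)
    have "F t * G t = (F 0 + (\<integral>s. a s \<partial>lborel)) * (G 0 + (\<integral>s. b s \<partial>lborel))"
      using prim_value[OF F t] prim_value[OF G t] by (simp add: a_def b_def)
    then show ?thesis
      unfolding e using i1 i2 ia ib sum by (simp add: algebra_simps)
  qed
  then show ?thesis by (intro primI) blast+
qed

lemma prim_exp: "prim (\<lambda>t. exp (a * t)) (\<lambda>t. a * exp (a * t))"
proof -
  have "integrable lborel (\<lambda>s. indicator {0..t} s *\<^sub>R (a * exp (a * s))) \<and>
      exp (a * t) = exp (a * 0) + (\<integral>s. indicator {0..t} s *\<^sub>R (a * exp (a * s)) \<partial>lborel)" if "0 \<le> t" for t :: real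
  proof
    have c: "continuous_on {0..t} (\<lambda>s. a * exp (a * s))" by (intro continuous_intros)
    show "integrable lborel (\<lambda>s. indicator {0..t} s *\<^sub>R (a * exp (a * s)))"
      by (rule borel_integrable_compact[OF compact_Icc c])
    have "(\<integral>s. indicator {0..t} s *\<^sub>R (a * exp (a * s)) \<partial>lborel) = exp (a * t) - exp (a * 0)"
    proof (rule integral_FTC_atLeastAtMost[OF that _ c])
      show "((\<lambda>s. exp (a * s)) has_vector_derivative a * exp (a * x)) (at x within {0..t})" for x
        unfolding has_real_derivative_iff_has_vector_derivative[symmetric]
        by (auto intro!: derivative_eq_intros)
    qed
    then show "exp (a * t) = exp (a * 0) + (\<integral>s. indicator {0..t} s *\<^sub>R (a * exp (a * s)) \<partial>lborel)" by simp
  qed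
  then show ?thesis unfolding real_scaleR_def by (intro primI) blast+
qed

lemma prim_exp_mult:
  assumes "prim F f" shows "prim (\<lambda>t. exp (a * t) * F t) (\<lambda>t. exp (a * t) * (a * F t + f t))"
  using prim_mult[OF prim_exp[of a] assms] by (simp add: algebra_simps)

lemma prim_of_continuous:
  assumes "\<And>t. 0 \<le> t \<Longrightarrow> continuous_on {0..t} f"
  obtains F where "prim F f" "F 0 = 0"
proof -
  define F where "F t = (\<integral>s. indicator {0..t} s * f s \<partial>lborel)" for t :: real
  have "(\<lambda>s. indicator {0..0::real} s * f s) = (\<lambda>s. if s = 0 then f s else 0)"
    by (auto simp: indicator_def)
  have F0: "F 0 = 0"
  proof -
    have "F 0 = (\<integral>s. 0 \<partial>(lborel :: real measure))"
      unfolding F_def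
    proof (rule integral_cong_AE)
      show "AE s in lborel. indicator {0..0::real} s * f s = 0"
        using AE_lborel_singleton[of 0] by eventually_elim (auto simp: indicator_def)
      show "(\<lambda>s. indicator {0..0::real} s * f s) \<in> borel_measurable lborel"
        using borel_integrable_compact[OF compact_Icc assms[of 0]] by (auto dest: borel_measurable_integrable)
    qed simp
    then show ?thesis by simp
  qed
  have "prim F f"
  proof (rule primI)
    fix t :: real assume "0 \<le> t"
    show "integrable lborel (\<lambda>s. indicator {0..t} s * f s)"
      using borel_integrable_compact[OF compact_Icc assms[OF \<open>0 \<le> t\<close>]] by simp
    show "F t = F 0 + (\<integral>s. indicator {0..t} s * f s \<partial>lborel)"
      by (simp add: F0 F_def[of t])
  qed
  with F0 that show ?thesis by blast
qed

text \<open>Over a time interval on which the integral \<open>\<Gamma>\<close> of \<open>c\<close> grows by one half, the increment of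
  \<open>Z\<close> is at most half of its final value, so \<open>Z\<close> at most doubles; \<open>m\<close> such intervals suffice.\<close>
lemma gronwall:
  assumes Z: "prim Z (\<lambda>s. c s * y s)" and \<Gamma>: "prim \<Gamma> c" "\<Gamma> 0 = 0"
    and c: "\<And>s. 0 \<le> s \<Longrightarrow> 0 \<le> c s" and y0: "\<And>s. 0 \<le> s \<Longrightarrow> 0 \<le> y s" and Z0: "0 \<le> Z 0"
    and y: "\<And>s. 0 \<le> s \<Longrightarrow> y s \<le> Z s"
    and m: "\<And>t. 0 \<le> t \<Longrightarrow> \<Gamma> t \<le> real m / 2" and t: "0 \<le> t"
  shows "y t \<le> 2 ^ m * Z 0"
proof -
  have Zmono: "Z s \<le> Z t" if "0 \<le> s" "s \<le> t" for s t
    by (rule prim_mono[OF Z that]) (use c y0 that in auto)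
  have step: "Z t * (1 - (\<Gamma> t - \<Gamma> s)) \<le> Z s" if st: "0 \<le> s" "s \<le> t" for s t
  proof -
    have "prim (\<lambda>r. Z t * \<Gamma> r + (- 1) * Z r) (\<lambda>r. Z t * c r + (- 1) * (c r * y r))"
      by (intro prim_add prim_cmult Z \<Gamma>)
    then have "Z t * \<Gamma> s + (- 1) * Z s \<le> Z t * \<Gamma> t + (- 1) * Z t"
    proof (rule prim_mono[OF _ st], intro AE_I2 impI)
      fix r assume r: "s < r \<and> r < t"
      have "y r \<le> Z t" using y[of r] Zmono[of r t] r st by simp
      then have "c r * y r \<le> c r * Z t" using c[of r] r st by (intro mult_left_mono) auto
      then show "0 \<le> Z t * c r + (- 1) * (c r * y r)" by (simp add: mult.commute)
    qed
    then show ?thesis by (simp add: algebra_simps)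
  qed
  have "\<Gamma> t \<le> real j / 2 \<Longrightarrow> 0 \<le> t \<Longrightarrow> Z t \<le> 2 ^ j * Z 0" for j t
  proof (induction j arbitrary: t)
    case 0
    have "0 \<le> \<Gamma> t" using prim_mono[OF \<Gamma>(1), of 0 t] c 0 \<Gamma>(2) by auto
    then have "\<Gamma> t = 0" using 0 by simp
    then show ?case using step[of 0 t] 0 \<Gamma>(2) by simp
  next
    case (Suc j)
    show ?case
    proof (cases "\<Gamma> t \<le> real j / 2")
      case True
      then have "Z t \<le> 2 ^ j * Z 0" using Suc by simp
      also have "\<dots> \<le> 2 ^ Suc j * Z 0" using Z0 by (intro mult_right_mono power_increasing) auto
      finally show ?thesis .
    next
      case False
      have "\<exists>s\<ge>0. s \<le> t \<and> \<Gamma> s = real j / 2"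
        using False Suc.prems \<Gamma>(2) prim_continuous[OF \<Gamma>(1), of t] by (intro IVT') auto
      then obtain s where s: "0 \<le> s" "s \<le> t" "\<Gamma> s = real j / 2" by blast
      have Zs: "Z s \<le> 2 ^ j * Z 0" using Suc.IH[of s] s by simp
      have Zt: "0 \<le> Z t" using Zmono[of 0 t] Z0 Suc.prems by simp
      have "Z t * (1 / 2) \<le> Z t * (1 - (\<Gamma> t - \<Gamma> s))"
        using Suc.prems s by (intro mult_left_mono Zt) (simp add: field_simps)
      also have "\<dots> \<le> Z s" by (rule step[OF s(1,2)])
      finally show ?thesis using Zs by simp
    qed
  qed
  then have "Z t \<le> 2 ^ m * Z 0" using m t by simp
  then show ?thesis using y[OF t] by simp
qed

section \<open>Energy identities\<close>

text \<open>Dominated convergence in the integrated identity for the partial sums. Convergence is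
  assumed at time zero and obtained at all later times. The derivative \<open>e'\<close> is a pointwise limit
  of measurable functions; \<open>e\<close> itself need not be measurable.\<close>
lemma prim_series:
  fixes U G :: "int \<times> int \<Rightarrow> real \<Rightarrow> real" and w :: "int \<times> int \<Rightarrow> real"
  assumes U: "\<And>k. prim (U k) (G k)"
    and E0: "convergent (\<lambda>n. \<Sum>k\<in>freqs n. w k * (U k 0)\<^sup>2)"
    and dom: "\<And>T. 0 < T \<Longrightarrow> \<exists>D. set_integrable lborel {0<..<T} D \<and>
      (AE s in lborel. 0 < s \<and> s < T \<longrightarrow>
        (\<lambda>n. \<Sum>k\<in>freqs n. 2 * (w k * (U k s * G k s))) \<longlonglongrightarrow> e s \<and>
        (\<forall>n. \<bar>\<Sum>k\<in>freqs n. 2 * (w k * (U k s * G k s))\<bar> \<le> D s))"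
  obtains E e' where "prim E e'" "\<And>t. 0 \<le> t \<Longrightarrow> (\<lambda>n. \<Sum>k\<in>freqs n. w k * (U k t)\<^sup>2) \<longlonglongrightarrow> E t"
    "\<And>T. AE s in lborel. 0 < s \<and> s < T \<longrightarrow> e' s = e s"
proof -
  define en where "en n s = (\<Sum>k\<in>freqs n. 2 * (w k * (U k s * G k s)))" for n s
  define En where "En n t = (\<Sum>k\<in>freqs n. w k * (U k t)\<^sup>2)" for n t
  define e' where "e' s = lim (\<lambda>n. en n s)" for s
  define E where "E t = lim (\<lambda>n. En n t)" for t
  have En: "prim (En n) (en n)" for n
  proof -
    have "prim (\<lambda>t. \<Sum>k\<in>freqs n. w k * (U k t * U k t)) (\<lambda>t. \<Sum>k\<in>freqs n. w k * (G k t * U k t + U k t * G k t))"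
      by (intro prim_sum prim_cmult prim_mult U)
    moreover have "(\<lambda>t. \<Sum>k\<in>freqs n. w k * (U k t * U k t)) = En n"
      by (rule ext) (simp add: En_def power2_eq_square)
    moreover have "(\<lambda>t. \<Sum>k\<in>freqs n. w k * (G k t * U k t + U k t * G k t)) = en n"
      by (rule ext) (auto simp: en_def algebra_simps intro!: sum.cong)
    ultimately show ?thesis by simp
  qed
  have ae: "AE s in lborel. 0 < s \<and> s < T \<longrightarrow> e' s = e s" for T
  proof (cases "0 < T")
    case True
    from dom[OF this] obtain D where "AE s in lborel. 0 < s \<and> s < T \<longrightarrow> (\<lambda>n. en n s) \<longlonglongrightarrow> e s \<and> (\<forall>n. \<bar>en n s\<bar> \<le> D s)"
      unfolding en_def by blast
    then show ?thesis by eventually_elim (auto simp: e'_def limI)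
  qed auto
  have main: "integrable lborel (\<lambda>s. indicator {0..t} s * e' s) \<and> (\<lambda>n. En n t) \<longlonglongrightarrow> E 0 + (\<integral>s. indicator {0..t} s * e' s \<partial>lborel)"
    if t: "0 \<le> t" for t
  proof -
    have "0 < t + 1" using t by simp
    from dom[OF this] obtain D where D: "set_integrable lborel {0<..<t + 1} D"
      and aeD: "AE s in lborel. 0 < s \<and> s < t + 1 \<longrightarrow> (\<lambda>n. en n s) \<longlonglongrightarrow> e s \<and> (\<forall>n. \<bar>en n s\<bar> \<le> D s)"
      unfolding en_def by blast
    let ?S = "\<lambda>n s. indicator {0..t} s * en n s" and ?f = "\<lambda>s. indicator {0..t} s * e' s"
      and ?D = "\<lambda>s. indicator {0<..<t + 1} s * D s"
    have mS: "?S n \<in> borel_measurable lborel" for n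
      using prim_integrable[OF En t] by auto
    have "?f = (\<lambda>s. lim (\<lambda>n. ?S n s))"
      by (auto simp: e'_def indicator_def)
    then have mf: "?f \<in> borel_measurable lborel"
      using borel_measurable_lim_metric[OF mS] by simp
    have iD: "integrable lborel ?D" using D by (simp add: set_integrable_def)
    have lim: "AE s in lborel. (\<lambda>n. ?S n s) \<longlonglongrightarrow> ?f s"
      using aeD AE_lborel_singleton[of 0]
    proof eventually_elim
      case (elim s)
      show ?case
      proof (cases "s \<in> {0..t}")
        case True
        then have "(\<lambda>n. en n s) \<longlonglongrightarrow> e s" using elim by auto
        moreover from this have "e' s = e s" by (simp add: e'_def limI)
        ultimately show ?thesis using True by simp
      qed simp
    qed
    have bd: "AE s in lborel. norm (?S n s) \<le> ?D s" for n
      using aeD AE_lborel_singleton[of 0]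
    proof eventually_elim
      case (elim s)
      then show ?case
        by (cases "0 < s \<and> s < t + 1") (auto simp: indicator_def abs_mult intro: order_trans[OF abs_ge_zero])
    qed
    have I: "integrable lborel ?f" "(\<lambda>n. \<integral>s. ?S n s \<partial>lborel) \<longlonglongrightarrow> (\<integral>s. ?f s \<partial>lborel)"
      using integrable_dominated_convergence[OF mf mS iD lim bd] integral_dominated_convergence[OF mf mS iD lim bd] .
    have "(\<lambda>n. En n 0) \<longlonglongrightarrow> E 0"
      using E0 unfolding En_def[symmetric] by (simp add: E_def convergent_LIMSEQ_iff)
    from tendsto_add[OF this I(2)] have "(\<lambda>n. En n t) \<longlonglongrightarrow> E 0 + (\<integral>s. ?f s \<partial>lborel)"
      by (simp flip: prim_value[OF En t])
    with I(1) show ?thesis by simp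
  qed
  have E: "E t = E 0 + (\<integral>s. indicator {0..t} s * e' s \<partial>lborel)" if "0 \<le> t" for t
    using main[OF that] by (simp add: E_def[of t] limI)
  have "prim E e'"
    by (rule primI) (use main E in blast)+
  moreover have "(\<lambda>n. \<Sum>k\<in>freqs n. w k * (U k t)\<^sup>2) \<longlonglongrightarrow> E t" if "0 \<le> t" for t
    using main[OF that] E[OF that] by (simp add: En_def)
  ultimately show ?thesis using that ae by blast
qed

section \<open>Estimates at a fixed time\<close>

lemma inner_Lap:
  assumes "u \<in> L2" "v \<in> L2" "\<And>k. coef v k = - eig k * coef u k" "sobfin 1 u"
  shows "L2_inner u v = - sob 1 u"
proof -
  have "(\<lambda>n. \<Sum>k\<in>freqs n. coef u k * coef v k) \<longlonglongrightarrow> L2_inner u v"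
    by (rule parseval[OF assms(1,2)])
  moreover have "(\<Sum>k\<in>freqs n. coef u k * coef v k) = - ssum 1 u n" for n
    by (simp add: ssum_def assms(3) power2_eq_square mult_ac flip: sum_negf)
  ultimately show ?thesis
    using LIMSEQ_unique[OF _ tendsto_minus[OF ssum_tendsto[OF assms(4)]]] by simp
qed

lemma inner_Dx:
  assumes "u \<in> L2" "v \<in> L2" "ux \<in> L2" "vx \<in> L2" "coef ux = dxc (coef u)" "coef vx = dxc (coef v)"
  shows "L2_inner u vx = - L2_inner ux v"
proof -
  have "(\<lambda>n. \<Sum>k\<in>freqs n. coef u k * coef vx k) \<longlonglongrightarrow> L2_inner u vx"
    "(\<lambda>n. - (\<Sum>k\<in>freqs n. coef ux k * coef v k)) \<longlonglongrightarrow> - L2_inner ux v"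
    by (intro parseval tendsto_minus assms)+
  moreover have "(\<Sum>k\<in>freqs n. coef u k * coef vx k) = - (\<Sum>k\<in>freqs n. coef ux k * coef v k)" for n
    unfolding assms(5,6) by (rule sum_dxc_adjoint)
  ultimately show ?thesis using LIMSEQ_unique by simp
qed

lemma Dx_norm_le:
  assumes "u \<in> L2_per0" "sobfin 1 u" shows "(L2_norm (Dx u))\<^sup>2 \<le> sob 1 u"
  using grad_norm_sq[OF assms] zero_le_power2[of "L2_norm (Dz u)"] unfolding grad_norm_eq by linarith

lemma young: "0 < e \<Longrightarrow> 2 * (x * y) \<le> e * x\<^sup>2 + y\<^sup>2 / e" for e x y :: real
proof -
  assume e: "0 < e"
  have "0 \<le> (e * x - y)\<^sup>2 / e" using e by simp
  also have "\<dots> = e * x\<^sup>2 - 2 * (x * y) + y\<^sup>2 / e"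
    using e by (simp add: power2_eq_square field_simps)
  finally show ?thesis by simp
qed

lemma young_half:
  fixes \<mu> x y b :: real
  assumes "0 < \<mu>" "y\<^sup>2 \<le> b" shows "2 * (x * y) \<le> \<mu> / 2 * x\<^sup>2 + 2 / \<mu> * b"
proof -
  have "2 * (x * y) \<le> \<mu> / 2 * x\<^sup>2 + y\<^sup>2 / (\<mu> / 2)"
    using assms(1) by (intro young) simp
  also have "y\<^sup>2 / (\<mu> / 2) \<le> b / (\<mu> / 2)"
    using assms by (intro divide_right_mono) auto
  also have "b / (\<mu> / 2) = 2 / \<mu> * b" by simp
  finally show ?thesis by simp
qed

lemma absorb_dissipation:
  fixes m z x y :: real
  assumes "x \<le> m / 2 * z + a" "y \<le> m / 2 * z + b" "c \<le> m * z" "e = - 2 * (m * z) + y + x"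
  shows "e \<le> - c + a + b"
proof -
  have "m / 2 * z = (m * z) / 2" by simp
  then show ?thesis using assms by linarith
qed

lemma square_sum3_le: "(x + y + z)\<^sup>2 \<le> 3 * (x\<^sup>2 + y\<^sup>2 + z\<^sup>2)" for x y z :: real
proof -
  have "0 \<le> (x - y)\<^sup>2 + (y - z)\<^sup>2 + (x - z)\<^sup>2" by simp
  then show ?thesis by (simp add: power2_eq_square algebra_simps)
qed

text \<open>The common form of the two equations at one instant: \<open>g\<close> is the time derivative of \<open>u\<close>,
  transported by the flow with stream function \<open>\<psi>\<close>. For the vorticity \<open>c f = \<rho>\<^sub>x\<close> and for the
  density \<open>c f = - N\<^sup>2 \<psi>\<^sub>x\<close>.\<close>
locale transport =
  fixes m c :: real and \<psi> u f g :: field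
  assumes m: "0 < m" and psi: "\<psi> \<in> L2_per0" "sobfin 3 \<psi>" and u: "u \<in> H2_per0"
    and f: "f \<in> L2" and g: "g \<in> L2"
    and eqn: "AE p in torus. g p + Jac u \<psi> p = c * f p + m * Lap u p"
begin

lemmas u_props = H2_per0_props[OF u]

lemma zero_mean: "coef u 0 = 0"
  by (rule coef_zero_mean[OF u_props(1)])

lemma in_L2: "u \<in> L2" "Lap u \<in> L2"
  using u_props L2_per0_L2 by auto

lemma fin1: "sobfin 1 u"
  using sobfin_mono[OF zero_mean u_props(4), of 1] by simp

lemmas J = jacobian[OF u_props(1) fin1 psi]

lemma norm_J: "(L2_norm (Jac u \<psi>))\<^sup>2 \<le> 1600 * (sob 3 \<psi> * sob 1 u)"
proof -
  have "(L2_norm (Jac u \<psi>))\<^sup>2 \<le> (40 * sqrt (sob 3 \<psi>) * sqrt (sob 1 u))\<^sup>2"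
    by (intro power_mono J) simp
  also have "\<dots> = 1600 * (sob 3 \<psi> * sob 1 u)"
    using sob_nonneg[OF psi(2)] sob_nonneg[OF fin1] by (simp add: power_mult_distrib)
  finally show ?thesis .
qed

lemma norm_Lap: "(L2_norm (Lap u))\<^sup>2 = sob 2 u"
  using sob_0(2)[OF in_L2(2)] sob_Lap(2)[OF u_props(3), of 0] by (simp flip: numeral_2_eq_2)

definition rhs :: field where "rhs p = c * f p + m * Lap u p - Jac u \<psi> p"

lemma rhs_L2: "rhs \<in> L2"
  unfolding rhs_def[abs_def] by (intro L2_diff L2_add L2_scale in_L2 f J)

lemma rhs_AE: "AE p in torus. g p = rhs p"
  using eqn by eventually_elim (simp add: rhs_def)

lemma inner:
  assumes v: "v \<in> L2"
  shows "L2_inner v g = c * L2_inner v f + m * L2_inner v (Lap u) - L2_inner v (Jac u \<psi>)"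
proof -
  have "L2_inner v g = L2_inner v rhs"
    by (rule L2_inner_cong_AE) (use v g rhs_L2 rhs_AE L2_measurable in auto)
  also have "\<dots> = c * L2_inner v f + m * L2_inner v (Lap u) - L2_inner v (Jac u \<psi>)"
    unfolding rhs_def[abs_def]
    by (simp only: L2_inner_diff_right L2_inner_add_right L2_inner_scale_right L2_diff L2_add L2_scale
        in_L2 f J v)
  finally show ?thesis .
qed

lemma norm: "(L2_norm g)\<^sup>2 \<le> 3 * (c\<^sup>2 * (L2_norm f)\<^sup>2 + m\<^sup>2 * sob 2 u + 1600 * (sob 3 \<psi> * sob 1 u))"
proof -
  have "L2_norm g = L2_norm rhs"
    by (intro L2_norm_cong_AE L2_measurable rhs_AE g rhs_L2)
  also have "\<dots> \<le> L2_norm (\<lambda>p. c * f p) + L2_norm (\<lambda>p. m * Lap u p) + L2_norm (Jac u \<psi>)"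
    unfolding rhs_def[abs_def]
    by (intro order_trans[OF L2_norm_triangle_diff] add_right_mono L2_norm_triangle L2_add L2_scale in_L2 f J)
  finally have "(L2_norm g)\<^sup>2 \<le> (L2_norm (\<lambda>p. c * f p) + L2_norm (\<lambda>p. m * Lap u p) + L2_norm (Jac u \<psi>))\<^sup>2"
    by (intro power_mono) auto
  also have "\<dots> \<le> 3 * ((L2_norm (\<lambda>p. c * f p))\<^sup>2 + (L2_norm (\<lambda>p. m * Lap u p))\<^sup>2 + (L2_norm (Jac u \<psi>))\<^sup>2)"
    by (rule square_sum3_le)
  also have "\<dots> \<le> 3 * (c\<^sup>2 * (L2_norm f)\<^sup>2 + m\<^sup>2 * sob 2 u + 1600 * (sob 3 \<psi> * sob 1 u))"
    using norm_J by (simp add: L2_norm_scale power_mult_distrib norm_Lap mult_ac)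
  finally show ?thesis .
qed

lemma inner_self: "L2_inner u g = c * L2_inner u f - m * sob 1 u"
  using inner[OF in_L2(1)] inner_Lap[OF in_L2 u_props(3) fin1] J(3) by (simp add: L2_inner_commute)

text \<open>Testing with the Laplacian of \<open>u\<close>: one quarter of the dissipation \<open>2 m (\<Delta>u, \<Delta>u)\<close> absorbs
  the Jacobian, one quarter the forcing, and the remaining half is bounded below by the Poincare
  inequality.\<close>
lemma gradient_rate:
  "- 2 * L2_inner (Lap u) g \<le> - (m * lambda1) * sob 1 u + 2 / m * (1600 * (sob 3 \<psi> * sob 1 u)) + 2 / m * (c\<^sup>2 * (L2_norm f)\<^sup>2)"
proof -
  let ?v = "Lap u"
  have 1: "L2_inner ?v ?v = sob 2 u" using norm_Lap by (simp add: L2_norm_sq)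
  have 2: "2 * L2_inner ?v (Jac u \<psi>) \<le> m / 2 * sob 2 u + 2 / m * (1600 * (sob 3 \<psi> * sob 1 u))"
    using young_half[OF m norm_J, of "L2_norm ?v"] L2_Cauchy_Schwarz[OF in_L2(2) J(1)]
    unfolding norm_Lap by linarith
  have nf: "(L2_norm (\<lambda>p. - c * f p))\<^sup>2 \<le> c\<^sup>2 * (L2_norm f)\<^sup>2"
    by (simp only: L2_norm_scale power_mult_distrib) simp
  have 3: "2 * L2_inner ?v (\<lambda>p. - c * f p) \<le> m / 2 * sob 2 u + 2 / m * (c\<^sup>2 * (L2_norm f)\<^sup>2)"
    using young_half[OF m nf, of "L2_norm ?v"] L2_Cauchy_Schwarz[OF in_L2(2) L2_scale[OF f, of "- c"]]
    unfolding norm_Lap by linarith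
  have "lambda1 * sob 1 u \<le> sob (Suc 1) u"
    by (rule sobfin_Suc(2)[OF zero_mean]) (use u_props(4) in \<open>simp add: numeral_2_eq_2\<close>)
  also have "Suc 1 = 2" by simp
  finally have 4: "m * lambda1 * sob 1 u \<le> m * sob 2 u" using m by (simp add: mult.assoc)
  have "- 2 * L2_inner ?v g = - 2 * (m * sob 2 u) + 2 * L2_inner ?v (\<lambda>p. - c * f p) + 2 * L2_inner ?v (Jac u \<psi>)"
    unfolding inner[OF in_L2(2)] 1 L2_inner_scale_right by (simp add: algebra_simps)
  from absorb_dissipation[OF 2 3 4 this] show ?thesis by simp
qed

end

text \<open>The Jacobians drop out, and so does the exchange between the two forms of energy, because
  \<open>(\<psi>, \<rho>\<^sub>x) = - (\<psi>\<^sub>x, \<rho>)\<close>; the weight \<open>n = N\<^sup>2\<close> is chosen for this.\<close>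
lemma energy_balance:
  assumes \<omega>: "transport \<nu> 1 \<psi> (Lap \<psi>) (Dx \<rho>) g" and \<rho>: "transport \<mu> (- n) \<psi> \<rho> (Dx \<psi>) r"
    and psi: "\<psi> \<in> H2_per0"
  shows "n * (- 2 * L2_inner \<psi> g) + 2 * L2_inner \<rho> r = - 2 * (n * \<nu> * sob 2 \<psi> + \<mu> * sob 1 \<rho>)"
proof -
  interpret w: transport \<nu> 1 \<psi> "Lap \<psi>" "Dx \<rho>" g by (rule \<omega>)
  interpret r: transport \<mu> "- n" \<psi> \<rho> "Dx \<psi>" r by (rule \<rho>)
  note P = H2_per0_props[OF psi]
  have pL: "\<psi> \<in> L2" by (rule L2_per0_L2[OF P(1)])
  have 1: "L2_inner \<psi> (Jac (Lap \<psi>) \<psi>) = 0"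
    using w.J(4) by (simp add: L2_inner_commute)
  have 2: "L2_inner \<psi> (Lap (Lap \<psi>)) = sob 2 \<psi>"
  proof -
    have "(\<lambda>n. \<Sum>k\<in>freqs n. coef \<psi> k * coef (Lap (Lap \<psi>)) k) = ssum 2 \<psi>"
      by (rule ext) (simp add: ssum_def w.u_props(3) P(3) power2_eq_square mult_ac)
    then show ?thesis
      using parseval[OF pL w.in_L2(2)] LIMSEQ_unique ssum_tendsto[OF P(4)] by simp
  qed
  have s1: "sobfin 1 \<psi>" using sobfin_mono[OF coef_zero_mean[OF P(1)] P(4), of 1] by simp
  have 3: "L2_inner \<psi> (Dx \<rho>) = - L2_inner \<rho> (Dx \<psi>)"
    using inner_Dx[OF pL r.in_L2(1) r.f w.f Dx_props(2)[OF P(1) s1] Dx_props(2)[OF r.u_props(1) r.fin1]]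
    by (simp add: L2_inner_commute)
  show ?thesis
    unfolding w.inner[OF pL] r.inner_self 1 2 3 by (simp add: algebra_simps)
qed

text \<open>The Jacobian drops out, and half of the dissipation absorbs \<open>(u, \<rho>\<^sub>x)\<close>.\<close>
lemma enstrophy_rate:
  assumes \<omega>: "transport \<nu> 1 \<psi> u (Dx \<rho>) g" and \<rho>: "\<rho> \<in> L2_per0" "sobfin 1 \<rho>"
  shows "2 * L2_inner u g \<le> - \<nu> * sob 1 u + sob 1 \<rho> / (\<nu> * lambda1)"
proof -
  interpret transport \<nu> 1 \<psi> u "Dx \<rho>" g by (rule \<omega>)
  have e: "0 < \<nu> * lambda1" using m lambda1_pos by simp
  have "2 * L2_inner u (Dx \<rho>) \<le> 2 * (L2_norm u * L2_norm (Dx \<rho>))"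
    using L2_Cauchy_Schwarz[OF in_L2(1) f] by simp
  also have "\<dots> \<le> (\<nu> * lambda1) * (L2_norm u)\<^sup>2 + (L2_norm (Dx \<rho>))\<^sup>2 / (\<nu> * lambda1)"
    by (rule young[OF e])
  also have "\<dots> \<le> \<nu> * (lambda1 * sob 0 u) + sob 1 \<rho> / (\<nu> * lambda1)"
    unfolding sob_0(2)[OF in_L2(1), symmetric] using Dx_norm_le[OF \<rho>] e
    by (intro add_mono divide_right_mono) auto
  also have "\<nu> * (lambda1 * sob 0 u) \<le> \<nu> * sob 1 u"
    using sobfin_Suc(2)[OF zero_mean, of 0] fin1 m by (intro mult_left_mono) auto
  finally have "2 * L2_inner u (Dx \<rho>) \<le> \<nu> * sob 1 u + sob 1 \<rho> / (\<nu> * lambda1)" by simp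
  then show ?thesis unfolding inner_self by (simp add: algebra_simps)
qed

section \<open>Decay from the differential inequalities\<close>

text \<open>Gronwall's inequality for \<open>exp (a t) Y\<close>: the linear term \<open>- a Y\<close> is cancelled by the
  weight, the source \<open>h\<close> has a bounded weighted integral, and \<open>P\<close> has a bounded integral.\<close>
lemma weighted_gronwall:
  assumes Y: "prim Y y'" and I: "prim I (\<lambda>s. exp (a * s) * h s)" "I 0 = 0" "\<And>t. 0 \<le> t \<Longrightarrow> I t \<le> H" "0 \<le> H"
    and IP: "prim IP P" "IP 0 = 0" "\<And>t. 0 \<le> t \<Longrightarrow> IP t \<le> KP"
    and P: "\<And>t. 0 \<le> t \<Longrightarrow> 0 \<le> P t" "\<And>t. 0 \<le> t \<Longrightarrow> continuous_on {0..t} P"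
    and pos: "\<And>t. 0 \<le> t \<Longrightarrow> 0 \<le> Y t" "0 \<le> K"
    and ineq: "\<And>T. AE s in lborel. 0 < s \<and> s < T \<longrightarrow> y' s \<le> - a * Y s + K * (P s * Y s) + h s"
    and t: "0 \<le> t"
  shows "exp (a * t) * Y t \<le> 2 ^ nat \<lceil>2 * (K * KP)\<rceil> * (Y 0 + H)"
proof -
  let ?y = "\<lambda>s. exp (a * s) * Y s" and ?c = "\<lambda>s. K * P s"
  have cY: "continuous_on {0..t} Y" if "0 \<le> t" for t by (rule prim_continuous[OF Y that])
  obtain J where J: "prim J (\<lambda>s. ?c s * ?y s)" "J 0 = 0"
  proof (rule prim_of_continuous[of "\<lambda>s. ?c s * ?y s"])
    show "continuous_on {0..t} (\<lambda>s. ?c s * ?y s)" if "0 \<le> t" for t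
      by (intro continuous_intros P cY that)
  qed blast
  define Z where "Z t = (Y 0 + H) + J t" for t
  have Z: "prim Z (\<lambda>s. ?c s * ?y s)"
    using prim_add[OF prim_const[of "Y 0 + H"] J(1)] by (simp add: Z_def[abs_def])
  have yZ: "?y s \<le> Z s" if s: "0 \<le> s" for s
  proof -
    let ?D = "\<lambda>t. (J t + I t) + (- 1) * ?y t"
    have "prim ?D (\<lambda>s. (?c s * ?y s + exp (a * s) * h s) + (- 1) * (exp (a * s) * (a * Y s + y' s)))"
      by (intro prim_add prim_cmult prim_exp_mult J I Y)
    then have "?D 0 \<le> ?D s"
    proof (rule prim_mono)
      show "AE r in lborel. 0 < r \<and> r < s \<longrightarrow>
          0 \<le> (?c r * ?y r + exp (a * r) * h r) + (- 1) * (exp (a * r) * (a * Y r + y' r))"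
        using ineq[of s]
      proof eventually_elim
        case (elim r)
        have "(?c r * ?y r + exp (a * r) * h r) + (- 1) * (exp (a * r) * (a * Y r + y' r))
            = exp (a * r) * (K * (P r * Y r) + h r - a * Y r - y' r)"
          by (simp add: algebra_simps)
        moreover have "0 \<le> exp (a * r) * (K * (P r * Y r) + h r - a * Y r - y' r)" if "0 < r \<and> r < s"
          using elim that by (intro mult_nonneg_nonneg) auto
        ultimately show ?case by simp
      qed
    qed (use s in auto)
    then show ?thesis using I(3)[OF s] J(2) I(2) by (simp add: Z_def)
  qed
  have "?y t \<le> 2 ^ nat \<lceil>2 * (K * KP)\<rceil> * Z 0"
  proof (rule gronwall[OF Z, where \<Gamma>="\<lambda>t. K * IP t"])
    show "prim (\<lambda>t. K * IP t) ?c" by (rule prim_cmult[OF IP(1)])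
    show "K * IP t \<le> real (nat \<lceil>2 * (K * KP)\<rceil>) / 2" if "0 \<le> t" for t
    proof -
      have "K * IP t \<le> K * KP" by (intro mult_left_mono IP pos that)
      also have "2 * (K * KP) \<le> real (nat \<lceil>2 * (K * KP)\<rceil>)" by (rule real_nat_ceiling_ge)
      then have "K * KP \<le> real (nat \<lceil>2 * (K * KP)\<rceil>) / 2" by simp
      finally show ?thesis .
    qed
    show "0 \<le> Z 0" using J(2) I(4) pos(1)[of 0] by (simp add: Z_def)
  qed (use IP(2) P pos yZ t in \<open>auto intro: mult_nonneg_nonneg\<close>)
  then show ?thesis using J(2) by (simp add: Z_def)
qed

text \<open>The weight \<open>exp (a s)\<close> costs half of the dissipation in the energy identity and leaves
  bounds for the weighted integrals of \<open>W\<close> and \<open>Q\<close>. These control the sources in the remaining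
  inequalities: the enstrophy inequality bounds the integral of \<open>P\<close> by \<open>KP\<close>, and the gradient
  inequalities are then of the form of the previous lemma.\<close>
lemma decay:
  fixes A W P R Q :: "real \<Rightarrow> real" and \<nu> \<mu> n :: real
  defines "a \<equiv> lambda1 * min \<nu> \<mu>"
  defines "Y0 \<equiv> n * A 0 + R 0"
  defines "KP \<equiv> (W 0 + Y0 / (\<mu> * (\<nu> * lambda1))) / \<nu>"
  assumes par: "0 < \<nu>" "0 < \<mu>" "0 < n"
    and prims: "prim A a'" "prim W w'" "prim P p'" "prim R r'" "prim Q q'"
    and pos: "\<And>t. 0 \<le> t \<Longrightarrow> 0 \<le> A t \<and> 0 \<le> W t \<and> 0 \<le> P t \<and> 0 \<le> R t \<and> 0 \<le> Q t"
    and poincare: "\<And>t. 0 \<le> t \<Longrightarrow> lambda1 * A t \<le> W t \<and> lambda1 * R t \<le> Q t"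
    and rates: "\<And>T. AE s in lborel. 0 < s \<and> s < T \<longrightarrow>
      n * a' s + r' s \<le> - 2 * (n * \<nu> * W s + \<mu> * Q s) \<and>
      w' s \<le> - \<nu> * P s + Q s / (\<nu> * lambda1) \<and>
      q' s \<le> - (\<mu> * lambda1) * Q s + K1 * (P s * Q s) + K2 * A s \<and>
      p' s \<le> - (\<nu> * lambda1) * P s + K3 * (P s * P s) + K4 * Q s"
    and K: "0 \<le> K1" "0 \<le> K2" "0 \<le> K3" "0 \<le> K4"
    and t: "0 \<le> t"
  shows "exp (a * t) * Q t \<le> 2 ^ nat \<lceil>2 * (K1 * KP)\<rceil> * (Q 0 + K2 / lambda1 * (Y0 / (n * \<nu>)))"
    "exp (a * t) * P t \<le> 2 ^ nat \<lceil>2 * (K3 * KP)\<rceil> * (P 0 + K4 * (Y0 / \<mu>))"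
proof -
  have lambda1: "0 < lambda1" by (rule lambda1_pos)
  have a: "0 \<le> a" "a \<le> lambda1 * \<nu>" "a \<le> lambda1 * \<mu>"
    using par lambda1 by (auto simp: a_def)
  have cont: "continuous_on {0..t} W" "continuous_on {0..t} P" "continuous_on {0..t} Q" if "0 \<le> t" for t
    using prim_continuous[OF prims(2) that] prim_continuous[OF prims(3) that] prim_continuous[OF prims(5) that] .
  obtain IW where IW: "prim IW (\<lambda>s. exp (a * s) * W s)" "IW 0 = 0"
    by (rule prim_of_continuous[of "\<lambda>s. exp (a * s) * W s"]) (intro continuous_intros cont, assumption, blast)
  obtain IQ where IQ: "prim IQ (\<lambda>s. exp (a * s) * Q s)" "IQ 0 = 0"
    by (rule prim_of_continuous[of "\<lambda>s. exp (a * s) * Q s"]) (intro continuous_intros cont, assumption, blast)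
  obtain IP where IP: "prim IP P" "IP 0 = 0"
    by (rule prim_of_continuous[of P]) (intro cont, assumption, blast)
  have Ipos: "0 \<le> IW t" "0 \<le> IQ t" "0 \<le> IP t" if t: "0 \<le> t" for t
    using prim_mono[OF IW(1) order_refl t] prim_mono[OF IQ(1) order_refl t] prim_mono[OF IP(1) order_refl t]
      pos IW(2) IQ(2) IP(2) by auto
  have Y0: "0 \<le> Y0" using pos[of 0] par by (simp add: Y0_def)
  have diss: "n * \<nu> * IW t + \<mu> * IQ t \<le> Y0" if t: "0 \<le> t" for t
  proof -
    \<comment> \<open>The weighted energy plus the dissipation integrals is nonincreasing.\<close>
    let ?D = "\<lambda>t. (- 1) * (exp (a * t) * (n * A t + R t)) + (- 1) * (n * \<nu> * IW t + \<mu> * IQ t)"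
    have "prim ?D (\<lambda>s. (- 1) * (exp (a * s) * (a * (n * A s + R s) + (n * a' s + r' s)))
        + (- 1) * (n * \<nu> * (exp (a * s) * W s) + \<mu> * (exp (a * s) * Q s)))"
      by (intro prim_add prim_cmult prim_exp_mult prims IW IQ)
    then have "?D 0 \<le> ?D t"
    proof (rule prim_mono)
      show "AE s in lborel. 0 < s \<and> s < t \<longrightarrow>
        0 \<le> (- 1) * (exp (a * s) * (a * (n * A s + R s) + (n * a' s + r' s)))
        + (- 1) * (n * \<nu> * (exp (a * s) * W s) + \<mu> * (exp (a * s) * Q s))"
        using rates[of t]
      proof eventually_elim
        case (elim s)
        have "0 \<le> exp (a * s) * (- a * (n * A s + R s) - (n * a' s + r' s) - (n * \<nu> * W s + \<mu> * Q s))"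
          if s: "0 < s \<and> s < t"
        proof (rule mult_nonneg_nonneg)
          have "a * A s \<le> lambda1 * \<nu> * A s" "a * R s \<le> lambda1 * \<mu> * R s"
            using a pos[of s] s by (auto intro: mult_right_mono)
          moreover have "\<nu> * (lambda1 * A s) \<le> \<nu> * W s" "\<mu> * (lambda1 * R s) \<le> \<mu> * Q s"
            using poincare[of s] s par by auto
          ultimately have "a * A s \<le> \<nu> * W s" and aR: "a * R s \<le> \<mu> * Q s" by (simp_all add: mult_ac)
          then have "n * (a * A s) \<le> n * (\<nu> * W s)" using par by simp
          then have "a * (n * A s + R s) \<le> n * \<nu> * W s + \<mu> * Q s" using aR by (simp add: algebra_simps)
          then show "0 \<le> - a * (n * A s + R s) - (n * a' s + r' s) - (n * \<nu> * W s + \<mu> * Q s)"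
            using elim s by simp
        qed simp
        moreover have "(- 1) * (exp (a * s) * (a * (n * A s + R s) + (n * a' s + r' s)))
            + (- 1) * (n * \<nu> * (exp (a * s) * W s) + \<mu> * (exp (a * s) * Q s))
            = exp (a * s) * (- a * (n * A s + R s) - (n * a' s + r' s) - (n * \<nu> * W s + \<mu> * Q s))"
          by (simp add: algebra_simps)
        ultimately show ?case by (simp only:) blast
      qed
    qed (use t in auto)
    moreover have "0 \<le> exp (a * t) * (n * A t + R t)" using pos[OF t] par by simp
    ultimately show ?thesis using IW(2) IQ(2) by (simp add: Y0_def)
  qed
  have IWb: "IW t \<le> Y0 / (n * \<nu>)" and IQb: "IQ t \<le> Y0 / \<mu>" if "0 \<le> t" for t
  proof -
    have "0 \<le> n * \<nu> * IW t" "0 \<le> \<mu> * IQ t" using Ipos[OF that] par by auto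
    then have "n * \<nu> * IW t \<le> Y0" "\<mu> * IQ t \<le> Y0" using diss[OF that] by auto
    then show "IW t \<le> Y0 / (n * \<nu>)" "IQ t \<le> Y0 / \<mu>" using par by (simp_all add: field_simps)
  qed
  have IPb: "IP t \<le> KP" if t: "0 \<le> t" for t
  proof -
    \<comment> \<open>The weight in \<open>IQ\<close> is at least one, so it may be used for the integral of \<open>Q\<close> itself.\<close>
    let ?D = "\<lambda>t. (1 / (\<nu> * lambda1)) * IQ t + (- 1) * (W t + \<nu> * IP t)"
    have "prim ?D (\<lambda>s. (1 / (\<nu> * lambda1)) * (exp (a * s) * Q s) + (- 1) * (w' s + \<nu> * P s))"
      by (intro prim_add prim_cmult prims IP IQ)
    then have "?D 0 \<le> ?D t"
    proof (rule prim_mono)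
      show "AE s in lborel. 0 < s \<and> s < t \<longrightarrow>
          0 \<le> (1 / (\<nu> * lambda1)) * (exp (a * s) * Q s) + (- 1) * (w' s + \<nu> * P s)"
        using rates[of t]
      proof eventually_elim
        case (elim s)
        show ?case
        proof
          assume s: "0 < s \<and> s < t"
          have "1 * Q s \<le> exp (a * s) * Q s"
            using a(1) s pos[of s] by (intro mult_right_mono) auto
          then have "(1 / (\<nu> * lambda1)) * Q s \<le> (1 / (\<nu> * lambda1)) * (exp (a * s) * Q s)"
            using par lambda1 by (intro mult_left_mono) auto
          then show "0 \<le> (1 / (\<nu> * lambda1)) * (exp (a * s) * Q s) + (- 1) * (w' s + \<nu> * P s)"
            using elim s by simp
        qed
      qed
    qed (use t in auto)
    then have "\<nu> * IP t \<le> W 0 + (1 / (\<nu> * lambda1)) * IQ t" using IP(2) IQ(2) pos[OF t] by simp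
    also have "\<dots> \<le> W 0 + (1 / (\<nu> * lambda1)) * (Y0 / \<mu>)"
      using par lambda1 by (intro add_left_mono mult_left_mono IQb t) auto
    also have "\<dots> = W 0 + Y0 / (\<mu> * (\<nu> * lambda1))" by (simp add: mult_ac)
    finally show ?thesis using par by (simp add: KP_def field_simps)
  qed
  show "exp (a * t) * Q t \<le> 2 ^ nat \<lceil>2 * (K1 * KP)\<rceil> * (Q 0 + K2 / lambda1 * (Y0 / (n * \<nu>)))"
  proof (rule weighted_gronwall[OF prims(5) _ _ _ _ IP IPb _ cont(2) _ K(1) _ t,
        where I="\<lambda>t. K2 / lambda1 * IW t" and h="\<lambda>s. K2 / lambda1 * W s"])
    show "prim (\<lambda>t. K2 / lambda1 * IW t) (\<lambda>s. exp (a * s) * (K2 / lambda1 * W s))"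
      using prim_cmult[OF IW(1), of "K2 / lambda1"] by (simp add: mult_ac)
    show "K2 / lambda1 * IW t \<le> K2 / lambda1 * (Y0 / (n * \<nu>))" if "0 \<le> t" for t
      using K lambda1 by (intro mult_left_mono IWb that) auto
    show "0 \<le> K2 / lambda1 * (Y0 / (n * \<nu>))" using K lambda1 Y0 par by auto
    show "AE s in lborel. 0 < s \<and> s < T \<longrightarrow> q' s \<le> - a * Q s + K1 * (P s * Q s) + K2 / lambda1 * W s" for T
      using rates[of T]
    proof eventually_elim
      case (elim s)
      show ?case
      proof
        assume s: "0 < s \<and> s < T"
        have "a * Q s \<le> lambda1 * \<mu> * Q s" using a pos[of s] s by (auto intro: mult_right_mono)
        moreover have "K2 / lambda1 * (lambda1 * A s) \<le> K2 / lambda1 * W s"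
          using poincare[of s] s K lambda1 by (intro mult_left_mono) auto
        then have "K2 * A s \<le> K2 / lambda1 * W s" using lambda1 by simp
        ultimately show "q' s \<le> - a * Q s + K1 * (P s * Q s) + K2 / lambda1 * W s"
          using elim s by (simp add: mult_ac)
      qed
    qed
  qed (use IW(2) pos in auto)
  show "exp (a * t) * P t \<le> 2 ^ nat \<lceil>2 * (K3 * KP)\<rceil> * (P 0 + K4 * (Y0 / \<mu>))"
  proof (rule weighted_gronwall[OF prims(3) _ _ _ _ IP IPb _ cont(2) _ K(3) _ t,
        where I="\<lambda>t. K4 * IQ t" and h="\<lambda>s. K4 * Q s"])
    show "prim (\<lambda>t. K4 * IQ t) (\<lambda>s. exp (a * s) * (K4 * Q s))"
      using prim_cmult[OF IQ(1), of K4] by (simp add: mult_ac)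
    show "K4 * IQ t \<le> K4 * (Y0 / \<mu>)" if "0 \<le> t" for t
      using K by (intro mult_left_mono IQb that) auto
    show "0 \<le> K4 * (Y0 / \<mu>)" using K Y0 par by auto
    show "AE s in lborel. 0 < s \<and> s < T \<longrightarrow> p' s \<le> - a * P s + K3 * (P s * P s) + K4 * Q s" for T
      using rates[of T]
    proof eventually_elim
      case (elim s)
      show ?case
      proof
        assume s: "0 < s \<and> s < T"
        have "a * P s \<le> lambda1 * \<nu> * P s" using a pos[of s] s by (auto intro: mult_right_mono)
        then show "p' s \<le> - a * P s + K3 * (P s * P s) + K4 * Q s"
          using elim s by (simp add: mult_ac)
      qed
    qed
  qed (use IQ(2) pos in auto)
qed

section \<open>Energies along a solution\<close>

lemma coef_cong_AE:
  assumes "AE p in lborel. u p = v p" "u \<in> L2" "v \<in> L2" shows "coef u = coef v"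
  unfolding coef_def
  by (rule ext, rule L2_inner_cong_AE) (use assms AE_torus L2_measurable in auto)

lemma sob_cong: "coef u = coef v \<Longrightarrow> sob m u = sob m v" "coef u = coef v \<Longrightarrow> sobfin m u = sobfin m v"
  by (simp_all add: sob_def sobfin_def ssum_def[abs_def])

lemma has_time_derivative_prim:
  assumes "has_time_derivative u g" shows "prim (\<lambda>t. coef (u t) k) (\<lambda>t. coef (g t) k)"
  using assms cas_test[of k] unfolding has_time_derivative_def prim_def coef_def by blast

lemma H_norm_nonneg: "0 \<le> H_norm m u"
  unfolding H_norm_def by (intro real_sqrt_ge_zero sum_nonneg) auto

lemma coef_minus: "coef (\<lambda>p. - u p) k = - coef u k"
  by (simp add: coef_def L2_inner_minus)

lemma L2_norm_minus: "L2_norm (\<lambda>p. - u p) = L2_norm u"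
  by (simp add: L2_norm_eq_sqrt L2_inner_torus)

text \<open>Square integrability in time, in a form that asks for an integrable bound and not for
  measurability of the norm in \<open>s\<close>.\<close>
definition sq_dominated :: "(real \<Rightarrow> field) \<Rightarrow> bool" where
  "sq_dominated v \<longleftrightarrow> (\<forall>T>0. \<exists>D. set_integrable lborel {0<..<T} D \<and>
     (AE s in lborel. 0 < s \<and> s < T \<longrightarrow> v s \<in> L2 \<and> (L2_norm (v s))\<^sup>2 \<le> D s))"

text \<open>The derivative of \<open>\<Sum> w\<^sub>k c\<^sub>k\<^sup>2\<close> is \<open>2 (v, g)\<close>, where \<open>v\<close> is the function with coefficients
  \<open>w\<^sub>k c\<^sub>k\<close>.\<close>
lemma energy_prim:
  assumes U: "has_time_derivative u g" and E0: "convergent (\<lambda>n. \<Sum>k\<in>freqs n. w k * (coef (u 0) k)\<^sup>2)"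
    and v: "sq_dominated v" and g: "sq_dominated g"
    and w: "\<And>T. AE s in lborel. 0 < s \<and> s < T \<longrightarrow> (\<forall>k. w k * coef (u s) k = coef (v s) k)"
  obtains E e where "prim E e" "\<And>t. 0 \<le> t \<Longrightarrow> (\<lambda>n. \<Sum>k\<in>freqs n. w k * (coef (u t) k)\<^sup>2) \<longlonglongrightarrow> E t"
    "\<And>T. AE s in lborel. 0 < s \<and> s < T \<longrightarrow> e s = 2 * L2_inner (v s) (g s)"
proof (rule prim_series[OF has_time_derivative_prim[OF U] E0, of "\<lambda>s. 2 * L2_inner (v s) (g s)"])
  fix T :: real assume T: "0 < T"
  obtain D1 D2 where D: "set_integrable lborel {0<..<T} D1" "set_integrable lborel {0<..<T} D2"
    and ae: "AE s in lborel. 0 < s \<and> s < T \<longrightarrow> v s \<in> L2 \<and> (L2_norm (v s))\<^sup>2 \<le> D1 s"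
      "AE s in lborel. 0 < s \<and> s < T \<longrightarrow> g s \<in> L2 \<and> (L2_norm (g s))\<^sup>2 \<le> D2 s"
    using v g T unfolding sq_dominated_def by blast
  let ?e = "\<lambda>n s. \<Sum>k\<in>freqs n. 2 * (w k * (coef (u s) k * coef (g s) k))"
  have "AE s in lborel. 0 < s \<and> s < T \<longrightarrow>
        (\<lambda>n. ?e n s) \<longlonglongrightarrow> 2 * L2_inner (v s) (g s) \<and> (\<forall>n. \<bar>?e n s\<bar> \<le> D1 s + D2 s)"
    using ae w[of T]
  proof eventually_elim
    case (elim s)
    show ?case
    proof
      assume "0 < s \<and> s < T"
      with elim have L: "v s \<in> L2" "g s \<in> L2" and wk: "\<And>k. w k * coef (u s) k = coef (v s) k"
        and Ds: "(L2_norm (v s))\<^sup>2 + (L2_norm (g s))\<^sup>2 \<le> D1 s + D2 s" by auto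
      have eq: "?e n s = 2 * (\<Sum>k\<in>freqs n. coef (v s) k * coef (g s) k)" for n
        unfolding mult.assoc[symmetric, of "w _"] wk sum_distrib_left ..
      have "\<bar>?e n s\<bar> \<le> D1 s + D2 s" for n
      proof -
        have "\<bar>?e n s\<bar> \<le> (\<Sum>k\<in>freqs n. (coef (v s) k)\<^sup>2 + (coef (g s) k)\<^sup>2)"
          unfolding mult.assoc[symmetric, of "w _"] wk
        proof (rule order_trans[OF sum_abs], rule sum_mono)
          fix k show "\<bar>2 * (coef (v s) k * coef (g s) k)\<bar> \<le> (coef (v s) k)\<^sup>2 + (coef (g s) k)\<^sup>2"
            using young[of 1 "\<bar>coef (v s) k\<bar>" "\<bar>coef (g s) k\<bar>"] by (simp add: abs_mult)
        qed
        also have "\<dots> \<le> (L2_norm (v s))\<^sup>2 + (L2_norm (g s))\<^sup>2"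
          unfolding sum.distrib by (intro add_mono bessel L)
        finally show ?thesis using Ds by simp
      qed
      moreover have "(\<lambda>n. ?e n s) \<longlonglongrightarrow> 2 * L2_inner (v s) (g s)"
        unfolding eq by (intro tendsto_mult_left parseval L)
      ultimately show "(\<lambda>n. ?e n s) \<longlonglongrightarrow> 2 * L2_inner (v s) (g s) \<and> (\<forall>n. \<bar>?e n s\<bar> \<le> D1 s + D2 s)" by blast
    qed
  qed
  with set_integral_add(1)[OF D] show "\<exists>D. set_integrable lborel {0<..<T} D \<and> (AE s in lborel. 0 < s \<and> s < T \<longrightarrow>
        (\<lambda>n. ?e n s) \<longlonglongrightarrow> 2 * L2_inner (v s) (g s) \<and> (\<forall>n. \<bar>?e n s\<bar> \<le> D s))" by blast
qed (rule that)

lemma sq_dominated_L2_H2: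
  assumes H2: "\<And>T. 0 < T \<Longrightarrow> L2_H2 T u"
    and v: "\<And>T. AE s in lborel. 0 < s \<and> s < T \<longrightarrow> v s \<in> L2 \<and> (L2_norm (v s))\<^sup>2 \<le> sob 2 (u s)"
  shows "sq_dominated v"
  unfolding sq_dominated_def
proof (intro allI impI exI conjI)
  fix T :: real assume T: "0 < T"
  show "set_integrable lborel {0<..<T} (\<lambda>s. 2 * (H_norm 2 (u s))\<^sup>2)"
    using H2[OF T] by (intro set_integrable_mult_right impI) (simp add: L2_H2_def)
  have "AE s in lborel. 0 < s \<and> s < T \<longrightarrow> u s \<in> H2_per0" using H2[OF T] by (simp add: L2_H2_def)
  with v[of T] show "AE s in lborel. 0 < s \<and> s < T \<longrightarrow> v s \<in> L2 \<and> (L2_norm (v s))\<^sup>2 \<le> 2 * (H_norm 2 (u s))\<^sup>2"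
    by eventually_elim (use sob_2_le_H_norm H2_per0_props in \<open>blast intro: order_trans\<close>)
qed

lemma L2_norms_le_sob_2:
  assumes u: "u \<in> H2_per0"
  shows "(L2_norm u)\<^sup>2 \<le> sob 2 u" "(L2_norm (Lap u))\<^sup>2 = sob 2 u"
proof -
  note p = H2_per0_props[OF u]
  have "sob 0 u \<le> sob 2 u" using sobfin_mono[OF coef_zero_mean[OF p(1)] p(4), of 0] by simp
  moreover have "sob 0 (Lap u) = sob 2 u" using sob_Lap(2)[OF p(3), of 0] by (simp flip: numeral_2_eq_2)
  ultimately show "(L2_norm u)\<^sup>2 \<le> sob 2 u" "(L2_norm (Lap u))\<^sup>2 = sob 2 u"
    using sob_0(2)[OF L2_per0_L2[OF p(1)]] sob_0(2)[OF L2_per0_L2[OF p(2)]] by simp_all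
qed

text \<open>The weights 1 and \<open>\<lambda>\<^sub>k\<close>, for which the function \<open>v\<close> in \<open>energy_prim\<close> is \<open>u\<close> and \<open>- \<Delta>u\<close>.\<close>
lemma mean_square_and_gradient:
  assumes U: "has_time_derivative u g" and init: "sobfin 1 (u 0)" and H2: "\<And>T. 0 < T \<Longrightarrow> L2_H2 T u"
    and g: "sq_dominated g"
  shows "\<exists>E e. prim E e \<and> (\<forall>t\<ge>0. sobfin 0 (u t) \<and> E t = sob 0 (u t)) \<and>
      (\<forall>T. AE s in lborel. 0 < s \<and> s < T \<longrightarrow> e s = 2 * L2_inner (u s) (g s))"
    "\<exists>F f. prim F f \<and> (\<forall>t\<ge>0. sobfin 1 (u t) \<and> F t = sob 1 (u t)) \<and>
      (\<forall>T. AE s in lborel. 0 < s \<and> s < T \<longrightarrow> f s = - 2 * L2_inner (Lap (u s)) (g s))"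
proof -
  have per: "u t \<in> L2_per0" if "0 \<le> t" for t using U that by (simp add: has_time_derivative_def)
  have H2s: "AE s in lborel. 0 < s \<and> s < T \<longrightarrow> u s \<in> H2_per0" for T
    using H2[of T] by (cases "0 < T") (auto simp: L2_H2_def)
  have conv: "convergent (ssum m (u 0))" if "m \<le> 1" for m
    using sobfin_mono[OF coef_zero_mean[OF per] init that] ssum_tendsto unfolding convergent_def by blast
  have fin: "sobfin m (u t) \<and> E t = sob m (u t)" if "ssum m (u t) \<longlonglongrightarrow> E t" for m E t
    using that by (auto intro: sobfinI simp: sob_def limI)
  obtain E e where E: "prim E e" "\<And>t. 0 \<le> t \<Longrightarrow> (\<lambda>n. \<Sum>k\<in>freqs n. eig k ^ 0 * (coef (u t) k)\<^sup>2) \<longlonglongrightarrow> E t"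
    "\<And>T. AE s in lborel. 0 < s \<and> s < T \<longrightarrow> e s = 2 * L2_inner (u s) (g s)"
  proof (rule energy_prim[OF U _ _ g, of "\<lambda>k. eig k ^ 0" u])
    show "sq_dominated u"
    proof (rule sq_dominated_L2_H2[OF H2])
      show "AE s in lborel. 0 < s \<and> s < T \<longrightarrow> u s \<in> L2 \<and> (L2_norm (u s))\<^sup>2 \<le> sob 2 (u s)" for T
        using H2s[of T] by eventually_elim (use L2_norms_le_sob_2 H2_per0_props L2_per0_L2 in blast)
    qed
    show "convergent (\<lambda>n. \<Sum>k\<in>freqs n. eig k ^ 0 * (coef (u 0) k)\<^sup>2)"
      using conv[of 0] unfolding ssum_def[abs_def] by simp
    show "AE s in lborel. 0 < s \<and> s < T \<longrightarrow> (\<forall>k. eig k ^ 0 * coef (u s) k = coef (u s) k)" for T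
      by simp
  qed blast
  obtain F f where F: "prim F f" "\<And>t. 0 \<le> t \<Longrightarrow> (\<lambda>n. \<Sum>k\<in>freqs n. eig k ^ 1 * (coef (u t) k)\<^sup>2) \<longlonglongrightarrow> F t"
    "\<And>T. AE s in lborel. 0 < s \<and> s < T \<longrightarrow> f s = 2 * L2_inner (\<lambda>p. - Lap (u s) p) (g s)"
  proof (rule energy_prim[OF U _ _ g, of "\<lambda>k. eig k ^ 1" "\<lambda>s p. - Lap (u s) p"])
    show "convergent (\<lambda>n. \<Sum>k\<in>freqs n. eig k ^ 1 * (coef (u 0) k)\<^sup>2)"
      using conv[of 1] unfolding ssum_def[abs_def] by simp
    show "sq_dominated (\<lambda>s p. - Lap (u s) p)"
    proof (rule sq_dominated_L2_H2[OF H2])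
      show "AE s in lborel. 0 < s \<and> s < T \<longrightarrow> (\<lambda>p. - Lap (u s) p) \<in> L2 \<and> (L2_norm (\<lambda>p. - Lap (u s) p))\<^sup>2 \<le> sob 2 (u s)" for T
        using H2s[of T]
        by eventually_elim (auto simp: L2_norm_minus L2_norms_le_sob_2 intro: L2_minus L2_per0_L2 H2_per0_props(2))
    qed
    show "AE s in lborel. 0 < s \<and> s < T \<longrightarrow> (\<forall>k. eig k ^ 1 * coef (u s) k = coef (\<lambda>p. - Lap (u s) p) k)" for T
      using H2s[of T] by eventually_elim (simp add: coef_minus H2_per0_props(3))
  qed blast
  have "sobfin 0 (u t) \<and> E t = sob 0 (u t)" "sobfin 1 (u t) \<and> F t = sob 1 (u t)" if "0 \<le> t" for t
    using E(2)[OF that] F(2)[OF that] unfolding ssum_def[symmetric] by (auto dest!: fin)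
  moreover have "AE s in lborel. 0 < s \<and> s < T \<longrightarrow> f s = - 2 * L2_inner (Lap (u s)) (g s)" for T
    using F(3)[of T] by (simp add: L2_inner_minus)
  ultimately show "\<exists>E e. prim E e \<and> (\<forall>t\<ge>0. sobfin 0 (u t) \<and> E t = sob 0 (u t)) \<and>
      (\<forall>T. AE s in lborel. 0 < s \<and> s < T \<longrightarrow> e s = 2 * L2_inner (u s) (g s))"
    "\<exists>F f. prim F f \<and> (\<forall>t\<ge>0. sobfin 1 (u t) \<and> F t = sob 1 (u t)) \<and>
      (\<forall>T. AE s in lborel. 0 < s \<and> s < T \<longrightarrow> f s = - 2 * L2_inner (Lap (u s)) (g s))"
    using E(1,3) F(1) by blast+
qed

section \<open>A priori bounds for solutions\<close>

text \<open>A solution with chosen time derivatives, \<open>n\<close> standing for \<open>N\<^sup>2\<close> and \<open>\<mu>\<close> for \<open>\<nu> / Pr\<close>.\<close>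
locale solution =
  fixes \<nu> n \<mu> :: real and \<psi> \<rho> \<omega>t \<rho>t :: "real \<Rightarrow> field"
  assumes par: "0 < \<nu>" "0 < n" "0 < \<mu>"
    and init: "sobfin 3 (\<psi> 0)" "sobfin 1 (\<rho> 0)"
    and psi: "\<And>t. 0 \<le> t \<Longrightarrow> \<psi> t \<in> H2_per0"
    and V: "\<And>S. 0 < S \<Longrightarrow> Linf_V S (\<lambda>t. Lap (\<psi> t))" "\<And>S. 0 < S \<Longrightarrow> Linf_V S \<rho>"
    and H2: "\<And>S. 0 < S \<Longrightarrow> L2_H2 S (\<lambda>t. Lap (\<psi> t))" "\<And>S. 0 < S \<Longrightarrow> L2_H2 S \<rho>"
    and dt: "has_time_derivative (\<lambda>t. Lap (\<psi> t)) \<omega>t" "has_time_derivative \<rho> \<rho>t"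
    and eqn: "AE t in lborel. 0 < t \<longrightarrow> (AE p in lborel.
           \<omega>t t p + Jac (Lap (\<psi> t)) (\<psi> t) p = Dx (\<rho> t) p + \<nu> * Lap (Lap (\<psi> t)) p \<and>
           \<rho>t t p + Jac (\<rho> t) (\<psi> t) p = - n * Dx (\<psi> t) p + \<mu> * Lap (\<rho> t) p)"
begin

definition good :: "real \<Rightarrow> bool" where
  "good s \<longleftrightarrow> transport \<nu> 1 (\<psi> s) (Lap (\<psi> s)) (Dx (\<rho> s)) (\<omega>t s) \<and>
     transport \<mu> (- n) (\<psi> s) (\<rho> s) (Dx (\<psi> s)) (\<rho>t s)"

lemma rho: "0 \<le> t \<Longrightarrow> \<rho> t \<in> L2_per0"
  using dt(2) by (simp add: has_time_derivative_def)

lemma sob_omega: "0 \<le> t \<Longrightarrow> sob m (Lap (\<psi> t)) = sob (m + 2) (\<psi> t)"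
  "0 \<le> t \<Longrightarrow> sobfin m (Lap (\<psi> t)) = sobfin (m + 2) (\<psi> t)"
  using sob_Lap[OF H2_per0_props(3)[OF psi]] by auto

lemma psi_zero_mean: "0 \<le> t \<Longrightarrow> coef (\<psi> t) 0 = 0"
  by (rule coef_zero_mean[OF H2_per0_props(1)[OF psi]])

lemma almost_all_good: "AE s in lborel. 0 < s \<and> s < T \<longrightarrow> good s"
proof (cases "0 < T")
  case True
  have "AE s in lborel. 0 < s \<and> s < T \<longrightarrow> Lap (\<psi> s) \<in> H2_per0" "AE s in lborel. 0 < s \<and> s < T \<longrightarrow> \<rho> s \<in> H2_per0"
    "AE s in lborel. 0 < s \<longrightarrow> \<omega>t s \<in> L2_per0" "AE s in lborel. 0 < s \<longrightarrow> \<rho>t s \<in> L2_per0"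
    using H2[OF True] dt by (auto simp: L2_H2_def has_time_derivative_def)
  with eqn show ?thesis
  proof eventually_elim
    case (elim s)
    show ?case
    proof
      assume s: "0 < s \<and> s < T"
      have o: "Lap (\<psi> s) \<in> H2_per0" and r: "\<rho> s \<in> H2_per0" and t: "\<omega>t s \<in> L2" "\<rho>t s \<in> L2"
        using elim s L2_per0_L2 by auto
      have "AE p in lborel. \<omega>t s p + Jac (Lap (\<psi> s)) (\<psi> s) p = 1 * Dx (\<rho> s) p + \<nu> * Lap (Lap (\<psi> s)) p"
        "AE p in lborel. \<rho>t s p + Jac (\<rho> s) (\<psi> s) p = - n * Dx (\<psi> s) p + \<mu> * Lap (\<rho> s) p"
        using elim s by (auto elim: eventually_mono)
      note e = AE_torus[OF this(1)] AE_torus[OF this(2)]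
      note P = H2_per0_props[OF psi, of s] and O = H2_per0_props[OF o] and R = H2_per0_props[OF r]
      have p4: "sobfin 4 (\<psi> s)" using O(4) sob_omega(2)[of s 2] s by simp
      have fin: "sobfin 1 (\<psi> s)" "sobfin 3 (\<psi> s)" "sobfin 1 (\<rho> s)"
        using sobfin_mono[OF psi_zero_mean p4] sobfin_mono[OF coef_zero_mean[OF R(1)] R(4), of 1] s by auto
      show "good s"
        unfolding good_def
        by (intro conjI transport.intro e o r t fin par P(1) L2_per0_L2[OF Dx_props(1)] R(1)) (use s in auto)
    qed
  qed
qed auto

text \<open>Through the equations: the Jacobians are bounded since \<open>\<nabla>\<omega>\<close> and \<open>\<nabla>\<rho>\<close> are bounded in time,
  and the diffusion terms are square integrable in time.\<close>
lemma rates_dominated: "sq_dominated \<omega>t" "sq_dominated \<rho>t"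
proof -
  have "\<exists>D. set_integrable lborel {0<..<T} D \<and> (AE s in lborel. 0 < s \<and> s < T \<longrightarrow>
      (\<omega>t s \<in> L2 \<and> (L2_norm (\<omega>t s))\<^sup>2 \<le> D s) \<and> (\<rho>t s \<in> L2 \<and> (L2_norm (\<rho>t s))\<^sup>2 \<le> D s))"
    if T: "0 < T" for T
  proof -
    obtain M1 where M1: "AE t in lborel. 0 < t \<and> t < T \<longrightarrow> Lap (\<psi> t) \<in> H_per0 1 \<and> H_norm 1 (Lap (\<psi> t)) \<le> M1"
      using V(1)[OF T] unfolding Linf_V_def by blast
    obtain M2 where M2: "AE t in lborel. 0 < t \<and> t < T \<longrightarrow> \<rho> t \<in> H_per0 1 \<and> H_norm 1 (\<rho> t) \<le> M2"
      using V(2)[OF T] unfolding Linf_V_def by blast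
      \<comment> \<open>A bound for \<open>sob 1\<close> of the vorticity and of the density.\<close>
  define M where "M = (max \<bar>M1\<bar> \<bar>M2\<bar>)\<^sup>2"
    define X where "X s = (H_norm 2 (Lap (\<psi> s)))\<^sup>2 + (H_norm 2 (\<rho> s))\<^sup>2" for s
    define c1 where "c1 = 3 * ((1 + n\<^sup>2) * M + 1600 * (M * M))"
    define c2 where "c2 = 6 * (\<nu>\<^sup>2 + \<mu>\<^sup>2)"
    have X: "set_integrable lborel {0<..<T} X"
      unfolding X_def using H2[OF T] by (intro set_integral_add) (auto simp: L2_H2_def)
    have "set_integrable lborel {0<..<T} (\<lambda>s. c1 + c2 * X s)"
    proof (intro set_integral_add(1) set_integrable_mult_right impI X)
      show "set_integrable lborel {0<..<T} (\<lambda>s. c1)"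
        unfolding set_integrable_def by (intro integrable_scaleR_left integrable_real_indicator)
          (use T in \<open>simp_all add: emeasure_lborel_Ioo\<close>)
    qed
    moreover have "AE s in lborel. 0 < s \<and> s < T \<longrightarrow>
        (\<omega>t s \<in> L2 \<and> (L2_norm (\<omega>t s))\<^sup>2 \<le> c1 + c2 * X s) \<and> (\<rho>t s \<in> L2 \<and> (L2_norm (\<rho>t s))\<^sup>2 \<le> c1 + c2 * X s)"
      using M1 M2 almost_all_good[of T]
    proof eventually_elim
      case (elim s)
      show ?case
      proof
        assume s: "0 < s \<and> s < T"
        with elim(3) have "good s" by blast
        then interpret w: transport \<nu> 1 "\<psi> s" "Lap (\<psi> s)" "Dx (\<rho> s)" "\<omega>t s"
          + r: transport \<mu> "- n" "\<psi> s" "\<rho> s" "Dx (\<psi> s)" "\<rho>t s"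
          by (simp_all add: good_def)
        have "sob 1 (Lap (\<psi> s)) \<le> (H_norm 1 (Lap (\<psi> s)))\<^sup>2" "sob 1 (\<rho> s) \<le> (H_norm 1 (\<rho> s))\<^sup>2"
          by (rule sob_1_le_H_norm, use elim(1) s in blast, rule sob_1_le_H_norm, use elim(2) s in blast)
        moreover have "(H_norm 1 (Lap (\<psi> s)))\<^sup>2 \<le> M" "(H_norm 1 (\<rho> s))\<^sup>2 \<le> M"
          unfolding M_def by (intro power_mono H_norm_nonneg, use elim(1,2) s in force)+
        moreover have o1: "sob 1 (Lap (\<psi> s)) = sob 3 (\<psi> s)"
          using sob_omega(1)[of s 1] s by (simp add: numeral_3_eq_3)
        ultimately have P3: "sob 3 (\<psi> s) \<le> M" and Q1: "sob 1 (\<rho> s) \<le> M" by linarith+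
        have "sob 2 (Lap (\<psi> s)) \<le> 2 * (H_norm 2 (Lap (\<psi> s)))\<^sup>2" "sob 2 (\<rho> s) \<le> 2 * (H_norm 2 (\<rho> s))\<^sup>2"
          using sob_2_le_H_norm w.u_props r.u_props by blast+
        moreover have "0 \<le> (H_norm 2 (Lap (\<psi> s)))\<^sup>2" "0 \<le> (H_norm 2 (\<rho> s))\<^sup>2" by simp_all
        moreover have "2 * X s = 2 * (H_norm 2 (Lap (\<psi> s)))\<^sup>2 + 2 * (H_norm 2 (\<rho> s))\<^sup>2" by (simp add: X_def)
        ultimately have L: "sob 2 (Lap (\<psi> s)) \<le> 2 * X s" "sob 2 (\<rho> s) \<le> 2 * X s" and X0: "0 \<le> X s" by linarith+
        have M0: "0 \<le> M" by (simp add: M_def)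
        have p: "sobfin 1 (\<psi> s) \<and> sob 1 (\<psi> s) \<le> sob 3 (\<psi> s)"
          by (rule sobfin_mono[OF psi_zero_mean w.psi(2)]) (use s in auto)
        have "(L2_norm (Dx (\<psi> s)))\<^sup>2 \<le> sob 1 (\<psi> s)" "(L2_norm (Dx (\<rho> s)))\<^sup>2 \<le> sob 1 (\<rho> s)"
          using Dx_norm_le w.psi(1) p r.u_props(1) r.fin1 by blast+
        then have D: "(L2_norm (Dx (\<psi> s)))\<^sup>2 \<le> M" "(L2_norm (Dx (\<rho> s)))\<^sup>2 \<le> M" using p P3 Q1 by linarith+
        have PP: "sob 3 (\<psi> s) * sob 1 (Lap (\<psi> s)) \<le> M * M" "sob 3 (\<psi> s) * sob 1 (\<rho> s) \<le> M * M"
          unfolding o1 using P3 Q1 M0 sob_nonneg[OF w.psi(2)] sob_nonneg[OF r.fin1] by (auto intro!: mult_mono)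
        have arith: "x \<le> c1 + c2 * X s"
          if "x \<le> 3 * (c\<^sup>2 * y + m\<^sup>2 * z + 1600 * w)" "y \<le> M" "z \<le> 2 * X s" "w \<le> M * M" "c\<^sup>2 \<le> 1 + n\<^sup>2" "m\<^sup>2 \<le> \<nu>\<^sup>2 + \<mu>\<^sup>2"
            "0 \<le> y" "0 \<le> z"
          for x c y m z w
        proof -
          have "c\<^sup>2 * y \<le> (1 + n\<^sup>2) * M" "m\<^sup>2 * z \<le> (\<nu>\<^sup>2 + \<mu>\<^sup>2) * (2 * X s)"
            using that by (auto intro!: mult_mono)
          then have "3 * (c\<^sup>2 * y + m\<^sup>2 * z + 1600 * w) \<le> 3 * ((1 + n\<^sup>2) * M + (\<nu>\<^sup>2 + \<mu>\<^sup>2) * (2 * X s) + 1600 * (M * M))"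
            using that by (intro mult_left_mono add_mono) auto
          also have "\<dots> = c1 + c2 * X s" by (simp add: c1_def c2_def algebra_simps)
          finally show ?thesis using that(1) by simp
        qed
        show "(\<omega>t s \<in> L2 \<and> (L2_norm (\<omega>t s))\<^sup>2 \<le> c1 + c2 * X s) \<and> (\<rho>t s \<in> L2 \<and> (L2_norm (\<rho>t s))\<^sup>2 \<le> c1 + c2 * X s)"
        proof (intro conjI w.g r.g)
          show "(L2_norm (\<omega>t s))\<^sup>2 \<le> c1 + c2 * X s"
            by (rule arith[OF w.norm D(2) L(1) PP(1)]) (auto intro: sob_nonneg w.u_props)
          show "(L2_norm (\<rho>t s))\<^sup>2 \<le> c1 + c2 * X s"
            by (rule arith[OF r.norm D(1) L(2) PP(2)]) (auto intro: sob_nonneg r.u_props)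
        qed
      qed
    qed
    ultimately show ?thesis by blast
  qed
  then show "sq_dominated \<omega>t" "sq_dominated \<rho>t"
    unfolding sq_dominated_def by (blast intro: eventually_mono)+
qed

text \<open>The kinetic energy is \<open>\<Sum> \<omega>\<^sub>k\<^sup>2 / \<lambda>\<^sub>k\<close>. At \<open>k = 0\<close> the weight is \<open>1 / 0 = 0\<close>, which agrees
  with the zero mean of \<open>\<psi>\<close>.\<close>
lemma stream_function_energy:
  obtains A a where "prim A a" "\<And>t. 0 \<le> t \<Longrightarrow> sobfin 1 (\<psi> t) \<and> A t = sob 1 (\<psi> t)"
    "\<And>T. AE s in lborel. 0 < s \<and> s < T \<longrightarrow> a s = - 2 * L2_inner (\<psi> s) (\<omega>t s)"
proof -
  have w: "1 / eig k * coef (Lap (\<psi> t)) k = - coef (\<psi> t) k" if "0 \<le> t" for t k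
  proof (cases "k = 0")
    case True then show ?thesis using psi_zero_mean[OF that] by simp
  next
    case False
    then have "eig k \<noteq> 0" using eig_lower[of k] lambda1_pos by linarith
    then show ?thesis by (simp add: H2_per0_props(3)[OF psi[OF that]])
  qed
  have sum: "(\<Sum>k\<in>freqs j. 1 / eig k * (coef (Lap (\<psi> t)) k)\<^sup>2) = ssum 1 (\<psi> t) j" if "0 \<le> t" for t j
    unfolding ssum_def
  proof (rule sum.cong)
    fix k
    have "1 / eig k * (coef (Lap (\<psi> t)) k)\<^sup>2 = (1 / eig k * coef (Lap (\<psi> t)) k) * coef (Lap (\<psi> t)) k"
      by (simp add: power2_eq_square)
    also have "\<dots> = eig k ^ 1 * (coef (\<psi> t) k)\<^sup>2"
      unfolding w[OF that] H2_per0_props(3)[OF psi[OF that]] by (simp add: power2_eq_square)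
    finally show "1 / eig k * (coef (Lap (\<psi> t)) k)\<^sup>2 = eig k ^ 1 * (coef (\<psi> t) k)\<^sup>2" .
  qed simp
  obtain A a where A: "prim A a" "\<And>t. 0 \<le> t \<Longrightarrow> (\<lambda>j. \<Sum>k\<in>freqs j. 1 / eig k * (coef (Lap (\<psi> t)) k)\<^sup>2) \<longlonglongrightarrow> A t"
    "\<And>T. AE s in lborel. 0 < s \<and> s < T \<longrightarrow> a s = 2 * L2_inner (\<lambda>p. - \<psi> s p) (\<omega>t s)"
  proof (rule energy_prim[OF dt(1) _ _ rates_dominated(1), of "\<lambda>k. 1 / eig k" "\<lambda>s p. - \<psi> s p"])
    have "sobfin 1 (\<psi> 0)" using sobfin_mono[OF psi_zero_mean init(1), of 1] by simp
    then show "convergent (\<lambda>j. \<Sum>k\<in>freqs j. 1 / eig k * (coef (Lap (\<psi> 0)) k)\<^sup>2)"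
      unfolding sum[OF order_refl] using ssum_tendsto convergent_def by blast
    show "sq_dominated (\<lambda>s p. - \<psi> s p)"
    proof (rule sq_dominated_L2_H2[OF H2(1)])
      fix T :: real
      show "AE s in lborel. 0 < s \<and> s < T \<longrightarrow> (\<lambda>p. - \<psi> s p) \<in> L2 \<and> (L2_norm (\<lambda>p. - \<psi> s p))\<^sup>2 \<le> sob 2 (Lap (\<psi> s))"
        using almost_all_good[of T]
      proof eventually_elim
        case (elim s)
        show ?case
        proof
          assume s: "0 < s \<and> s < T"
          with elim interpret w: transport \<nu> 1 "\<psi> s" "Lap (\<psi> s)" "Dx (\<rho> s)" "\<omega>t s" by (simp add: good_def)
          note le = L2_norms_le_sob_2(1)[OF psi, of s] L2_norms_le_sob_2(2)[OF psi, of s] L2_norms_le_sob_2(1)[OF w.u]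
          show "(\<lambda>p. - \<psi> s p) \<in> L2 \<and> (L2_norm (\<lambda>p. - \<psi> s p))\<^sup>2 \<le> sob 2 (Lap (\<psi> s))"
            using le s L2_minus[OF L2_per0_L2[OF w.psi(1)]] by (simp add: L2_norm_minus)
        qed
      qed
    qed
    show "AE s in lborel. 0 < s \<and> s < T \<longrightarrow> (\<forall>k. 1 / eig k * coef (Lap (\<psi> s)) k = coef (\<lambda>p. - \<psi> s p) k)" for T
      by (intro AE_I2 impI allI) (simp only: coef_minus w less_imp_le)
  qed blast
  show ?thesis
  proof (rule that[OF A(1)])
    show "sobfin 1 (\<psi> t) \<and> A t = sob 1 (\<psi> t)" if "0 \<le> t" for t
      using A(2)[OF that] unfolding sum[OF that] by (auto intro: sobfinI simp: sob_def limI)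
    show "AE s in lborel. 0 < s \<and> s < T \<longrightarrow> a s = - 2 * L2_inner (\<psi> s) (\<omega>t s)" for T
      using A(3)[of T] by (simp add: L2_inner_minus)
  qed
qed

theorem bounds:
  defines "a \<equiv> lambda1 * min \<nu> \<mu>"
  defines "Y0 \<equiv> n * sob 1 (\<psi> 0) + sob 0 (\<rho> 0)"
  defines "KP \<equiv> (sob 2 (\<psi> 0) + Y0 / (\<mu> * (\<nu> * lambda1))) / \<nu>"
  assumes t: "0 \<le> t"
  shows "sobfin 3 (\<psi> t)" "sobfin 1 (\<rho> t)"
    "exp (a * t) * sob 1 (\<rho> t) \<le> 2 ^ nat \<lceil>2 * ((2 / \<mu> * 1600) * KP)\<rceil> * (sob 1 (\<rho> 0) + (2 / \<mu> * n\<^sup>2) / lambda1 * (Y0 / (n * \<nu>)))"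
    "exp (a * t) * sob 3 (\<psi> t) \<le> 2 ^ nat \<lceil>2 * ((2 / \<nu> * 1600) * KP)\<rceil> * (sob 3 (\<psi> 0) + 2 / \<nu> * (Y0 / \<mu>))"
proof -
  have om0: "sobfin 1 (Lap (\<psi> 0))" using sob_omega(2)[of 0 1] init(1) by (simp add: numeral_3_eq_3)
  from mean_square_and_gradient(1)[OF dt(1) om0 H2(1) rates_dominated(1)] obtain W w' where W: "prim W w'" "\<And>t. 0 \<le> t \<Longrightarrow> sobfin 0 (Lap (\<psi> t)) \<and> W t = sob 0 (Lap (\<psi> t))"
    "\<And>T. AE s in lborel. 0 < s \<and> s < T \<longrightarrow> w' s = 2 * L2_inner (Lap (\<psi> s)) (\<omega>t s)" by blast
  from mean_square_and_gradient(2)[OF dt(1) om0 H2(1) rates_dominated(1)] obtain P p' where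
    P: "prim P p'" "\<And>t. 0 \<le> t \<Longrightarrow> sobfin 1 (Lap (\<psi> t)) \<and> P t = sob 1 (Lap (\<psi> t))"
    "\<And>T. AE s in lborel. 0 < s \<and> s < T \<longrightarrow> p' s = - 2 * L2_inner (Lap (Lap (\<psi> s))) (\<omega>t s)" by blast
  from mean_square_and_gradient(1)[OF dt(2) init(2) H2(2) rates_dominated(2)] obtain R r' where R: "prim R r'" "\<And>t. 0 \<le> t \<Longrightarrow> sobfin 0 (\<rho> t) \<and> R t = sob 0 (\<rho> t)"
    "\<And>T. AE s in lborel. 0 < s \<and> s < T \<longrightarrow> r' s = 2 * L2_inner (\<rho> s) (\<rho>t s)" by blast
  from mean_square_and_gradient(2)[OF dt(2) init(2) H2(2) rates_dominated(2)] obtain Q q' where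
    Q: "prim Q q'" "\<And>t. 0 \<le> t \<Longrightarrow> sobfin 1 (\<rho> t) \<and> Q t = sob 1 (\<rho> t)"
    "\<And>T. AE s in lborel. 0 < s \<and> s < T \<longrightarrow> q' s = - 2 * L2_inner (Lap (\<rho> s)) (\<rho>t s)" by blast
  obtain A a' where A: "prim A a'" "\<And>t. 0 \<le> t \<Longrightarrow> sobfin 1 (\<psi> t) \<and> A t = sob 1 (\<psi> t)"
    "\<And>T. AE s in lborel. 0 < s \<and> s < T \<longrightarrow> a' s = - 2 * L2_inner (\<psi> s) (\<omega>t s)"
    by (rule stream_function_energy) blast
  have W2: "W t = sob 2 (\<psi> t)" and P3: "P t = sob 3 (\<psi> t)" and P3f: "sobfin 3 (\<psi> t)" if "0 \<le> t" for t
    using W(2)[OF that] P(2)[OF that] sob_omega[OF that, of 0] sob_omega[OF that, of 1]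
    by (simp_all add: numeral_2_eq_2 numeral_3_eq_3)
  have pos: "0 \<le> A t \<and> 0 \<le> W t \<and> 0 \<le> P t \<and> 0 \<le> R t \<and> 0 \<le> Q t" if "0 \<le> t" for t
    using A(2)[OF that] W(2)[OF that] P(2)[OF that] R(2)[OF that] Q(2)[OF that] sob_nonneg by auto
  have poin: "lambda1 * A t \<le> W t \<and> lambda1 * R t \<le> Q t" if "0 \<le> t" for t
    using sobfin_Suc(2)[OF psi_zero_mean[OF that], of 1] H2_per0_props(4)[OF psi[OF that]]
      sobfin_Suc(2)[OF coef_zero_mean[OF rho[OF that]], of 0] A(2)[OF that] W2[OF that] R(2)[OF that] Q(2)[OF that]
    by (simp flip: numeral_2_eq_2)
  have ineqs: "AE s in lborel. 0 < s \<and> s < T \<longrightarrow>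
      n * a' s + r' s \<le> - 2 * (n * \<nu> * W s + \<mu> * Q s) \<and>
      w' s \<le> - \<nu> * P s + Q s / (\<nu> * lambda1) \<and>
      q' s \<le> - (\<mu> * lambda1) * Q s + (2 / \<mu> * 1600) * (P s * Q s) + (2 / \<mu> * n\<^sup>2) * A s \<and>
      p' s \<le> - (\<nu> * lambda1) * P s + (2 / \<nu> * 1600) * (P s * P s) + 2 / \<nu> * Q s" for T
    using almost_all_good[of T] A(3)[of T] R(3)[of T] W(3)[of T] Q(3)[of T] P(3)[of T]
  proof eventually_elim
    case (elim s)
    show ?case
    proof
      assume s: "0 < s \<and> s < T"
      then have s0: "0 \<le> s" by simp
      from elim s have \<omega>: "transport \<nu> 1 (\<psi> s) (Lap (\<psi> s)) (Dx (\<rho> s)) (\<omega>t s)"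
        and \<rho>: "transport \<mu> (- n) (\<psi> s) (\<rho> s) (Dx (\<psi> s)) (\<rho>t s)" by (simp_all add: good_def)
      have v: "A s = sob 1 (\<psi> s)" "W s = sob 2 (\<psi> s)" "P s = sob 3 (\<psi> s)" "sob 1 (Lap (\<psi> s)) = P s" "Q s = sob 1 (\<rho> s)"
        using A(2)[OF s0] W2[OF s0] P3[OF s0] P(2)[OF s0] Q(2)[OF s0] by simp_all
      have fr: "(L2_norm (Dx (\<psi> s)))\<^sup>2 \<le> A s" "(L2_norm (Dx (\<rho> s)))\<^sup>2 \<le> Q s"
        using Dx_norm_le[OF H2_per0_props(1)[OF psi[OF s0]]] A(2)[OF s0] Dx_norm_le[OF rho[OF s0]] Q(2)[OF s0] by auto
      have 1: "n * a' s + r' s \<le> - 2 * (n * \<nu> * W s + \<mu> * Q s)"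
        using energy_balance[OF \<omega> \<rho> psi[OF s0]] elim s v by simp
      have 2: "w' s \<le> - \<nu> * P s + Q s / (\<nu> * lambda1)"
        using enstrophy_rate[OF \<omega> rho[OF s0]] Q(2)[OF s0] elim s v by simp
      have "2 / \<mu> * (n\<^sup>2 * (L2_norm (Dx (\<psi> s)))\<^sup>2) \<le> 2 / \<mu> * (n\<^sup>2 * A s)"
        using fr par by (intro mult_left_mono) auto
      then have 3: "q' s \<le> - (\<mu> * lambda1) * Q s + (2 / \<mu> * 1600) * (P s * Q s) + (2 / \<mu> * n\<^sup>2) * A s"
        using transport.gradient_rate[OF \<rho>] elim s v by (simp add: mult.assoc)
      have "2 / \<nu> * (L2_norm (Dx (\<rho> s)))\<^sup>2 \<le> 2 / \<nu> * Q s"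
        using fr par by (intro mult_left_mono) auto
      then have "p' s \<le> - (\<nu> * lambda1) * P s + (2 / \<nu> * 1600) * (P s * P s) + 2 / \<nu> * Q s"
        using transport.gradient_rate[OF \<omega>] elim s v by (simp add: mult.assoc)
      with 1 2 3 show "n * a' s + r' s \<le> - 2 * (n * \<nu> * W s + \<mu> * Q s) \<and>
          w' s \<le> - \<nu> * P s + Q s / (\<nu> * lambda1) \<and>
          q' s \<le> - (\<mu> * lambda1) * Q s + (2 / \<mu> * 1600) * (P s * Q s) + (2 / \<mu> * n\<^sup>2) * A s \<and>
          p' s \<le> - (\<nu> * lambda1) * P s + (2 / \<nu> * 1600) * (P s * P s) + 2 / \<nu> * Q s" by blast
    qed
  qed
  have K: "0 \<le> 2 / \<mu> * 1600" "0 \<le> 2 / \<mu> * n\<^sup>2" "0 \<le> 2 / \<nu> * 1600" "0 \<le> 2 / \<nu>"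
    using par by auto
  have start: "A 0 = sob 1 (\<psi> 0)" "W 0 = sob 2 (\<psi> 0)" "P 0 = sob 3 (\<psi> 0)" "R 0 = sob 0 (\<rho> 0)" "Q 0 = sob 1 (\<rho> 0)"
    using A(2)[of 0] W2[of 0] P3[of 0] R(2)[of 0] Q(2)[of 0] by simp_all
  note d = decay[OF par(1,3,2) A(1) W(1) P(1) R(1) Q(1) pos poin ineqs K t]
  show "exp (a * t) * sob 1 (\<rho> t) \<le> 2 ^ nat \<lceil>2 * ((2 / \<mu> * 1600) * KP)\<rceil> * (sob 1 (\<rho> 0) + (2 / \<mu> * n\<^sup>2) / lambda1 * (Y0 / (n * \<nu>)))"
    using d(1) Q(2)[OF t] unfolding start a_def KP_def Y0_def by simp
  show "exp (a * t) * sob 3 (\<psi> t) \<le> 2 ^ nat \<lceil>2 * ((2 / \<nu> * 1600) * KP)\<rceil> * (sob 3 (\<psi> 0) + 2 / \<nu> * (Y0 / \<mu>))"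
    using d(2) P3[OF t] unfolding start a_def KP_def Y0_def by simp
  show "sobfin 3 (\<psi> t)" by (rule P3f[OF t])
  show "sobfin 1 (\<rho> t)" using Q(2)[OF t] by blast
qed

end

text \<open>The data are prescribed almost everywhere only, so they agree with the values at time zero
  in their coefficients, and hence in all seminorms.\<close>
lemma is_solution_locale:
  assumes par: "\<nu> > 0" "N\<^sup>2 > 0" "Pr > 0" and init: "\<psi>\<^sub>0 \<in> H_per0 3" "\<rho>\<^sub>0 \<in> H_per0 1"
    and sol: "is_solution \<nu> N Pr \<psi>\<^sub>0 \<rho>\<^sub>0 \<psi> \<rho>"
  obtains \<omega>t \<rho>t where "solution \<nu> (N\<^sup>2) (\<nu> / Pr) \<psi> \<rho> \<omega>t \<rho>t"
    "coef (\<psi> 0) = coef \<psi>\<^sub>0" "coef (\<rho> 0) = coef \<rho>\<^sub>0"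
proof -
  have ini: "\<psi>\<^sub>0 \<in> L2_per0" "sobfin 3 \<psi>\<^sub>0" "\<rho>\<^sub>0 \<in> L2_per0" "sobfin 1 \<rho>\<^sub>0"
    using init by (auto simp only: H_per0_iff)
  have "\<psi> 0 \<in> L2_per0" "\<rho> 0 \<in> L2_per0"
    using sol H2_per0_props(1) unfolding is_solution_def by blast+
  then have c0: "coef (\<psi> 0) = coef \<psi>\<^sub>0" "coef (\<rho> 0) = coef \<rho>\<^sub>0"
    using sol ini unfolding is_solution_def by (auto intro!: coef_cong_AE L2_per0_L2)
  obtain \<omega>t \<rho>t where s: "has_time_derivative (\<lambda>t. Lap (\<psi> t)) \<omega>t" "has_time_derivative \<rho> \<rho>t"
    "AE t in lborel. 0 < t \<longrightarrow> (AE p in lborel.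
           \<omega>t t p + Jac (Lap (\<psi> t)) (\<psi> t) p = Dx (\<rho> t) p + \<nu> * Lap (Lap (\<psi> t)) p \<and>
           \<rho>t t p + Jac (\<rho> t) (\<psi> t) p = - N\<^sup>2 * Dx (\<psi> t) p + \<nu> / Pr * Lap (\<rho> t) p)"
    using sol unfolding is_solution_def by blast
  have "solution \<nu> (N\<^sup>2) (\<nu> / Pr) \<psi> \<rho> \<omega>t \<rho>t"
  proof
    show "sobfin 3 (\<psi> 0)" "sobfin 1 (\<rho> 0)" using ini sob_cong(2) c0 by blast+
  qed (use sol par s in \<open>simp_all add: is_solution_def\<close>)
  then show ?thesis using c0 by (rule that)
qed

text \<open>The constants are those of \<open>decay\<close>; they involve the seminorms of the initial data, and so
  they are the same for all solutions.\<close>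
theorem solution_bounds:
  fixes \<nu> N Pr :: real and \<psi>\<^sub>0 \<rho>\<^sub>0 :: field
  assumes par: "\<nu> > 0" "N\<^sup>2 > 0" "Pr > 0" and init: "\<psi>\<^sub>0 \<in> H_per0 3" "\<rho>\<^sub>0 \<in> H_per0 1"
  obtains KQ KP where "\<And>\<psi> \<rho> t. is_solution \<nu> N Pr \<psi>\<^sub>0 \<rho>\<^sub>0 \<psi> \<rho> \<Longrightarrow> 0 \<le> t \<Longrightarrow>
    \<psi> t \<in> H2_per0 \<and> \<psi> t \<in> H_per0 3 \<and> \<rho> t \<in> H_per0 1 \<and>
    exp (lambda1 * min \<nu> (\<nu> / Pr) * t) * sob 1 (\<rho> t) \<le> KQ \<and> exp (lambda1 * min \<nu> (\<nu> / Pr) * t) * sob 3 (\<psi> t) \<le> KP"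
proof -
  define Y0 where "Y0 = N\<^sup>2 * sob 1 \<psi>\<^sub>0 + sob 0 \<rho>\<^sub>0"
  define \<mu> where "\<mu> = \<nu> / Pr"
  define KI where "KI = (sob 2 \<psi>\<^sub>0 + Y0 / (\<mu> * (\<nu> * lambda1))) / \<nu>"
  define KQ where "KQ = 2 ^ nat \<lceil>2 * ((2 / \<mu> * 1600) * KI)\<rceil> * (sob 1 \<rho>\<^sub>0 + (2 / \<mu> * (N\<^sup>2)\<^sup>2) / lambda1 * (Y0 / (N\<^sup>2 * \<nu>)))"
  define KP where "KP = 2 ^ nat \<lceil>2 * ((2 / \<nu> * 1600) * KI)\<rceil> * (sob 3 \<psi>\<^sub>0 + 2 / \<nu> * (Y0 / \<mu>))"
  show ?thesis
  proof (rule that[of KQ KP])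
    fix \<psi> \<rho> and t :: real
    assume sol: "is_solution \<nu> N Pr \<psi>\<^sub>0 \<rho>\<^sub>0 \<psi> \<rho>" and t: "0 \<le> t"
    obtain \<omega>t \<rho>t where "solution \<nu> (N\<^sup>2) (\<nu> / Pr) \<psi> \<rho> \<omega>t \<rho>t" and c0: "coef (\<psi> 0) = coef \<psi>\<^sub>0" "coef (\<rho> 0) = coef \<rho>\<^sub>0"
      by (rule is_solution_locale[OF par init sol]) blast
    then interpret solution \<nu> "N\<^sup>2" "\<nu> / Pr" \<psi> \<rho> \<omega>t \<rho>t by simp
    show "\<psi> t \<in> H2_per0 \<and> \<psi> t \<in> H_per0 3 \<and> \<rho> t \<in> H_per0 1 \<and>
      exp (lambda1 * min \<nu> (\<nu> / Pr) * t) * sob 1 (\<rho> t) \<le> KQ \<and> exp (lambda1 * min \<nu> (\<nu> / Pr) * t) * sob 3 (\<psi> t) \<le> KP"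
      using bounds[OF t] psi[OF t] rho[OF t] H2_per0_props(1)[OF psi[OF t]]
      unfolding H_per0_iff sob_cong(1)[OF c0(1)] sob_cong(1)[OF c0(2)] KQ_def KP_def KI_def Y0_def \<mu>_def by blast
  qed
qed

lemma sqrt_exp_bound:
  assumes "exp (a * t) * x \<le> (K::real)" shows "sqrt x \<le> sqrt K * exp (- (a / 2) * t)"
proof -
  have "x = exp (- (a * t)) * (exp (a * t) * x)" by (simp flip: mult.assoc exp_add)
  also have "\<dots> \<le> exp (- (a * t)) * K" by (intro mult_left_mono assms) simp
  finally have "sqrt x \<le> sqrt (exp (- (a * t)) * K)" by (rule real_sqrt_le_mono)
  also have "exp (- (a * t)) = (exp (- (a / 2) * t))\<^sup>2" by (simp flip: exp_double)
  finally show ?thesis by (simp add: real_sqrt_mult mult.commute)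
qed

theorem theorem2p5:
  fixes \<nu> N Pr :: real and \<psi>\<^sub>0 \<rho>\<^sub>0 :: field
  assumes "\<nu> > 0" and "N\<^sup>2 > 0" and "Pr > 0"
    and "\<psi>\<^sub>0 \<in> H_per0 3" and "\<rho>\<^sub>0 \<in> H_per0 1"
  shows "(\<exists>C>0. \<exists>\<kappa>>0. \<forall>\<psi> \<rho>. is_solution \<nu> N Pr \<psi>\<^sub>0 \<rho>\<^sub>0 \<psi> \<rho> \<longrightarrow>
            (\<forall>t\<ge>0. \<psi> t \<in> H_per0 3 \<and> \<rho> t \<in> H_per0 1 \<and>
               H_norm 3 (\<psi> t) + H_norm 1 (\<rho> t) \<le> C * exp (- \<kappa> * t))) \<and>
         (\<exists>T>0. \<exists>M>0. \<exists>C>0. \<exists>\<kappa>>0. \<forall>\<psi> \<rho>. is_solution \<nu> N Pr \<psi>\<^sub>0 \<rho>\<^sub>0 \<psi> \<rho> \<longrightarrow>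
            (\<forall>t. 0 \<le> t \<and> t \<le> T \<longrightarrow>
               grad_norm (\<rho> t) \<le> M \<and> grad_norm (Lap (\<psi> t)) \<le> M) \<and>
            (\<forall>t>T. grad_norm (\<rho> t) \<le> C * exp (- \<kappa> * t) \<and>
               grad_norm (Lap (\<psi> t)) \<le> C * exp (- \<kappa> * t)))"
proof -
  define \<kappa> where "\<kappa> = lambda1 * min \<nu> (\<nu> / Pr) / 2"
  have kap: "0 < \<kappa>" using assms lambda1_pos by (simp add: \<kappa>_def)
  obtain KQ KP where b: "\<And>\<psi> \<rho> t. is_solution \<nu> N Pr \<psi>\<^sub>0 \<rho>\<^sub>0 \<psi> \<rho> \<Longrightarrow> 0 \<le> t \<Longrightarrow>
      \<psi> t \<in> H2_per0 \<and> \<psi> t \<in> H_per0 3 \<and> \<rho> t \<in> H_per0 1 \<and>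
      exp (lambda1 * min \<nu> (\<nu> / Pr) * t) * sob 1 (\<rho> t) \<le> KQ \<and> exp (lambda1 * min \<nu> (\<nu> / Pr) * t) * sob 3 (\<psi> t) \<le> KP"
    by (rule solution_bounds[OF assms]) blast
  define c3 where "c3 = sqrt (card {(i, j). i + j \<le> (3::nat)})"
  define c1 where "c1 = sqrt (card {(i, j). i + j \<le> (1::nat)})"
  \<comment> \<open>One constant for the Sobolev norms and for both gradients; the last summand makes it positive.\<close>
  define C where "C = \<bar>c3 * sqrt KP + c1 * sqrt KQ\<bar> + \<bar>sqrt KP\<bar> + \<bar>sqrt KQ\<bar> + 1"
  have C: "0 < C" unfolding C_def by linarith
  have main: "\<psi> t \<in> H_per0 3 \<and> \<rho> t \<in> H_per0 1 \<and> H_norm 3 (\<psi> t) + H_norm 1 (\<rho> t) \<le> C * exp (- \<kappa> * t) \<and>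
      grad_norm (\<rho> t) \<le> C * exp (- \<kappa> * t) \<and> grad_norm (Lap (\<psi> t)) \<le> C * exp (- \<kappa> * t)"
    if sol: "is_solution \<nu> N Pr \<psi>\<^sub>0 \<rho>\<^sub>0 \<psi> \<rho>" and t: "0 \<le> t" for \<psi> \<rho> t
  proof -
    have s: "\<psi> t \<in> H_per0 3" "\<rho> t \<in> H_per0 1" "\<psi> t \<in> H2_per0"
      "exp (lambda1 * min \<nu> (\<nu> / Pr) * t) * sob 1 (\<rho> t) \<le> KQ" "exp (lambda1 * min \<nu> (\<nu> / Pr) * t) * sob 3 (\<psi> t) \<le> KP"
      using b[OF sol t] by auto
    have P: "\<psi> t \<in> L2_per0" "sobfin 3 (\<psi> t)" and R: "\<rho> t \<in> L2_per0" "sobfin 1 (\<rho> t)"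
      using s(1,2) unfolding H_per0_iff by auto
    note L = H2_per0_props[OF s(3)]
    have sp: "sqrt (sob 3 (\<psi> t)) \<le> sqrt KP * exp (- \<kappa> * t)" and sr: "sqrt (sob 1 (\<rho> t)) \<le> sqrt KQ * exp (- \<kappa> * t)"
      unfolding \<kappa>_def
      by (rule sqrt_exp_bound[OF s(5)], rule sqrt_exp_bound[OF s(4)])
    have "H_norm 3 (\<psi> t) \<le> c3 * (sqrt KP * exp (- \<kappa> * t))" "H_norm 1 (\<rho> t) \<le> c1 * (sqrt KQ * exp (- \<kappa> * t))"
      unfolding c3_def c1_def
      by (rule order_trans[OF H_norm_le[OF P]], intro mult_left_mono sp, simp)
         (rule order_trans[OF H_norm_le[OF R]], intro mult_left_mono sr, simp)
    then have "H_norm 3 (\<psi> t) + H_norm 1 (\<rho> t) \<le> (c3 * sqrt KP + c1 * sqrt KQ) * exp (- \<kappa> * t)"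
      by (simp add: algebra_simps)
    also have "\<dots> \<le> C * exp (- \<kappa> * t)"
      unfolding C_def by (intro mult_right_mono) auto
    finally have H: "H_norm 3 (\<psi> t) + H_norm 1 (\<rho> t) \<le> C * exp (- \<kappa> * t)" .
    have g1: "grad_norm (\<rho> t) = sqrt (sob 1 (\<rho> t))"
      using grad_norm_sq[OF R] by (metis real_sqrt_unique grad_norm_def real_sqrt_ge_zero sum_power2_ge_zero)
    have om: "sob 1 (Lap (\<psi> t)) = sob 3 (\<psi> t)" "sobfin 1 (Lap (\<psi> t))"
      using sob_Lap[OF L(3), of 1] P(2) by (simp_all add: numeral_3_eq_3)
    have g2: "grad_norm (Lap (\<psi> t)) = sqrt (sob 3 (\<psi> t))"
      using grad_norm_sq[OF L(2) om(2)] om(1) by (metis real_sqrt_unique grad_norm_def real_sqrt_ge_zero sum_power2_ge_zero)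
    have e: "sqrt KP * exp (- \<kappa> * t) \<le> C * exp (- \<kappa> * t)" "sqrt KQ * exp (- \<kappa> * t) \<le> C * exp (- \<kappa> * t)"
      unfolding C_def by (intro mult_right_mono; simp)+
    show ?thesis
      using s(1,2) H order_trans[OF sp e(1)] order_trans[OF sr e(2)] unfolding g1 g2 by blast
  qed
  have bd: "C * exp (- \<kappa> * t) \<le> C" if "0 \<le> t" for t
    using kap C that by (simp add: mult_le_cancel_left1)
  show ?thesis
  proof (intro conjI)
    show "\<exists>C>0. \<exists>\<kappa>>0. \<forall>\<psi> \<rho>. is_solution \<nu> N Pr \<psi>\<^sub>0 \<rho>\<^sub>0 \<psi> \<rho> \<longrightarrow>
            (\<forall>t\<ge>0. \<psi> t \<in> H_per0 3 \<and> \<rho> t \<in> H_per0 1 \<and>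
               H_norm 3 (\<psi> t) + H_norm 1 (\<rho> t) \<le> C * exp (- \<kappa> * t))"
      using C kap main by blast
    \<comment> \<open>The estimates start at time zero, so any \<open>T\<close> will do; here \<open>T = 1\<close>.\<close>
    have "\<forall>\<psi> \<rho>. is_solution \<nu> N Pr \<psi>\<^sub>0 \<rho>\<^sub>0 \<psi> \<rho> \<longrightarrow>
            (\<forall>t. 0 \<le> t \<and> t \<le> 1 \<longrightarrow> grad_norm (\<rho> t) \<le> C \<and> grad_norm (Lap (\<psi> t)) \<le> C) \<and>
            (\<forall>t>1. grad_norm (\<rho> t) \<le> C * exp (- \<kappa> * t) \<and> grad_norm (Lap (\<psi> t)) \<le> C * exp (- \<kappa> * t))"
      using main bd by (meson less_imp_le order_trans zero_le_one)
    then show "\<exists>T>0. \<exists>M>0. \<exists>C>0. \<exists>\<kappa>>0. \<forall>\<psi> \<rho>. is_solution \<nu> N Pr \<psi>\<^sub>0 \<rho>\<^sub>0 \<psi> \<rho> \<longrightarrow>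
            (\<forall>t. 0 \<le> t \<and> t \<le> T \<longrightarrow>
               grad_norm (\<rho> t) \<le> M \<and> grad_norm (Lap (\<psi> t)) \<le> M) \<and>
            (\<forall>t>T. grad_norm (\<rho> t) \<le> C * exp (- \<kappa> * t) \<and>
               grad_norm (Lap (\<psi> t)) \<le> C * exp (- \<kappa> * t))"
      using C kap zero_less_one by blast
  qed
qed

end
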